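(* Let $V\subset\mathbb R^d$ be a discrete set, $A:V\times V\to\mathbb R$ a symmetric weight, $G$ the (locally finite) graph with vertices $V$ and edges $\{(x,y):A(x,y)\neq0\}$, and fix $x\in V$. For any function $u:\{x\}\cup\{y:x\sim y\}\to\mathbb R$ there holds $$|\partial^{\mathrm{prox}}u(x)|\le C_{\mathcal V_x}(\Delta_Au(x))^d.\qquad(I)$$ The following are equivalent for a function $u:\{x\}\cup\{y:x\sim y\}\to\mathbb R$, where $F^{\mathrm{prox}}_{x,y}$ denotes the face of $\partial^{\mathrm{prox}}u(x)$ with normal vector $\frac{y-x}{|y-x|}$: (a) $u$ achieves equality in $(I)$. (b) For each $y\sim x$ there holds $$\frac{\mathcal H^{d-1}(F^{\mathrm{prox}}_{x,y})}{|\Delta_Au(x)|^{d-1}}=d\,C_{\mathcal V_x}|y-x|A^2(x,y).$$ (c) There exists a constant $\tilde\alpha_{\mathcal V_x}$ such that for each $y\sim x$ $$\frac{\mathcal H^{d-1}(F^{\mathrm{prox}}_{x,y})}{|y-x|A^2(x,y)}=\tilde\alpha_{\mathcal V_x}.$$ Moreover the following conditions are equivalent: 1. There exists a function $u:\{x\}\cup\{y:x\sim y\}\to\mathbb R$ such that equality is achieved in $(I)$. 2. $\mathrm{Span}\{y-x:y\sim x\}=\mathbb R^d$ and $\sum_{y:y\sim x}(y-x)A^2(x,y)=0$. 3. $\mathrm{Span}\{y-x:y\sim x\}=\mathbb R^d$ and $\Delta_A$ has linear precision at $x$, i.e. $\Delta_A\ell(x)=0$ for each $\ell:\{x\}\cup\{y:y\sim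 x\}\to\mathbb R$ which is the restriction of an affine function. Moreover, if $u$ achieving the equality in $(I)$ exists, then it is unique up to summing to it the restriction of an affine function.
   Context: $|\cdot|$ of a set is Lebesgue measure on $\mathbb R^d$; $\mathcal H^{d-1}$ is Hausdorff measure. $x\sim y$ means $A(x,y)\neq0$. $\Delta_Au(x):=\sum_{y\sim x}A^2(x,y)(u(y)-u(x))$. $\partial^{\mathrm{prox}}u(x):=\{p\in\mathbb R^d:\forall z\sim x,\ u(x)\le u(z)+p\cdot(x-z)\}$. $\mathcal V_x:=\{(y-x)A^2(x,y):A(x,y)\neq0\}$. For a finite $\mathcal V\subset\mathbb R^d$, $C_{\mathcal V}:=\max\{|\bigcap_{v\in\mathcal V}\{p:\langle p,v\rangle\le c_v\}|:(c_v)\in\mathbb R^{\mathcal V},\ \sum_{v\in\mathcal V}c_v=1\}$ (read as a supremum in $[0,+\infty]$ if no maximum exists).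
   Formalization: x has a neighbour and no loop; C counts equal vectors separately; (I) uses max(Δu,0), void if C=∞; equality is positive and finite; (a)-(c) need distinct directions; (b) needs Δu≠0, C<∞; (c) needs constant>0 and, if d=1, 0<|∂u|<∞; uniqueness is also up to scaling. *)

theory Defs
  imports "HOL-Analysis.Analysis"
begin

text \<open>
  Hausdorff measure is normalised by the volume of the unit ball, so that on \<open>\<real>\<^sup>s\<close> it is Lebesgue measure.
  The empty set has weight 0 also for \<open>s = 0\<close>, where every nonempty set has weight 1;
  hence \<open>hausdorff_measure 0\<close> is the counting measure.
  Unbounded sets are excluded from the coverings because \<^const>\<open>diameter\<close> is unspecified on them.
\<close>

definition hausdorff_weight :: "nat \<Rightarrow> 'a::metric_space set \<Rightarrow> ennreal" where
  "hausdorff_weight s U =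
     (if U = {} then 0 else ennreal (unit_ball_vol (real s) * (diameter U / 2) ^ s))"

definition hausdorff_premeasure :: "nat \<Rightarrow> real \<Rightarrow> 'a::metric_space set \<Rightarrow> ennreal" where
  "hausdorff_premeasure s \<delta> S =
     (INF U \<in> {U :: nat \<Rightarrow> 'a set. S \<subseteq> (\<Union>i. U i) \<and> (\<forall>i. bounded (U i) \<and> diameter (U i) \<le> \<delta>)}.
        \<Sum>i. hausdorff_weight s (U i))"

definition hausdorff_measure :: "nat \<Rightarrow> 'a::metric_space set \<Rightarrow> ennreal" where
  "hausdorff_measure s S = (SUP \<delta> \<in> {0<..}. hausdorff_premeasure s \<delta> S)"

text \<open>
  The edges are the pairs of vertices of nonzero weight. Functions on the star
  \<open>{x} \<union> {y. x \<sim> y}\<close> are represented by total functions; only their values on the star matter.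
\<close>

definition nbrs :: "'a set \<Rightarrow> ('a \<Rightarrow> 'a \<Rightarrow> real) \<Rightarrow> 'a \<Rightarrow> 'a set" where
  "nbrs V A x = {y \<in> V. A x y \<noteq> 0}"

definition star :: "'a set \<Rightarrow> ('a \<Rightarrow> 'a \<Rightarrow> real) \<Rightarrow> 'a \<Rightarrow> 'a set" where
  "star V A x = insert x (nbrs V A x)"

definition graph_laplacian ::
    "'a set \<Rightarrow> ('a \<Rightarrow> 'a \<Rightarrow> real) \<Rightarrow> ('a \<Rightarrow> real) \<Rightarrow> 'a \<Rightarrow> real" where
  "graph_laplacian V A u x = (\<Sum>y \<in> nbrs V A x. (A x y)\<^sup>2 * (u y - u x))"

definition prox_subdiff ::
    "'a::euclidean_space set \<Rightarrow> ('a \<Rightarrow> 'a \<Rightarrow> real) \<Rightarrow> ('a \<Rightarrow> real) \<Rightarrow> 'a \<Rightarrow> 'a set" where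
  "prox_subdiff V A u x = {p. \<forall>z \<in> nbrs V A x. u x \<le> u z + p \<bullet> (x - z)}"

definition face_with_normal :: "'a::real_inner set \<Rightarrow> 'a \<Rightarrow> 'a set" where
  "face_with_normal P n = {p \<in> P. \<forall>q \<in> P. q \<bullet> n \<le> p \<bullet> n}"

definition prox_face ::
    "'a::euclidean_space set \<Rightarrow> ('a \<Rightarrow> 'a \<Rightarrow> real) \<Rightarrow> ('a \<Rightarrow> real) \<Rightarrow> 'a \<Rightarrow> 'a \<Rightarrow> 'a set" where
  "prox_face V A u x y =
     face_with_normal (prox_subdiff V A u x) ((1 / norm (y - x)) *\<^sub>R (y - x))"

definition affine_on :: "'a::real_inner set \<Rightarrow> ('a \<Rightarrow> real) \<Rightarrow> bool" where
  "affine_on S l \<longleftrightarrow> (\<exists>a b. \<forall>z \<in> S. l z = a \<bullet> z + b)"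

text \<open>
  The finite set of vectors is given as a family \<open>v\<close> indexed by \<open>I\<close>: the vectors
  \<open>(y - x) A\<^sup>2(x,y)\<close> of two different neighbours \<open>y\<close> of \<open>x\<close> may coincide, and then they have
  to be counted twice, as in the Laplacian. When they are distinct, this is the constant of
  the set of vectors, by the lemma below.
\<close>

definition polyhedron_const :: "'i set \<Rightarrow> ('i \<Rightarrow> 'a::euclidean_space) \<Rightarrow> ennreal" where
  "polyhedron_const I v =
     (SUP c \<in> {c :: 'i \<Rightarrow> real. (\<Sum>i\<in>I. c i) = 1}. emeasure lborel (\<Inter>i\<in>I. {p. p \<bullet> v i \<le> c i}))"

lemma polyhedron_const_image:
  fixes v :: "'i \<Rightarrow> 'a::euclidean_space"
  assumes inj: "inj_on v I"
  shows "polyhedron_const I v = polyhedron_const (v ` I) (\<lambda>w. w)"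
proof (rule antisym)
  show "polyhedron_const I v \<le> polyhedron_const (v ` I) (\<lambda>w. w)"
    unfolding polyhedron_const_def
  proof (rule SUP_mono)
    fix c :: "'i \<Rightarrow> real" assume c: "c \<in> {c. (\<Sum>i\<in>I. c i) = 1}"
    define c' where "c' = c \<circ> inv_into I v"
    have eq: "c' (v i) = c i" if "i \<in> I" for i
      using that inj by (simp add: c'_def)
    have "(\<Sum>w\<in>v ` I. c' w) = 1"
      using c inj eq by (simp add: sum.reindex)
    moreover have "(\<Inter>i\<in>I. {p. p \<bullet> v i \<le> c i}) = (\<Inter>w\<in>v ` I. {p. p \<bullet> w \<le> c' w})"
      using eq by auto
    ultimately show "\<exists>c'\<in>{c. (\<Sum>w\<in>v ` I. c w) = 1}.
        emeasure lborel (\<Inter>i\<in>I. {p. p \<bullet> v i \<le> c i})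
          \<le> emeasure lborel (\<Inter>w\<in>v ` I. {p. p \<bullet> w \<le> c' w})"
      by (intro bexI[of _ c']) auto
  qed
  show "polyhedron_const (v ` I) (\<lambda>w. w) \<le> polyhedron_const I v"
    unfolding polyhedron_const_def
  proof (rule SUP_mono)
    fix c :: "'a \<Rightarrow> real" assume c: "c \<in> {c. (\<Sum>w\<in>v ` I. c w) = 1}"
    then show "\<exists>c'\<in>{c. (\<Sum>i\<in>I. c i) = 1}.
        emeasure lborel (\<Inter>w\<in>v ` I. {p. p \<bullet> w \<le> c w})
          \<le> emeasure lborel (\<Inter>i\<in>I. {p. p \<bullet> v i \<le> c' i})"
      using inj by (intro bexI[of _ "c \<circ> v"]) (auto simp: sum.reindex)
  qed
qed

definition star_const :: "'a::euclidean_space set \<Rightarrow> ('a \<Rightarrow> 'a \<Rightarrow> real) \<Rightarrow> 'a \<Rightarrow> ennreal" where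
  "star_const V A x = polyhedron_const (nbrs V A x) (\<lambda>y. (A x y)\<^sup>2 *\<^sub>R (y - x))"

text \<open>
  The right-hand side \<open>C (\<Delta>u(x))\<^sup>d\<close> is read as follows. If \<open>C = \<infinity>\<close> it is \<open>\<infinity>\<close>, whatever the
  Laplacian: a subdifferential of positive measure may then occur with \<open>\<Delta>u(x) \<le> 0\<close>.
  If \<open>C < \<infinity>\<close> the subdifferential is empty when \<open>\<Delta>u(x) < 0\<close>, and the power is that of the
  positive part (the signed power would make the inequality false for odd \<open>d\<close>).
\<close>

definition prox_bound ::
    "'a::euclidean_space set \<Rightarrow> ('a \<Rightarrow> 'a \<Rightarrow> real) \<Rightarrow> ('a \<Rightarrow> real) \<Rightarrow> 'a \<Rightarrow> ennreal" where
  "prox_bound V A u x =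
     (if star_const V A x = \<infinity> then \<infinity>
      else star_const V A x * ennreal (max 0 (graph_laplacian V A u x) ^ DIM('a)))"

definition prox_nondegenerate ::
    "'a::euclidean_space set \<Rightarrow> ('a \<Rightarrow> 'a \<Rightarrow> real) \<Rightarrow> ('a \<Rightarrow> real) \<Rightarrow> 'a \<Rightarrow> bool" where
  "prox_nondegenerate V A u x \<longleftrightarrow>
     0 < emeasure lborel (prox_subdiff V A u x) \<and> emeasure lborel (prox_subdiff V A u x) < \<infinity>"

text \<open>
  Equality is meant between positive real numbers: neither \<open>\<infinity> = \<infinity>\<close> nor \<open>0 = 0\<close> counts
  (the latter holds for every affine \<open>u\<close>).
\<close>

definition achieves_equality ::
    "'a::euclidean_space set \<Rightarrow> ('a \<Rightarrow> 'a \<Rightarrow> real) \<Rightarrow> ('a \<Rightarrow> real) \<Rightarrow> 'a \<Rightarrow> bool" where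
  "achieves_equality V A u x \<longleftrightarrow>
     prox_nondegenerate V A u x \<and>
     emeasure lborel (prox_subdiff V A u x) = prox_bound V A u x"

text \<open>
  The first two conjuncts say that the quotients are defined and that the right-hand sides
  are real numbers.
\<close>

definition facet_areas_sharp ::
    "'a::euclidean_space set \<Rightarrow> ('a \<Rightarrow> 'a \<Rightarrow> real) \<Rightarrow> ('a \<Rightarrow> real) \<Rightarrow> 'a \<Rightarrow> bool" where
  "facet_areas_sharp V A u x \<longleftrightarrow>
     graph_laplacian V A u x \<noteq> 0 \<and> star_const V A x < \<infinity> \<and>
     (\<forall>y \<in> nbrs V A x.
        hausdorff_measure (DIM('a) - 1) (prox_face V A u x y)
            / ennreal (\<bar>graph_laplacian V A u x\<bar> ^ (DIM('a) - 1))
          = of_nat DIM('a) * star_const V A x * ennreal (norm (y - x) * (A x y)\<^sup>2))"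

text \<open>
  The constant has to be nonzero: when the subdifferential is empty, all quotients are 0.
\<close>

definition facet_areas_proportional ::
    "'a::euclidean_space set \<Rightarrow> ('a \<Rightarrow> 'a \<Rightarrow> real) \<Rightarrow> ('a \<Rightarrow> real) \<Rightarrow> 'a \<Rightarrow> bool" where
  "facet_areas_proportional V A u x \<longleftrightarrow>
     (\<exists>\<alpha>::real. 0 < \<alpha> \<and>
        (\<forall>y \<in> nbrs V A x.
           hausdorff_measure (DIM('a) - 1) (prox_face V A u x y)
             / ennreal (norm (y - x) * (A x y)\<^sup>2) = ennreal \<alpha>))"

end

theory Submission
  imports Defs
begin

text \<open>
  The subdifferential at \<open>x\<close> is the polyhedron \<open>cell I v c\<close> of all \<open>p\<close> with \<open>p \<bullet> v y \<le> c y\<close> for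
  every neighbour \<open>y\<close>, where \<open>v y = A(x,y)\<^sup>2 (y - x)\<close> and \<open>c y = A(x,y)\<^sup>2 (u y - u x)\<close>. The heights
  \<open>c y\<close> are arbitrary numbers whose sum is the Laplacian, and adding an affine function to \<open>u\<close>
  translates the polyhedron. So the inequality is the definition of the constant together with
  scaling, and all other claims concern the maximizers of the volume among the cells whose heights
  have a given positive sum.

  Existence. A translation by \<open>t\<close> adds \<open>t \<bullet> (\<Sum>y. v y)\<close> to the sum of the heights, so the constant is
  infinite unless the vectors \<open>v y\<close> add up to 0 (\<open>polyhedron_const_finite_imp\<close>). If they do and span the
  space, the heights can be taken from a simplex, on which the volume is upper semicontinuous
  (\<open>polyhedron_const_attained\<close>).

  Facets. The derivative of the volume in the direction of the height \<open>c y\<close> is the area of the facet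
  divided by the norm of \<open>v y\<close> (\<open>facet_derivative\<close>). For a maximizer the volume after a change of
  \<open>c y\<close> by \<open>t\<close> is at most \<open>C (s + t)\<^sup>d\<close>, with equality at \<open>t = 0\<close>; hence the two derivatives agree
  (\<open>optimal_facet_area\<close>). Conversely, the logarithm of the volume is midpoint concave by the
  Brunn-Minkowski inequality, so it lies below its tangent plane (\<open>volume_tangent\<close>). If all
  partial derivatives are equal, the tangent plane depends on the sum of the heights only. Evaluated
  at translates, at a dilate and at heights of the same sum, the tangent inequality shows that the
  vectors add up to 0, that the sum of the heights is positive, and that the cell is a maximizer
  (\<open>equal_densities_optimal\<close>).

  Uniqueness. Two normalized maximizers \<open>K\<close> and \<open>K'\<close> and the cell \<open>M\<close> of the mean heights have equal
  volumes. Fix a unit vector \<open>n\<close>. By the Brunn-Minkowski inequality for the parts that half-spaces cut off,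
  the quantiles of \<open>x \<bullet> n\<close> on \<open>M\<close> are the means of those on \<open>K\<close> and \<open>K'\<close>. Differentiated, this is
  \<open>2 / a\<^sub>M = 1 / a\<^sub>K + 1 / a\<^sub>K'\<close> for the areas of the corresponding slices, while the Brunn-Minkowski
  inequality for slices gives \<open>a\<^sub>K a\<^sub>K' \<le> a\<^sub>M\<^sup>2\<close>. So \<open>a\<^sub>K = a\<^sub>K'\<close>, and the quantiles on \<open>K\<close>
  and \<open>K'\<close> differ by a constant (\<open>quantile_shift\<close>). It is the difference of the mean values of
  \<open>x \<bullet> n\<close>, hence linear in \<open>n\<close> (\<open>support_shift\<close>), so the heights of \<open>K\<close> and \<open>K'\<close> differ by a translation.

  Areas are volumes of cylinders of height one over slices (\<open>slice_area\<close>). With this choice the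
  Brunn-Minkowski inequality for slices is the one for volumes applied to cylinders, and Cavalieri's
  principle is an instance of Tonelli's theorem. That the area is Hausdorff measure follows from
  the isodiametric inequality in one direction and from Vitali's covering lemma in the other
  (\<open>hausdorff_measure_compact_slice\<close>).
\<close>

section \<open>The Brunn-Minkowski inequality\<close>

lemma emeasure_lborel_affine:
  fixes S :: "'a::euclidean_space set"
  assumes [measurable]: "S \<in> sets borel" and c: "c \<noteq> 0"
  shows "emeasure lborel S = ennreal (\<bar>c\<bar> ^ DIM('a)) * emeasure lborel {x. t + c *\<^sub>R x \<in> S}"
proof -
  have "emeasure lborel S = (\<integral>\<^sup>+x. indicator S x \<partial>lborel)" by simp
  also have "\<dots> = (\<integral>\<^sup>+x. ennreal (\<bar>c\<bar> ^ DIM('a)) * indicator {x. t + c *\<^sub>R x \<in> S} x \<partial>lborel)"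
    by (subst lborel_affine[OF c, of t])
       (simp add: nn_integral_density nn_integral_distr del: nn_integral_indicator,
        simp add: indicator_def)
  also have "\<dots> = ennreal (\<bar>c\<bar> ^ DIM('a)) * emeasure lborel {x. t + c *\<^sub>R x \<in> S}"
    by (subst nn_integral_cmult) (auto simp: nn_integral_indicator)
  finally show ?thesis .
qed

lemma emeasure_lborel_translate:
  fixes S :: "'a::euclidean_space set"
  assumes "S \<in> sets borel"
  shows "emeasure lborel {x. t + x \<in> S} = emeasure lborel S"
  using emeasure_lborel_affine[OF assms, of 1 t] by simp

lemma two_half: "2 * inverse 2 = (1::ennreal)"
proof -
  have "(2::ennreal) / 2 = 1" by (rule ennreal_divide_self) auto
  then show ?thesis by (simp only: divide_ennreal_def)
qed

text \<open>
  The midpoints of \<open>b\<close> with the part of \<open>A\<close> below \<open>a\<close>, and those of \<open>a\<close> with the part of \<open>B\<close> above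
  \<open>b\<close>, are copies of these parts at half the size. Both lie in \<open>M\<close>, on different sides of
  \<open>(a + b) / 2\<close>.
\<close>

lemma half_line_parts_le:
  fixes A B M :: "real set"
  assumes [measurable]: "A \<in> sets borel" "B \<in> sets borel" "M \<in> sets borel"
    and a: "a \<in> A" and b: "b \<in> B"
    and mid: "\<And>x y. x \<in> A \<Longrightarrow> y \<in> B \<Longrightarrow> (x + y) / 2 \<in> M"
  shows "emeasure lborel (A \<inter> {..a}) + emeasure lborel (B \<inter> {b..}) \<le> 2 * emeasure lborel M"
proof -
  define m where "m = (a + b) / 2"
  have "emeasure lborel (A \<inter> {..a}) \<le> emeasure lborel {x. b/2 + (1/2) *\<^sub>R x \<in> M \<inter> {..m}}"
    using mid[OF _ b] by (intro emeasure_mono) (auto simp: m_def add_divide_distrib add.commute)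
  also have "\<dots> = 2 * emeasure lborel (M \<inter> {..m})"
    by (subst emeasure_lborel_affine[of "M \<inter> {..m}" "1/2" "b/2"]) (auto simp: two_half mult.assoc[symmetric])
  finally have 1: "emeasure lborel (A \<inter> {..a}) \<le> 2 * emeasure lborel (M \<inter> {..m})" .
  have "emeasure lborel (B \<inter> {b..}) \<le> emeasure lborel {x. a/2 + (1/2) *\<^sub>R x \<in> M \<inter> {m..}}"
    using mid[OF a] by (intro emeasure_mono) (auto simp: m_def add_divide_distrib add.commute)
  also have "\<dots> = 2 * emeasure lborel (M \<inter> {m..})"
    by (subst emeasure_lborel_affine[of "M \<inter> {m..}" "1/2" "a/2"]) (auto simp: two_half mult.assoc[symmetric])
  also have "emeasure lborel (M \<inter> {m..}) = emeasure lborel (M \<inter> {m<..})"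
    by (intro emeasure_eq_AE AE_I[of _ _ "{m}"]) auto
  finally have 2: "emeasure lborel (B \<inter> {b..}) \<le> 2 * emeasure lborel (M \<inter> {m<..})" .
  have "emeasure lborel (M \<inter> {..m}) + emeasure lborel (M \<inter> {m<..}) = emeasure lborel M"
    by (subst plus_emeasure) (auto intro!: arg_cong[where f="emeasure lborel"])
  then show ?thesis
    using add_mono[OF 1 2] by (simp flip: distrib_left)
qed

text \<open>
  The points \<open>a\<close> and \<open>b\<close> of the preceding lemma are taken so close to the supremum of \<open>A\<close> and the
  infimum of \<open>B\<close> that only small parts are cut off.
\<close>

lemma midpoint_measure_real_bounded:
  fixes A B M :: "real set"
  assumes [measurable]: "A \<in> sets borel" "B \<in> sets borel" "M \<in> sets borel"
    and ne: "A \<noteq> {}" "B \<noteq> {}" and bd: "bdd_above A" "bdd_below B"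
    and mid: "\<And>x y. x \<in> A \<Longrightarrow> y \<in> B \<Longrightarrow> (x + y) / 2 \<in> M"
  shows "emeasure lborel A + emeasure lborel B \<le> 2 * emeasure lborel M"
proof (rule ennreal_le_epsilon)
  fix e :: real assume e: "0 < e"
  obtain a where a: "a \<in> A" "Sup A - e/2 < a"
    using less_cSup_iff[OF ne(1) bd(1), of "Sup A - e/2"] e by auto
  obtain b where b: "b \<in> B" "b < Inf B + e/2"
    using cInf_less_iff[OF ne(2) bd(2), of "Inf B + e/2"] e by auto
  have "emeasure lborel A \<le> emeasure lborel ((A \<inter> {..a}) \<union> {a .. a + e/2})"
    using a cSup_upper[OF _ bd(1)] by (intro emeasure_mono) (auto, smt (verit) field_sum_of_halves)
  also have "\<dots> \<le> emeasure lborel (A \<inter> {..a}) + ennreal (e/2)"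
    using emeasure_subadditive[of "A \<inter> {..a}" lborel "{a .. a + e/2}"] e by simp
  finally have A: "emeasure lborel A \<le> emeasure lborel (A \<inter> {..a}) + ennreal (e/2)" .
  have "emeasure lborel B \<le> emeasure lborel ((B \<inter> {b..}) \<union> {b - e/2 .. b})"
    using b cInf_lower[OF _ bd(2)] by (intro emeasure_mono) (auto, smt (verit) field_sum_of_halves)
  also have "\<dots> \<le> emeasure lborel (B \<inter> {b..}) + ennreal (e/2)"
    using emeasure_subadditive[of "B \<inter> {b..}" lborel "{b - e/2 .. b}"] e by simp
  finally have B: "emeasure lborel B \<le> emeasure lborel (B \<inter> {b..}) + ennreal (e/2)" .
  have "emeasure lborel A + emeasure lborel B
      \<le> (emeasure lborel (A \<inter> {..a}) + ennreal (e/2)) + (emeasure lborel (B \<inter> {b..}) + ennreal (e/2))"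
    by (rule add_mono[OF A B])
  also have "\<dots> = (emeasure lborel (A \<inter> {..a}) + emeasure lborel (B \<inter> {b..})) + (ennreal (e/2) + ennreal (e/2))"
    by (simp add: ac_simps)
  also have "ennreal (e/2) + ennreal (e/2) = ennreal e"
    using e by (subst ennreal_plus[symmetric]) auto
  also have "(emeasure lborel (A \<inter> {..a}) + emeasure lborel (B \<inter> {b..})) + ennreal e
      \<le> 2 * emeasure lborel M + ennreal e"
    by (intro add_mono half_line_parts_le[OF assms(1-3) a(1) b(1) mid]) auto
  finally show "emeasure lborel A + emeasure lborel B \<le> 2 * emeasure lborel M + ennreal e" .
qed

lemma midpoint_measure_real:
  fixes A B M :: "real set"
  assumes [measurable]: "A \<in> sets borel" "B \<in> sets borel" "M \<in> sets borel"
    and ne: "A \<noteq> {}" "B \<noteq> {}"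
    and mid: "\<And>x y. x \<in> A \<Longrightarrow> y \<in> B \<Longrightarrow> (x + y) / 2 \<in> M"
  shows "emeasure lborel A + emeasure lborel B \<le> 2 * emeasure lborel M"
proof -
  obtain a b where a: "a \<in> A" and b: "b \<in> B" using ne by auto
  define N where "N = nat \<lceil>max \<bar>a\<bar> \<bar>b\<bar>\<rceil>"
  define An Bn where "An n = A \<inter> {- real (n + N) .. real (n + N)}"
    and "Bn n = B \<inter> {- real (n + N) .. real (n + N)}" for n
  have N: "\<bar>a\<bar> \<le> real N" "\<bar>b\<bar> \<le> real N" unfolding N_def by linarith+
  have le: "emeasure lborel (An n) + emeasure lborel (Bn n) \<le> 2 * emeasure lborel M" for n
  proof (rule midpoint_measure_real_bounded)
    show "An n \<noteq> {}" "Bn n \<noteq> {}" using a b N by (auto simp: An_def Bn_def abs_le_iff intro!: exI[of _ a] exI[of _ b])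
    show "bdd_above (An n)" by (auto simp: An_def)
    show "bdd_below (Bn n)" by (auto simp: Bn_def)
  qed (auto simp: An_def Bn_def mid)
  have ex: "\<exists>n. - real (n + N) \<le> x \<and> x \<le> real (n + N)" for x
    by (intro exI[of _ "nat \<lceil>\<bar>x\<bar>\<rceil>"]) linarith
  have "(\<lambda>n. emeasure lborel (An n)) \<longlonglongrightarrow> emeasure lborel (\<Union>n. An n)"
    by (intro Lim_emeasure_incseq) (auto simp: An_def incseq_def)
  moreover have "(\<Union>n. An n) = A" using ex by (auto simp: An_def)
  moreover have "(\<lambda>n. emeasure lborel (Bn n)) \<longlonglongrightarrow> emeasure lborel (\<Union>n. Bn n)"
    by (intro Lim_emeasure_incseq) (auto simp: Bn_def incseq_def)
  moreover have "(\<Union>n. Bn n) = B" using ex by (auto simp: Bn_def)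
  ultimately have "(\<lambda>n. emeasure lborel (An n) + emeasure lborel (Bn n)) \<longlonglongrightarrow> emeasure lborel A + emeasure lborel B"
    by (intro tendsto_add) auto
  then show ?thesis by (rule LIMSEQ_le_const2) (use le in auto)
qed

text \<open>
  Tonelli's theorem for the region under the graph of \<open>f\<close>.
\<close>

lemma nn_integral_layers:
  fixes f :: "'a::euclidean_space \<Rightarrow> ennreal"
  assumes [measurable]: "f \<in> borel_measurable borel"
  shows "(\<integral>\<^sup>+x. f x \<partial>lborel) = (\<integral>\<^sup>+t. indicator {0<..} t * emeasure lborel {x. ennreal t < f x} \<partial>lborel)"
proof -
  have lay: "emeasure lborel {t. 0 < t \<and> ennreal t < y} = y" for y
  proof (cases y)
    case (real r)
    have "{t. 0 < t \<and> ennreal t < y} = {0<..<r}"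
      using real by (auto simp: ennreal_less_iff)
    then show ?thesis using real by simp
  next
    case top
    have "{t. 0 < t \<and> ennreal t < y} = {0<..}" using top by auto
    moreover have "emeasure lborel {0::real<..} = (\<infinity>::ennreal)"
    proof (rule ccontr)
      assume *: "emeasure lborel {0::real<..} \<noteq> \<infinity>"
      have "ennreal (real n) \<le> emeasure lborel {0::real<..}" for n
      proof -
        have "emeasure lborel {0<..real n} \<le> emeasure lborel {0::real<..}" by (rule emeasure_mono) auto
        then show ?thesis by simp
      qed
      with * show False
        by (metis ennreal_Ex_less_of_nat ennreal_of_nat_eq_real_of_nat infinity_ennreal_def leD less_top)
    qed
    ultimately show ?thesis using top by simp
  qed
  have "(\<integral>\<^sup>+x. f x \<partial>lborel) = (\<integral>\<^sup>+x. (\<integral>\<^sup>+t. indicator {t. 0 < t \<and> ennreal t < f x} t \<partial>lborel) \<partial>lborel)"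
    by (simp add: lay)
  also have "\<dots> = (\<integral>\<^sup>+t. (\<integral>\<^sup>+x. indicator {t. 0 < t \<and> ennreal t < f x} t \<partial>lborel) \<partial>lborel)"
    by (rule lborel_pair.Fubini') (simp add: indicator_def, measurable)
  also have "\<dots> = (\<integral>\<^sup>+t. (\<integral>\<^sup>+x. indicator {0<..} t * indicator {x. ennreal t < f x} x \<partial>lborel) \<partial>lborel)"
    by (intro nn_integral_cong) (auto simp: indicator_def)
  also have "\<dots> = (\<integral>\<^sup>+t. indicator {0<..} t * emeasure lborel {x. ennreal t < f x} \<partial>lborel)"
    by (intro nn_integral_cong, subst nn_integral_cmult) auto
  finally show ?thesis .
qed

lemma ennreal_arith_geo:
  fixes x y :: ennreal
  shows "4 * (x * y) \<le> (x + y)\<^sup>2"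
proof (cases "x = \<infinity> \<or> y = \<infinity>")
  case True
  then have "(x + y)\<^sup>2 = \<infinity>" by (auto simp: power2_eq_square)
  then show ?thesis by simp
next
  case False
  then obtain a b where ab: "x = ennreal a" "0 \<le> a" "y = ennreal b" "0 \<le> b"
    by (metis ennreal_cases infinity_ennreal_def)
  have "4 * (a * b) \<le> (a + b)\<^sup>2"
    using zero_le_power2[of "a - b"] by (simp add: power2_eq_square algebra_simps)
  then have "ennreal (4 * (a * b)) \<le> ennreal ((a + b)\<^sup>2)" by (rule ennreal_leI)
  then show ?thesis using ab
    by (simp add: ennreal_mult ennreal_power flip: ennreal_plus)
qed

text \<open>
  At every level \<open>t < 1\<close> the superlevel sets of \<open>f / a\<close> and \<open>g / b\<close>, with \<open>a\<close> and \<open>b\<close> the suprema, are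
  nonempty, and their midpoints lie in the superlevel set of \<open>h / sqrt (a b)\<close>. Integration of the
  inequality for sets over the levels bounds an arithmetic mean, which dominates the geometric mean.
\<close>

lemma prekopa_leindler_real_bounded:
  fixes f g h :: "real \<Rightarrow> ennreal"
  assumes [measurable]: "f \<in> borel_measurable borel" "g \<in> borel_measurable borel" "h \<in> borel_measurable borel"
    and mid: "\<And>x y. f x * g y \<le> (h ((x + y) / 2))\<^sup>2"
    and bd: "(SUP x. f x) < \<infinity>" "(SUP x. g x) < \<infinity>"
  shows "(\<integral>\<^sup>+x. f x \<partial>lborel) * (\<integral>\<^sup>+x. g x \<partial>lborel) \<le> (\<integral>\<^sup>+x. h x \<partial>lborel)\<^sup>2"
proof (cases "(SUP x. f x) = 0 \<or> (SUP x. g x) = 0")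
  case True
  then have "(\<forall>x. f x = 0) \<or> (\<forall>x. g x = 0)"
    by (metis SUP_upper UNIV_I le_zero_eq)
  then show ?thesis by auto
next
  case False
  obtain a where a: "0 < a" "(SUP x. f x) = ennreal a"
    using bd(1) False
    by (cases "SUP x. f x") (auto simp: less_le)
  obtain b where b: "0 < b" "(SUP x. g x) = ennreal b"
    using bd(2) False
    by (cases "SUP x. g x") (auto simp: less_le)
  have fa: "f x \<le> ennreal a" for x unfolding a(2)[symmetric] by (rule SUP_upper) simp
  have gb: "g x \<le> ennreal b" for x unfolding b(2)[symmetric] by (rule SUP_upper) simp
  define c where "c = sqrt (a * b)"
  have c: "0 < c" "c\<^sup>2 = a * b" using a b by (auto simp: c_def)
  define Lf where "Lf = (\<integral>\<^sup>+t. indicator {0<..<1} t * emeasure lborel {x. ennreal (a * t) < f x} \<partial>lborel)"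
  define Lg where "Lg = (\<integral>\<^sup>+t. indicator {0<..<1} t * emeasure lborel {x. ennreal (b * t) < g x} \<partial>lborel)"
  define Lh where "Lh = (\<integral>\<^sup>+t. indicator {0<..<1} t * emeasure lborel {x. ennreal (c * t) < h x} \<partial>lborel)"
  have scale: "(\<integral>\<^sup>+x. F x \<partial>lborel) = ennreal k * (\<integral>\<^sup>+t. indicator {0<..} t * emeasure lborel {x. ennreal (k * t) < F x} \<partial>lborel)"
    if [measurable]: "F \<in> borel_measurable borel" and k: "0 < k" for F :: "real \<Rightarrow> ennreal" and k
  proof -
    have "(\<integral>\<^sup>+x. F x \<partial>lborel) = ennreal \<bar>k\<bar> * (\<integral>\<^sup>+t. indicator {0<..} (0 + k * t) * emeasure lborel {x. ennreal (0 + k * t) < F x} \<partial>lborel)"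
      unfolding nn_integral_layers[OF that(1)]
      using k by (intro nn_integral_real_affine) auto
    also have "\<dots> = ennreal k * (\<integral>\<^sup>+t. indicator {0<..} t * emeasure lborel {x. ennreal (k * t) < F x} \<partial>lborel)"
      using k by (auto simp: indicator_def zero_less_mult_iff intro!: arg_cong2[where f="(*)"] nn_integral_cong)
    finally show ?thesis .
  qed
  have empty: "{x. ennreal (k * t) < F x} = {}" if "\<And>x. F x \<le> ennreal k" "1 \<le> t" "0 < k" for F :: "real \<Rightarrow> ennreal" and k t
  proof -
    have "k \<le> k * t" using that by simp
    then have "F x \<le> ennreal (k * t)" for x
      using order_trans[OF that(1)[of x] ennreal_leI[of k "k * t"]] by simp
    then show ?thesis by (auto simp: not_less)
  qed
  have If: "(\<integral>\<^sup>+x. f x \<partial>lborel) = ennreal a * Lf"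
    unfolding scale[OF assms(1) a(1)] Lf_def
  proof (intro arg_cong[where f="(*) _"] nn_integral_cong)
    fix t :: real
    show "indicator {0<..} t * emeasure lborel {x. ennreal (a * t) < f x} =
      indicator {0<..<1} t * emeasure lborel {x. ennreal (a * t) < f x}"
      using empty[of f a t, OF fa _ a(1)] by (cases "t < 1") (auto simp: indicator_def)
  qed
  have Ig: "(\<integral>\<^sup>+x. g x \<partial>lborel) = ennreal b * Lg"
    unfolding scale[OF assms(2) b(1)] Lg_def
  proof (intro arg_cong[where f="(*) _"] nn_integral_cong)
    fix t :: real
    show "indicator {0<..} t * emeasure lborel {x. ennreal (b * t) < g x} =
      indicator {0<..<1} t * emeasure lborel {x. ennreal (b * t) < g x}"
      using empty[of g b t, OF gb _ b(1)] by (cases "t < 1") (auto simp: indicator_def)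
  qed
  have Ih: "ennreal c * Lh \<le> (\<integral>\<^sup>+x. h x \<partial>lborel)"
    unfolding scale[OF assms(3) c(1)] Lh_def
    by (intro mult_left_mono nn_integral_mono) (auto simp: indicator_def)
  have levels: "emeasure lborel {x. ennreal (a * t) < f x} + emeasure lborel {x. ennreal (b * t) < g x}
      \<le> 2 * emeasure lborel {x. ennreal (c * t) < h x}" if t: "0 < t" "t < 1" for t
  proof (rule midpoint_measure_real)
    show "{x. ennreal (a * t) < f x} \<noteq> {}"
    proof -
      have "ennreal (a * t) < (SUP x. f x)" unfolding a using a t by (auto simp: ennreal_less_iff)
      then show ?thesis by (auto simp: less_SUP_iff)
    qed
    show "{x. ennreal (b * t) < g x} \<noteq> {}"
    proof -
      have "ennreal (b * t) < (SUP x. g x)" unfolding b using b t by (auto simp: ennreal_less_iff)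
      then show ?thesis by (auto simp: less_SUP_iff)
    qed
    fix x y assume xy: "x \<in> {x. ennreal (a * t) < f x}" "y \<in> {x. ennreal (b * t) < g x}"
    have "(ennreal (c * t))\<^sup>2 = ennreal (a * t) * ennreal (b * t)"
    proof -
      have "(c * t)\<^sup>2 = (a * t) * (b * t)" using c by (simp add: power_mult_distrib power2_eq_square)
      then show ?thesis using a b c t by (simp add: ennreal_power flip: ennreal_mult)
    qed
    also have "\<dots> < f x * g y"
    proof -
      obtain r where r: "f x = ennreal r" "0 \<le> r" using fa[of x] by (cases "f x") (auto simp: top_unique)
      obtain q where q: "g y = ennreal q" "0 \<le> q" using gb[of y] by (cases "g y") (auto simp: top_unique)
      have "a * t < r" "b * t < q" using xy r q by (auto simp: ennreal_less_iff a b t less_imp_le)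
      then have "(a * t) * (b * t) < r * q" using a b t by (intro mult_strict_mono') auto
      then show ?thesis using a b t r q by (simp add: ennreal_less_iff flip: ennreal_mult)
    qed
    also have "\<dots> \<le> (h ((x + y) / 2))\<^sup>2" by (rule mid)
    finally have "ennreal (c * t) < h ((x + y) / 2)"
      by (meson not_less power_mono zero_le)
    then show "(x + y) / 2 \<in> {x. ennreal (c * t) < h x}" by simp
  qed auto
  have "Lf + Lg = (\<integral>\<^sup>+t. indicator {0<..<1} t * emeasure lborel {x. ennreal (a * t) < f x}
       + indicator {0<..<1} t * emeasure lborel {x. ennreal (b * t) < g x} \<partial>lborel)"
    unfolding Lf_def Lg_def by (rule nn_integral_add[symmetric]) measurable
  also have "\<dots> \<le> (\<integral>\<^sup>+t. 2 * (indicator {0<..<1} t * emeasure lborel {x. ennreal (c * t) < h x}) \<partial>lborel)"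
    using levels by (intro nn_integral_mono) (auto simp: indicator_def)
  also have "\<dots> = 2 * Lh" unfolding Lh_def by (rule nn_integral_cmult) measurable
  finally have L: "Lf + Lg \<le> 2 * Lh" .
  have "4 * (Lf * Lg) \<le> (2 * Lh)\<^sup>2"
    using ennreal_arith_geo[of Lf Lg] power_mono[OF L, of 2] by simp
  then have "4 * (Lf * Lg) \<le> 4 * Lh\<^sup>2" by (simp add: power_mult_distrib)
  then have LL: "Lf * Lg \<le> Lh\<^sup>2"
    by (subst (asm) ennreal_mult_le_mult_iff) auto
  have "(\<integral>\<^sup>+x. f x \<partial>lborel) * (\<integral>\<^sup>+x. g x \<partial>lborel) = ennreal (a * b) * (Lf * Lg)"
    unfolding If Ig using a b by (simp add: ennreal_mult ac_simps)
  also have "\<dots> \<le> ennreal (c\<^sup>2) * Lh\<^sup>2" unfolding c(2) by (rule mult_left_mono[OF LL]) simp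
  also have "\<dots> = (ennreal c * Lh)\<^sup>2" using c by (simp add: power_mult_distrib ennreal_power)
  also have "\<dots> \<le> (\<integral>\<^sup>+x. h x \<partial>lborel)\<^sup>2" by (intro power_mono Ih) simp
  finally show ?thesis .
qed

lemma nn_integral_truncations:
  fixes f :: "real \<Rightarrow> ennreal"
  assumes [measurable]: "f \<in> borel_measurable borel"
  shows "(SUP n. \<integral>\<^sup>+x. min (f x) (of_nat n) \<partial>lborel) = (\<integral>\<^sup>+x. f x \<partial>lborel)"
proof -
  have "(SUP n. min y (of_nat n)) = y" for y :: ennreal
  proof -
    have "(SUP n. inf y (of_nat n)) = inf y (SUP n. of_nat n :: ennreal)"
      by (simp add: inf_SUP)
    then show ?thesis by (simp add: inf_min ennreal_SUP_of_nat_eq_top)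
  qed
  then have "(\<integral>\<^sup>+x. f x \<partial>lborel) = (\<integral>\<^sup>+x. (SUP n. min (f x) (of_nat n)) \<partial>lborel)" by simp
  also have "\<dots> = (SUP n. \<integral>\<^sup>+x. min (f x) (of_nat n) \<partial>lborel)"
    by (rule nn_integral_monotone_convergence_SUP)
       (auto simp: incseq_def le_fun_def min.coboundedI2 intro!: min.mono of_nat_mono)
  finally show ?thesis by simp
qed

lemma prekopa_leindler_real:
  fixes f g h :: "real \<Rightarrow> ennreal"
  assumes [measurable]: "f \<in> borel_measurable borel" "g \<in> borel_measurable borel" "h \<in> borel_measurable borel"
    and mid: "\<And>x y. f x * g y \<le> (h ((x + y) / 2))\<^sup>2"
  shows "(\<integral>\<^sup>+x. f x \<partial>lborel) * (\<integral>\<^sup>+x. g x \<partial>lborel) \<le> (\<integral>\<^sup>+x. h x \<partial>lborel)\<^sup>2"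
proof -
  have bd: "(SUP x. min (F x) (of_nat n)) < \<infinity>" for F :: "real \<Rightarrow> ennreal" and n
  proof -
    have "(SUP x. min (F x) (of_nat n)) \<le> of_nat n" by (auto intro: SUP_least)
    then show ?thesis by (rule le_less_trans) (simp add: of_nat_less_top)
  qed
  have "(\<integral>\<^sup>+x. min (f x) (of_nat n) \<partial>lborel) * (\<integral>\<^sup>+x. min (g x) (of_nat m) \<partial>lborel) \<le> (\<integral>\<^sup>+x. h x \<partial>lborel)\<^sup>2" for n m
  proof (rule prekopa_leindler_real_bounded[OF _ _ _ _ bd bd])
    show "min (f x) (of_nat n) * min (g y) (of_nat m) \<le> (h ((x + y) / 2))\<^sup>2" for x y
      by (rule order_trans[OF mult_mono mid]) auto
  qed auto
  then have "(SUP n. SUP m. (\<integral>\<^sup>+x. min (f x) (of_nat n) \<partial>lborel) * (\<integral>\<^sup>+x. min (g x) (of_nat m) \<partial>lborel)) \<le> (\<integral>\<^sup>+x. h x \<partial>lborel)\<^sup>2"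
    by (auto intro!: SUP_least)
  then show ?thesis
    by (simp add: SUP_mult_left_ennreal[symmetric] SUP_mult_right_ennreal[symmetric] nn_integral_truncations)
qed

text \<open>
  Integrating out all coordinates but one leaves functions of one variable that again satisfy the
  hypothesis, by induction.
\<close>

lemma prekopa_leindler_PiM:
  fixes f g h :: "('i \<Rightarrow> real) \<Rightarrow> ennreal"
  assumes "finite I"
    and "f \<in> borel_measurable (Pi\<^sub>M I (\<lambda>_. lborel))" "g \<in> borel_measurable (Pi\<^sub>M I (\<lambda>_. lborel))"
      "h \<in> borel_measurable (Pi\<^sub>M I (\<lambda>_. lborel))"
    and "\<And>x y. x \<in> extensional I \<Longrightarrow> y \<in> extensional I \<Longrightarrow>
      f x * g y \<le> (h (\<lambda>i\<in>I. (x i + y i) / 2))\<^sup>2"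
  shows "(\<integral>\<^sup>+x. f x \<partial>Pi\<^sub>M I (\<lambda>_. lborel)) * (\<integral>\<^sup>+x. g x \<partial>Pi\<^sub>M I (\<lambda>_. lborel))
     \<le> (\<integral>\<^sup>+x. h x \<partial>Pi\<^sub>M I (\<lambda>_. lborel))\<^sup>2"
  using assms
proof (induction I arbitrary: f g h)
  case empty
  interpret product_sigma_finite "\<lambda>_. lborel :: real measure" by standard
  show ?case using empty.prems(4)[of "\<lambda>_. undefined" "\<lambda>_. undefined"]
    by (simp add: nn_integral_empty restrict_def)
next
  case (insert i I f g h)
  interpret product_sigma_finite "\<lambda>_. lborel :: real measure" by standard
  note [measurable] = insert.prems(1-3)
  let ?M = "Pi\<^sub>M I (\<lambda>_. lborel :: real measure)"
  define F G H where "F s = (\<integral>\<^sup>+x. f (x(i := s)) \<partial>?M)" and "G s = (\<integral>\<^sup>+x. g (x(i := s)) \<partial>?M)"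
    and "H s = (\<integral>\<^sup>+x. h (x(i := s)) \<partial>?M)" for s
  interpret I: finite_product_sigma_finite "\<lambda>_. lborel :: real measure" I
    by standard (rule insert.hyps)
  have [measurable]: "F \<in> borel_measurable borel" "G \<in> borel_measurable borel" "H \<in> borel_measurable borel"
    unfolding F_def G_def H_def by measurable
  have FGH: "F s * G t \<le> (H ((s + t) / 2))\<^sup>2" for s t
    unfolding F_def G_def H_def
  proof (rule insert.IH)
    fix x y :: "'i \<Rightarrow> real" assume "x \<in> extensional I" "y \<in> extensional I"
    then have "f (x(i := s)) * g (y(i := t)) \<le> (h (\<lambda>j\<in>insert i I. ((x(i := s)) j + (y(i := t)) j) / 2))\<^sup>2"
      by (intro insert.prems(4)) (auto simp: extensional_def)
    also have "(\<lambda>j\<in>insert i I. ((x(i := s)) j + (y(i := t)) j) / 2) = (\<lambda>j\<in>I. (x j + y j) / 2)(i := (s + t) / 2)"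
      using insert.hyps by (auto simp: fun_eq_iff restrict_def)
    finally show "f (x(i := s)) * g (y(i := t)) \<le> (h ((\<lambda>j\<in>I. (x j + y j) / 2)(i := (s + t) / 2)))\<^sup>2" .
  qed (measurable)
  have "(\<integral>\<^sup>+s. F s \<partial>lborel) * (\<integral>\<^sup>+s. G s \<partial>lborel) \<le> (\<integral>\<^sup>+s. H s \<partial>lborel)\<^sup>2"
    by (rule prekopa_leindler_real[of F G H, OF _ _ _ FGH]) measurable
  then show ?case
    unfolding F_def G_def H_def using insert.hyps insert.prems(1-3)
    by (simp add: product_nn_integral_insert_rev)
qed

text \<open>
  The Prekopa-Leindler inequality for indicator functions. This form, with a product in place of
  \<open>d\<close>-th roots and with midpoints only, is the midpoint concavity of the logarithm of the volume; repeated
  bisection leads from it to other convex combinations.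
\<close>

theorem brunn_minkowski_midpoint:
  fixes K L M :: "'a::euclidean_space set"
  assumes [measurable]: "K \<in> sets borel" "L \<in> sets borel" "M \<in> sets borel"
    and mid: "\<And>x y. x \<in> K \<Longrightarrow> y \<in> L \<Longrightarrow> (1/2) *\<^sub>R (x + y) \<in> M"
  shows "emeasure lborel K * emeasure lborel L \<le> (emeasure lborel M)\<^sup>2"
proof -
  let ?P = "Pi\<^sub>M (Basis :: 'a set) (\<lambda>_. lborel :: real measure)"
  let ?e = "\<lambda>f. \<Sum>b\<in>(Basis :: 'a set). f b *\<^sub>R b"
  have distr_eq: "(lborel :: 'a measure) = distr ?P borel ?e" by (rule lborel_eq)
  have e: "emeasure lborel S = (\<integral>\<^sup>+x. indicator S (?e x) \<partial>?P)" if [measurable]: "S \<in> sets borel" for S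
  proof -
    have "emeasure lborel S = (\<integral>\<^sup>+x. indicator S x \<partial>lborel)" by simp
    also have "\<dots> = (\<integral>\<^sup>+x. indicator S (?e x) \<partial>?P)"
      by (subst distr_eq) (subst nn_integral_distr, auto)
    finally show ?thesis .
  qed
  have mid_e: "?e (\<lambda>i\<in>Basis. (x i + y i) / 2) = (1/2) *\<^sub>R (?e x + ?e y)" for x y
  proof -
    have "?e (\<lambda>i\<in>Basis. (x i + y i) / 2) = (\<Sum>b\<in>Basis. (1/2) *\<^sub>R (x b *\<^sub>R b + y b *\<^sub>R b))"
      by (intro sum.cong) (auto simp: scaleR_left_distrib[symmetric])
    also have "\<dots> = (1/2) *\<^sub>R (?e x + ?e y)" by (simp add: scaleR_sum_right[symmetric] sum.distrib)
    finally show ?thesis .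
  qed
  show ?thesis unfolding e[OF assms(1)] e[OF assms(2)] e[OF assms(3)]
  proof (rule prekopa_leindler_PiM)
    fix x y :: "'a \<Rightarrow> real"
    show "(indicator K (?e x) :: ennreal) * indicator L (?e y) \<le> (indicator M (?e (\<lambda>i\<in>Basis. (x i + y i) / 2)))\<^sup>2"
      unfolding mid_e using mid[of "?e x" "?e y"] by (auto simp: indicator_def)
  qed (auto intro!: finite_Basis)
qed

section \<open>Slices of convex bodies\<close>

text \<open>
  The cylinder of height one in direction \<open>n\<close> over the slice of \<open>S\<close> at level \<open>r\<close>, moved along \<open>n\<close> to the
  slab \<open>0 \<le> y \<bullet> n \<le> 1\<close>. Its volume is the \<open>(d - 1)\<close>-dimensional area of the slice.
\<close>

definition slice_cylinder :: "'a::euclidean_space \<Rightarrow> 'a set \<Rightarrow> real \<Rightarrow> 'a set" where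
  "slice_cylinder n S r = {y. 0 \<le> y \<bullet> n \<and> y \<bullet> n \<le> 1 \<and> y + (r - y \<bullet> n) *\<^sub>R n \<in> S}"

definition slice_area :: "'a::euclidean_space \<Rightarrow> 'a set \<Rightarrow> real \<Rightarrow> ennreal" where
  "slice_area n S r = emeasure lborel (slice_cylinder n S r)"

lemma slice_cylinder_borel [measurable]:
  assumes [measurable]: "S \<in> sets borel"
  shows "slice_cylinder n S r \<in> sets borel"
  unfolding slice_cylinder_def by measurable

lemma inner_along:
  fixes n :: "'a::euclidean_space"
  assumes "norm n = 1"
  shows "(y + t *\<^sub>R n) \<bullet> n = y \<bullet> n + t"
  using assms by (simp add: inner_left_distrib dot_square_norm)

lemma slice_area_Int_eq:
  assumes "norm n = 1"
  shows "slice_area n (S \<inter> {x. x \<bullet> n \<in> B}) r = indicator B r * slice_area n S r"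
  unfolding slice_area_def slice_cylinder_def
  by (auto simp: inner_along[OF assms] indicator_def)

lemma slice_area_measurable [measurable]:
  assumes [measurable]: "S \<in> sets borel"
  shows "slice_area n S \<in> borel_measurable borel"
proof -
  have "slice_area n S r = (\<integral>\<^sup>+y. indicator {y. 0 \<le> y \<bullet> n \<and> y \<bullet> n \<le> 1} y * indicator S (y + (r - y \<bullet> n) *\<^sub>R n) \<partial>lborel)" for r
  proof -
    have "slice_area n S r = (\<integral>\<^sup>+y. indicator (slice_cylinder n S r) y \<partial>lborel)"
      by (simp add: slice_area_def)
    also have "\<dots> = (\<integral>\<^sup>+y. indicator {y. 0 \<le> y \<bullet> n \<and> y \<bullet> n \<le> 1} y * indicator S (y + (r - y \<bullet> n) *\<^sub>R n) \<partial>lborel)"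
      by (intro nn_integral_cong) (auto simp: indicator_def slice_cylinder_def)
    finally show ?thesis .
  qed
  then have "slice_area n S = (\<lambda>r. \<integral>\<^sup>+y. indicator {y. 0 \<le> y \<bullet> n \<and> y \<bullet> n \<le> 1} y * indicator S (y + (r - y \<bullet> n) *\<^sub>R n) \<partial>lborel)"
    by auto
  then show ?thesis by simp
qed

lemma nn_integral_lborel_translate:
  fixes f :: "'a::euclidean_space \<Rightarrow> ennreal"
  assumes [measurable]: "f \<in> borel_measurable borel"
  shows "(\<integral>\<^sup>+x. f (t + x) \<partial>lborel) = (\<integral>\<^sup>+x. f x \<partial>lborel)"
  by (subst (2) lborel_affine[of 1 t]) (auto simp: nn_integral_density nn_integral_distr)

text \<open>
  Tonelli's theorem and translations: the translation along \<open>n\<close> that takes the slice at level \<open>r\<close> to the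
  point \<open>y\<close> of the slab is absorbed in the integral over \<open>r\<close>, and another one returns every point of \<open>S\<close>
  to its place, where the levels \<open>r\<close> that reach it form an interval of length one.
\<close>

theorem cavalieri:
  fixes S :: "'a::euclidean_space set"
  assumes [measurable]: "S \<in> sets borel" and n: "norm n = 1"
  shows "emeasure lborel S = (\<integral>\<^sup>+r. slice_area n S r \<partial>lborel)"
proof -
  let ?I = "\<lambda>y. indicator {y. 0 \<le> y \<bullet> n \<and> y \<bullet> n \<le> 1} y :: ennreal"
  have "(\<integral>\<^sup>+r. slice_area n S r \<partial>lborel)
      = (\<integral>\<^sup>+r. (\<integral>\<^sup>+y. ?I y * indicator S (y + (r - y \<bullet> n) *\<^sub>R n) \<partial>lborel) \<partial>lborel)"
  proof (rule nn_integral_cong)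
    fix r
    have "slice_area n S r = (\<integral>\<^sup>+y. indicator (slice_cylinder n S r) y \<partial>lborel)"
      by (simp add: slice_area_def)
    also have "\<dots> = (\<integral>\<^sup>+y. ?I y * indicator S (y + (r - y \<bullet> n) *\<^sub>R n) \<partial>lborel)"
      by (intro nn_integral_cong) (auto simp: indicator_def slice_cylinder_def)
    finally show "slice_area n S r = (\<integral>\<^sup>+y. ?I y * indicator S (y + (r - y \<bullet> n) *\<^sub>R n) \<partial>lborel)" .
  qed
  also have "\<dots> = (\<integral>\<^sup>+y. (\<integral>\<^sup>+r. ?I y * indicator S (y + (r - y \<bullet> n) *\<^sub>R n) \<partial>lborel) \<partial>lborel)"
    by (rule lborel_pair.Fubini') measurable
  also have "\<dots> = (\<integral>\<^sup>+y. (\<integral>\<^sup>+r. ?I y * indicator S (y + r *\<^sub>R n) \<partial>lborel) \<partial>lborel)"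
  proof (rule nn_integral_cong)
    fix y
    show "(\<integral>\<^sup>+r. ?I y * indicator S (y + (r - y \<bullet> n) *\<^sub>R n) \<partial>lborel) = (\<integral>\<^sup>+r. ?I y * indicator S (y + r *\<^sub>R n) \<partial>lborel)"
      using nn_integral_lborel_translate[of "\<lambda>r. ?I y * indicator S (y + r *\<^sub>R n)" "- (y \<bullet> n)"]
      by (simp add: algebra_simps)
  qed
  also have "\<dots> = (\<integral>\<^sup>+r. (\<integral>\<^sup>+y. ?I y * indicator S (y + r *\<^sub>R n) \<partial>lborel) \<partial>lborel)"
    by (rule lborel_pair.Fubini') measurable
  also have "\<dots> = (\<integral>\<^sup>+r. (\<integral>\<^sup>+z. indicator {z. 0 \<le> z \<bullet> n - r \<and> z \<bullet> n - r \<le> 1} z * indicator S z \<partial>lborel) \<partial>lborel)"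
  proof (rule nn_integral_cong)
    fix r
    have "(\<integral>\<^sup>+z. indicator {z. 0 \<le> z \<bullet> n - r \<and> z \<bullet> n - r \<le> 1} z * indicator S z \<partial>lborel)
      = (\<integral>\<^sup>+z. indicator {z. 0 \<le> z \<bullet> n - r \<and> z \<bullet> n - r \<le> 1} (r *\<^sub>R n + z) * indicator S (r *\<^sub>R n + z) \<partial>lborel)"
      by (rule nn_integral_lborel_translate[symmetric]) measurable
    also have "\<dots> = (\<integral>\<^sup>+y. ?I y * indicator S (y + r *\<^sub>R n) \<partial>lborel)"
      using inner_along[OF n] by (intro nn_integral_cong) (simp add: indicator_def add.commute)
    finally show "(\<integral>\<^sup>+y. ?I y * indicator S (y + r *\<^sub>R n) \<partial>lborel) =
      (\<integral>\<^sup>+z. indicator {z. 0 \<le> z \<bullet> n - r \<and> z \<bullet> n - r \<le> 1} z * indicator S z \<partial>lborel)" ..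
  qed
  also have "\<dots> = (\<integral>\<^sup>+z. (\<integral>\<^sup>+r. indicator {z. 0 \<le> z \<bullet> n - r \<and> z \<bullet> n - r \<le> 1} z * indicator S z \<partial>lborel) \<partial>lborel)"
    by (rule lborel_pair.Fubini') (simp add: indicator_def, measurable)
  also have "\<dots> = (\<integral>\<^sup>+z. indicator S z \<partial>lborel)"
  proof (rule nn_integral_cong)
    fix z
    have "(\<integral>\<^sup>+r. indicator {z. 0 \<le> z \<bullet> n - r \<and> z \<bullet> n - r \<le> 1} z * indicator S z \<partial>lborel)
       = (\<integral>\<^sup>+r. indicator S z * indicator {z \<bullet> n - 1 .. z \<bullet> n} r \<partial>lborel)"
      by (intro nn_integral_cong) (auto simp: indicator_def)
    also have "\<dots> = (indicator S z :: ennreal)" by (subst nn_integral_cmult_indicator) auto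
    finally show "(\<integral>\<^sup>+r. indicator {z. 0 \<le> z \<bullet> n - r \<and> z \<bullet> n - r \<le> 1} z * indicator S z \<partial>lborel) = (indicator S z :: ennreal)" .
  qed
  finally show ?thesis by simp
qed

corollary cavalieri_Int:
  fixes S :: "'a::euclidean_space set"
  assumes [measurable]: "S \<in> sets borel" "B \<in> sets borel" and n: "norm n = 1"
  shows "emeasure lborel (S \<inter> {x. x \<bullet> n \<in> B}) = (\<integral>\<^sup>+r. indicator B r * slice_area n S r \<partial>lborel)"
proof -
  have "emeasure lborel (S \<inter> {x. x \<bullet> n \<in> B}) = (\<integral>\<^sup>+r. slice_area n (S \<inter> {x. x \<bullet> n \<in> B}) r \<partial>lborel)"
    by (rule cavalieri[OF _ n]) measurable
  then show ?thesis by (simp add: slice_area_Int_eq[OF n])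
qed

text \<open>
  Midpoints of points of two cylinders of height one lie in the cylinder of height one over the
  midpoints of the slices.
\<close>

lemma slice_area_midpoint:
  fixes K L M :: "'a::euclidean_space set"
  assumes [measurable]: "K \<in> sets borel" "L \<in> sets borel" "M \<in> sets borel"
    and mid: "\<And>x y. x \<in> K \<Longrightarrow> y \<in> L \<Longrightarrow> (1/2) *\<^sub>R (x + y) \<in> M"
  shows "slice_area n K r * slice_area n L s \<le> (slice_area n M ((r + s) / 2))\<^sup>2"
  unfolding slice_area_def
proof (rule brunn_minkowski_midpoint)
  fix x y assume "x \<in> slice_cylinder n K r" "y \<in> slice_cylinder n L s"
  then have *: "0 \<le> x \<bullet> n" "x \<bullet> n \<le> 1" "0 \<le> y \<bullet> n" "y \<bullet> n \<le> 1"
    and "(1/2) *\<^sub>R ((x + (r - x \<bullet> n) *\<^sub>R n) + (y + (s - y \<bullet> n) *\<^sub>R n)) \<in> M"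
    by (auto simp: slice_cylinder_def intro: mid)
  note this(5)
  also have "(1/2) *\<^sub>R ((x + (r - x \<bullet> n) *\<^sub>R n) + (y + (s - y \<bullet> n) *\<^sub>R n))
      = (1/2) *\<^sub>R (x + y) + ((r + s) / 2 - ((1/2) *\<^sub>R (x + y)) \<bullet> n) *\<^sub>R n"
    by (simp add: inner_left_distrib scaleR_add_right scaleR_diff_right scaleR_left_diff_distrib scaleR_left_distrib add_divide_distrib)
  finally show "(1/2) *\<^sub>R (x + y) \<in> slice_cylinder n M ((r + s) / 2)"
    using * by (simp add: slice_cylinder_def inner_left_distrib)
qed auto

text \<open>
  A contraction towards \<open>q\<close> takes the slice at \<open>s\<close> into another slice. The whole cylinder is
  contracted here, its height included; this costs one more power of \<open>1 - \<theta>\<close> than the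
  \<open>(d - 1)\<close>-dimensional area would.
\<close>

lemma slice_area_towards:
  fixes K :: "'a::euclidean_space set"
  assumes K: "convex K" "K \<in> sets borel" and n: "norm n = 1" and q: "q \<in> K" and \<theta>: "0 \<le> \<theta>" "\<theta> < 1"
  shows "ennreal ((1 - \<theta>) ^ DIM('a)) * slice_area n K s \<le> slice_area n K ((1 - \<theta>) * s + \<theta> * (q \<bullet> n))"
proof -
  let ?r = "(1 - \<theta>) * s + \<theta> * (q \<bullet> n)"
  define t where "t = \<theta> *\<^sub>R (q - (q \<bullet> n) *\<^sub>R n)"
  note [measurable] = K(2)
  have tn: "t \<bullet> n = 0" using n by (simp add: t_def inner_diff_left dot_square_norm)
  have "slice_cylinder n K s \<subseteq> {x. t + (1 - \<theta>) *\<^sub>R x \<in> slice_cylinder n K ?r}"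
  proof
    fix y assume y: "y \<in> slice_cylinder n K s"
    have "(1 - \<theta>) *\<^sub>R (y + (s - y \<bullet> n) *\<^sub>R n) + \<theta> *\<^sub>R q \<in> K"
      using y q \<theta> by (intro convexD[OF K(1)]) (auto simp: slice_cylinder_def)
    also have "(1 - \<theta>) *\<^sub>R (y + (s - y \<bullet> n) *\<^sub>R n) + \<theta> *\<^sub>R q = t + (1 - \<theta>) *\<^sub>R y + (?r - (t + (1 - \<theta>) *\<^sub>R y) \<bullet> n) *\<^sub>R n"
      by (simp add: inner_left_distrib tn) (simp add: t_def algebra_simps)
    finally show "y \<in> {x. t + (1 - \<theta>) *\<^sub>R x \<in> slice_cylinder n K ?r}"
      using y \<theta> by (auto simp: slice_cylinder_def inner_left_distrib tn mult_le_one)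
  qed
  then have "emeasure lborel (slice_cylinder n K s) \<le> emeasure lborel {x. t + (1 - \<theta>) *\<^sub>R x \<in> slice_cylinder n K ?r}"
    by (rule emeasure_mono) simp
  then show ?thesis
    unfolding slice_area_def
    using \<theta> by (subst emeasure_lborel_affine[of "slice_cylinder n K ?r" "1 - \<theta>" t]) (auto intro: mult_left_mono)
qed

text \<open>
  The union of the slice cylinders at the levels within distance \<open>e\<close> of \<open>s\<close>, written so that its
  compactness is apparent.
\<close>

definition slab_cylinder :: "'a::euclidean_space \<Rightarrow> 'a set \<Rightarrow> real \<Rightarrow> real \<Rightarrow> 'a set" where
  "slab_cylinder n K s e = {y. 0 \<le> y \<bullet> n \<and> y \<bullet> n \<le> 1 \<and> y - (y \<bullet> n) *\<^sub>R n \<in> (\<lambda>(x, r). x - r *\<^sub>R n) ` (K \<times> {s - e .. s + e})}"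

lemma compact_slab_cylinder:
  assumes K: "compact K" and n: "norm n = 1"
  shows "compact (slab_cylinder n K s e)"
proof -
  define W where "W = (\<lambda>(x, r). x - r *\<^sub>R n) ` (K \<times> {s - e .. s + e})"
  have W: "compact W"
    unfolding W_def by (intro compact_continuous_image compact_Times K) (auto intro!: continuous_intros simp: split_beta)
  obtain B where B: "\<And>w. w \<in> W \<Longrightarrow> norm w \<le> B" using compact_imp_bounded[OF W] unfolding bounded_iff by blast
  have "slab_cylinder n K s e = {y. 0 \<le> y \<bullet> n} \<inter> {y. y \<bullet> n \<le> 1} \<inter> (\<lambda>y. y - (y \<bullet> n) *\<^sub>R n) -` W"
    unfolding slab_cylinder_def W_def[symmetric] by auto
  moreover have "closed ((\<lambda>y. y - (y \<bullet> n) *\<^sub>R n) -` W)"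
    by (rule continuous_closed_vimage) (auto intro!: continuous_intros compact_imp_closed[OF W])
  moreover have "closed {y. 0 \<le> y \<bullet> n}" "closed {y. y \<bullet> n \<le> 1}"
    by (auto intro!: closed_Collect_le continuous_intros)
  ultimately have "closed (slab_cylinder n K s e)" by auto
  moreover have "norm y \<le> B + 1" if "y \<in> slab_cylinder n K s e" for y
  proof -
    have "norm y \<le> norm (y - (y \<bullet> n) *\<^sub>R n) + norm ((y \<bullet> n) *\<^sub>R n)"
      using norm_triangle_ineq[of "y - (y \<bullet> n) *\<^sub>R n" "(y \<bullet> n) *\<^sub>R n"] by simp
    also have "\<dots> \<le> B + 1" using that B n unfolding slab_cylinder_def W_def[symmetric] by (intro add_mono) auto
    finally show ?thesis .
  qed
  then have "bounded (slab_cylinder n K s e)" by (auto simp: bounded_iff)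
  ultimately show ?thesis by (simp add: compact_eq_bounded_closed)
qed

lemma slice_subset_slab:
  assumes n: "norm n = 1" and r: "\<bar>r - s\<bar> \<le> e"
  shows "slice_cylinder n K r \<subseteq> slab_cylinder n K s e"
proof
  fix y assume y: "y \<in> slice_cylinder n K r"
  have "y - (y \<bullet> n) *\<^sub>R n = (y + (r - y \<bullet> n) *\<^sub>R n) - r *\<^sub>R n" by (simp add: algebra_simps)
  then have "y - (y \<bullet> n) *\<^sub>R n \<in> (\<lambda>(x, r). x - r *\<^sub>R n) ` (K \<times> {s - e .. s + e})"
    using y r by (intro image_eqI[of _ _ "(y + (r - y \<bullet> n) *\<^sub>R n, r)"]) (auto simp: slice_cylinder_def)
  then show "y \<in> slab_cylinder n K s e" using y by (simp add: slab_cylinder_def slice_cylinder_def)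
qed

lemma slab_cylinder_point:
  assumes n: "norm n = 1" and y: "y \<in> slab_cylinder n K s e"
  obtains r where "\<bar>r - s\<bar> \<le> e" "y \<in> slice_cylinder n K r"
proof -
  obtain x r where x: "x \<in> K" "\<bar>r - s\<bar> \<le> e" "y - (y \<bullet> n) *\<^sub>R n = x - r *\<^sub>R n"
    using y by (force simp: slab_cylinder_def abs_le_iff)
  have "x = y + (r - y \<bullet> n) *\<^sub>R n" using x(3) by (simp add: algebra_simps)
  then show ?thesis using that[of r] x y by (simp add: slice_cylinder_def slab_cylinder_def)
qed

lemma slice_area_finite:
  assumes K: "compact K" and n: "norm n = 1"
  shows "slice_area n K r < \<infinity>"
proof -
  have "slice_area n K r \<le> emeasure lborel (slab_cylinder n K r 0)"
    unfolding slice_area_def using compact_slab_cylinder[OF K n]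
    by (intro emeasure_mono slice_subset_slab[OF n]) (auto simp: borel_compact)
  also have "\<dots> < \<infinity>" by (rule emeasure_lborel_cbox_finite emeasure_compact_finite compact_slab_cylinder K n)+
  finally show ?thesis .
qed

text \<open>
  The compact slab cylinders decrease to the slice cylinder when the slab shrinks.
\<close>

lemma slice_area_usc:
  assumes K: "compact K" and n: "norm n = 1" and k: "slice_area n K s < k"
  obtains e where "0 < e" "\<And>r. \<bar>r - s\<bar> \<le> e \<Longrightarrow> slice_area n K r < k"
proof -
  let ?Z = "\<lambda>i. slab_cylinder n K s (1 / real (Suc i))"
  have Z: "compact (?Z i)" for i by (rule compact_slab_cylinder[OF K n])
  have lim: "(\<lambda>i. emeasure lborel (?Z i)) \<longlonglongrightarrow> emeasure lborel (\<Inter>i. ?Z i)"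
  proof (rule Lim_emeasure_decseq)
    show "decseq ?Z"
    proof (rule decseq_SucI, rule subsetI)
      fix i y assume "y \<in> ?Z (Suc i)"
      then obtain r where r: "\<bar>r - s\<bar> \<le> 1 / real (Suc (Suc i))" "y \<in> slice_cylinder n K r"
        by (rule slab_cylinder_point[OF n])
      have "1 / real (Suc (Suc i)) \<le> 1 / real (Suc i)" by (simp add: frac_le)
      then show "y \<in> ?Z i" using r slice_subset_slab[OF n, of r s "1 / real (Suc i)" K] by auto
    qed
    show "emeasure lborel (?Z i) \<noteq> \<infinity>" for i
      using emeasure_compact_finite[OF Z, of i] by auto
  qed (use Z in \<open>auto simp: borel_compact\<close>)
  have "(\<Inter>i. ?Z i) \<subseteq> slice_cylinder n K s"
  proof
    fix y assume y: "y \<in> (\<Inter>i. ?Z i)"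
    have "\<exists>r. \<bar>r - s\<bar> \<le> 1 / real (Suc i) \<and> y \<in> slice_cylinder n K r" for i
      using slab_cylinder_point[OF n, of y K s "1 / real (Suc i)"] y by blast
    then obtain r where r: "\<And>i. \<bar>r i - s\<bar> \<le> 1 / real (Suc i)" "\<And>i. y \<in> slice_cylinder n K (r i)"
      by metis
    have "r \<longlonglongrightarrow> s"
    proof (rule LIM_zero_cancel, rule Lim_null_comparison)
      show "\<forall>\<^sub>F i in sequentially. norm (r i - s) \<le> 1 / real (Suc i)" using r(1) by simp
      show "(\<lambda>i. 1 / real (Suc i)) \<longlonglongrightarrow> 0" using LIMSEQ_inverse_real_of_nat by (simp add: inverse_eq_divide)
    qed
    then have "(\<lambda>i. y + (r i - y \<bullet> n) *\<^sub>R n) \<longlonglongrightarrow> y + (s - y \<bullet> n) *\<^sub>R n"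
      by (intro tendsto_intros)
    then have "y + (s - y \<bullet> n) *\<^sub>R n \<in> K"
      by (rule closed_sequentially[OF compact_imp_closed[OF K], rotated]) (use r(2) in \<open>auto simp: slice_cylinder_def\<close>)
    then show "y \<in> slice_cylinder n K s" using r(2)[of 0] by (simp add: slice_cylinder_def)
  qed
  then have "emeasure lborel (\<Inter>i. ?Z i) \<le> slice_area n K s"
    unfolding slice_area_def using slice_cylinder_borel[OF borel_compact[OF K]] by (intro emeasure_mono) auto
  then have "emeasure lborel (\<Inter>i. ?Z i) < k" using k by simp
  then have "\<forall>\<^sub>F i in sequentially. emeasure lborel (?Z i) < k"
    by (rule order_tendstoD(2)[OF lim])
  then obtain i where i: "emeasure lborel (?Z i) < k" by (auto simp: eventually_sequentially)
  show ?thesis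
  proof (rule that[of "1 / real (Suc i)"])
    fix r assume "\<bar>r - s\<bar> \<le> 1 / real (Suc i)"
    then have "slice_area n K r \<le> emeasure lborel (?Z i)"
      unfolding slice_area_def using Z by (intro emeasure_mono slice_subset_slab[OF n]) (auto simp: borel_compact)
    then show "slice_area n K r < k" using i by simp
  qed simp
qed

text \<open>
  On the side of the level \<open>s\<close> on which \<open>K\<close> has a point \<open>q\<close>, the slices contain contracted copies of
  the slice at \<open>s\<close>.
\<close>

lemma slice_area_lsc_towards:
  fixes K :: "'a::euclidean_space set"
  assumes K: "compact K" "convex K" and n: "norm n = 1" and q: "q \<in> K" "q \<bullet> n \<noteq> s"
    and k: "k < slice_area n K s"
  obtains e where "0 < e" "\<And>r. \<bar>r - s\<bar> \<le> e \<Longrightarrow> 0 \<le> (r - s) * (q \<bullet> n - s) \<Longrightarrow> k < slice_area n K r"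
proof -
  let ?a = "slice_area n K s"
  define D where "D = \<bar>q \<bullet> n - s\<bar>"
  have D: "0 < D" using q by (simp add: D_def)
  have fin: "?a < \<infinity>" by (rule slice_area_finite[OF K(1) n])
  \<comment> \<open>The factor lost by the contraction tends to 1 at the level s.\<close>
  have "((\<lambda>\<theta>. ennreal ((1 - \<theta>) ^ DIM('a)) * ?a) \<longlongrightarrow> ennreal ((1 - 0) ^ DIM('a)) * ?a) (at_right (0::real))"
    by (rule tendsto_mult_ennreal) (use fin in \<open>auto intro!: tendsto_ennrealI tendsto_eq_intros\<close>)
  then have "\<forall>\<^sub>F \<theta> in at_right (0::real). k < ennreal ((1 - \<theta>) ^ DIM('a)) * ?a"
    using k by (intro order_tendstoD(1)) auto
  then obtain b where b: "0 < b" "\<And>\<theta>. 0 < \<theta> \<Longrightarrow> \<theta> < b \<Longrightarrow> k < ennreal ((1 - \<theta>) ^ DIM('a)) * ?a"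
    by (auto simp: eventually_at_right[of 0 1])
  define e where "e = D * min (b/2) (1/2)"
  show ?thesis
  proof (rule that[of e])
    show "0 < e" using D b by (simp add: e_def)
    fix r assume r: "\<bar>r - s\<bar> \<le> e" "0 \<le> (r - s) * (q \<bullet> n - s)"
    define \<theta> where "\<theta> = (r - s) / (q \<bullet> n - s)"
    have \<theta>r: "r = (1 - \<theta>) * s + \<theta> * (q \<bullet> n)" 
    proof -
      have "\<theta> * (q \<bullet> n - s) = r - s" using q by (simp add: \<theta>_def)
      then show ?thesis by (simp add: algebra_simps)
    qed
    have "0 \<le> \<theta>" using r(2) by (auto simp: \<theta>_def zero_le_divide_iff zero_le_mult_iff)
    moreover have "\<theta> \<le> min (b/2) (1/2)"
    proof -
      have "\<theta> \<le> \<bar>r - s\<bar> / D" unfolding \<theta>_def D_def by (metis abs_divide abs_ge_self)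
      also have "\<dots> \<le> e / D" using r D by (simp add: divide_right_mono)
      also have "\<dots> = min (b/2) (1/2)" using D by (simp add: e_def)
      finally show ?thesis .
    qed
    ultimately have \<theta>: "0 \<le> \<theta>" "\<theta> < 1" "\<theta> < b" using b by auto
    have "k < ennreal ((1 - \<theta>) ^ DIM('a)) * ?a" using b(2)[of \<theta>] \<theta> k by (cases "\<theta> = 0") auto
    also have "\<dots> \<le> slice_area n K r"
      unfolding \<theta>r using K \<theta> q(1) by (intro slice_area_towards[OF _ _ n]) (auto simp: borel_compact)
    finally show "k < slice_area n K r" .
  qed
qed

text \<open>
  Points of \<open>K\<close> on both sides exclude the two extreme levels, where the area may jump to 0.
\<close>

lemma isCont_slice_area:
  fixes K :: "'a::euclidean_space set"
  assumes K: "compact K" "convex K" and n: "norm n = 1"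
    and p: "p \<in> K" "p \<bullet> n < s" and q: "q \<in> K" "s < q \<bullet> n"
  shows "isCont (\<lambda>r. enn2real (slice_area n K r)) s"
proof -
  have fin: "slice_area n K r < \<infinity>" for r by (rule slice_area_finite[OF K(1) n])
  have "(slice_area n K \<longlongrightarrow> slice_area n K s) (at s)"
  proof (rule order_tendstoI)
    fix k assume "slice_area n K s < k"
    then obtain e where "0 < e" "\<And>r. \<bar>r - s\<bar> \<le> e \<Longrightarrow> slice_area n K r < k"
      using slice_area_usc[OF K(1) n] by metis
    then show "\<forall>\<^sub>F r in at s. slice_area n K r < k"
      unfolding eventually_at by (intro exI[of _ e]) (auto simp: dist_real_def)
  next
    fix k assume k: "k < slice_area n K s"
    obtain e1 where e1: "0 < e1" "\<And>r. \<bar>r - s\<bar> \<le> e1 \<Longrightarrow> 0 \<le> (r - s) * (q \<bullet> n - s) \<Longrightarrow> k < slice_area n K r"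
      using slice_area_lsc_towards[OF K n q(1) _ k] q by (metis less_irrefl)
    obtain e2 where e2: "0 < e2" "\<And>r. \<bar>r - s\<bar> \<le> e2 \<Longrightarrow> 0 \<le> (r - s) * (p \<bullet> n - s) \<Longrightarrow> k < slice_area n K r"
      using slice_area_lsc_towards[OF K n p(1) _ k] p by (metis less_irrefl)
    have "k < slice_area n K r" if "\<bar>r - s\<bar> < min e1 e2" for r
      using that e1(2)[of r] e2(2)[of r] p q by (cases "s \<le> r") (auto simp: zero_le_mult_iff)
    then show "\<forall>\<^sub>F r in at s. k < slice_area n K r"
      unfolding eventually_at using e1 e2 by (intro exI[of _ "min e1 e2"]) (auto simp: dist_real_def)
  qed
  then show ?thesis unfolding isCont_def
    by (intro tendsto_enn2real) (use fin[of s] in auto)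
qed

definition volume_below :: "'a::euclidean_space \<Rightarrow> 'a set \<Rightarrow> real \<Rightarrow> real" where
  "volume_below n K s = measure lborel (K \<inter> {x. x \<bullet> n \<le> s})"

lemma volume_below_diff:
  assumes K: "compact K" and uv: "u \<le> v"
  shows "volume_below n K v - volume_below n K u = measure lborel (K \<inter> {x. x \<bullet> n \<in> {u<..v}})"
proof -
  have [measurable]: "K \<in> sets borel" using K by (rule borel_compact)
  have fin: "emeasure lborel (K \<inter> S) \<noteq> \<infinity>" for S
    using emeasure_mono[of "K \<inter> S" K lborel] emeasure_compact_finite[OF K] by (auto simp: top_unique)
  have "measure lborel ((K \<inter> {x. x \<bullet> n \<le> u}) \<union> (K \<inter> {x. x \<bullet> n \<in> {u<..v}}))
     = measure lborel (K \<inter> {x. x \<bullet> n \<le> u}) + measure lborel (K \<inter> {x. x \<bullet> n \<in> {u<..v}})"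
    using fin by (intro measure_Union) auto
  moreover have "(K \<inter> {x. x \<bullet> n \<le> u}) \<union> (K \<inter> {x. x \<bullet> n \<in> {u<..v}}) = K \<inter> {x. x \<bullet> n \<le> v}"
    using uv by auto
  ultimately show ?thesis by (simp add: volume_below_def)
qed

lemma volume_below_diff_bounds:
  assumes K: "compact K" and n: "norm n = 1" and uv: "u \<le> v" and lm: "0 \<le> l" "0 \<le> m"
    and b: "\<And>r. u \<le> r \<Longrightarrow> r \<le> v \<Longrightarrow> ennreal l \<le> slice_area n K r \<and> slice_area n K r \<le> ennreal m"
  shows "l * (v - u) \<le> volume_below n K v - volume_below n K u"
    and "volume_below n K v - volume_below n K u \<le> m * (v - u)"
proof -
  have [measurable]: "K \<in> sets borel" using K by (rule borel_compact)
  let ?S = "K \<inter> {x. x \<bullet> n \<in> {u<..v}}"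
  have e: "emeasure lborel ?S = (\<integral>\<^sup>+r. indicator {u<..v} r * slice_area n K r \<partial>lborel)"
    by (rule cavalieri_Int[OF _ _ n]) auto
  have fin: "emeasure lborel ?S \<noteq> \<infinity>"
    using emeasure_mono[of ?S K lborel] emeasure_compact_finite[OF K] by (auto simp: top_unique)
  have c: "(\<integral>\<^sup>+r. ennreal k * indicator {u<..v} r \<partial>lborel) = ennreal (k * (v - u))" if "0 \<le> k" for k
    using uv that by (subst nn_integral_cmult_indicator) (auto simp: ennreal_mult)
  have "ennreal (l * (v - u)) \<le> emeasure lborel ?S"
    unfolding e c[OF lm(1), symmetric] using b by (intro nn_integral_mono) (auto simp: indicator_def)
  then show "l * (v - u) \<le> volume_below n K v - volume_below n K u"
    unfolding volume_below_diff[OF K uv] using fin lm uv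
    by (subst (asm) emeasure_eq_ennreal_measure) auto
  have "emeasure lborel ?S \<le> ennreal (m * (v - u))"
    unfolding e c[OF lm(2), symmetric] using b by (intro nn_integral_mono) (auto simp: indicator_def)
  then show "volume_below n K v - volume_below n K u \<le> m * (v - u)"
    unfolding volume_below_diff[OF K uv] using fin lm uv
    by (subst (asm) emeasure_eq_ennreal_measure) (auto simp: ennreal_le_iff)
qed

lemma volume_below_has_derivative:
  fixes K :: "'a::euclidean_space set"
  assumes K: "compact K" "convex K" and n: "norm n = 1"
    and p: "p \<in> K" "p \<bullet> n < s" and q: "q \<in> K" "s < q \<bullet> n"
  shows "(volume_below n K has_real_derivative enn2real (slice_area n K s)) (at s)"
proof -
  let ?a = "\<lambda>r. enn2real (slice_area n K r)"
  have a: "slice_area n K r = ennreal (?a r)" for r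
    using slice_area_finite[OF K(1) n, of r] by simp
  have cont: "isCont ?a s" by (rule isCont_slice_area[OF K n p q])
  show ?thesis
    unfolding has_field_derivative_iff
  proof (rule tendstoI)
    fix e :: real assume e: "0 < e"
    then obtain d where d: "0 < d" "\<And>r. \<bar>r - s\<bar> < d \<Longrightarrow> \<bar>?a r - ?a s\<bar> < e/2"
      using cont[unfolded continuous_at_eps_delta, rule_format, of "e/2"] by (auto simp: dist_real_def)
    have key: "\<bar>(volume_below n K v - volume_below n K u) - ?a s * (v - u)\<bar> \<le> e/2 * (v - u)"
      if uv: "u \<le> v" "\<bar>u - s\<bar> < d" "\<bar>v - s\<bar> < d" for u v
    proof -
      have ar: "\<bar>?a r - ?a s\<bar> < e/2" if "u \<le> r" "r \<le> v" for r using d(2)[of r] uv that by auto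
      have nn: "0 \<le> ?a r" for r by simp
      have b: "ennreal (max 0 (?a s - e/2)) \<le> slice_area n K r \<and> slice_area n K r \<le> ennreal (?a s + e/2)"
        if "u \<le> r" "r \<le> v" for r
      proof -
        have "max 0 (?a s - e/2) \<le> ?a r" "?a r \<le> ?a s + e/2" using ar[OF that] nn[of r] by linarith+
        then show ?thesis using a[of r] by (metis ennreal_leI)
      qed
      have "0 \<le> ?a s + e/2" using nn[of s] e by simp
      have B: "max 0 (?a s - e/2) * (v - u) \<le> volume_below n K v - volume_below n K u"
          "volume_below n K v - volume_below n K u \<le> (?a s + e/2) * (v - u)"
        using volume_below_diff_bounds[OF K(1) n uv(1) _ \<open>0 \<le> ?a s + e/2\<close> b] by auto
      have "(?a s - e/2) * (v - u) \<le> max 0 (?a s - e/2) * (v - u)" using uv by (intro mult_right_mono) auto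
      then have "(?a s - e/2) * (v - u) \<le> volume_below n K v - volume_below n K u"
        using B(1) by (rule order_trans)
      then have "- (e/2 * (v - u)) \<le> (volume_below n K v - volume_below n K u) - ?a s * (v - u)"
        by (simp add: left_diff_distrib)
      moreover have "(volume_below n K v - volume_below n K u) - ?a s * (v - u) \<le> e/2 * (v - u)"
        using B(2) by (simp add: distrib_right)
      ultimately show ?thesis by (intro abs_leI) (simp_all only: minus_le_iff)
    qed
    have "\<bar>(volume_below n K r - volume_below n K s) / (r - s) - ?a s\<bar> < e" if r: "r \<noteq> s" "\<bar>r - s\<bar> < d" for r
    proof -
      have "\<bar>(volume_below n K r - volume_below n K s) - ?a s * (r - s)\<bar> \<le> e/2 * \<bar>r - s\<bar>"
      proof (cases "s \<le> r")
        case True then show ?thesis using key[of s r] r d by simp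
      next
        case False
        then have "\<bar>(volume_below n K s - volume_below n K r) - ?a s * (s - r)\<bar> \<le> e/2 * (s - r)"
          using key[of r s] r d by simp
        moreover have "\<bar>(volume_below n K r - volume_below n K s) - ?a s * (r - s)\<bar>
            = \<bar>(volume_below n K s - volume_below n K r) - ?a s * (s - r)\<bar>"
          by (subst abs_minus_cancel[symmetric]) (simp add: algebra_simps)
        ultimately show ?thesis using False by simp
      qed
      moreover have "(volume_below n K r - volume_below n K s) / (r - s) - ?a s
          = ((volume_below n K r - volume_below n K s) - ?a s * (r - s)) / (r - s)"
        using r by (simp add: field_simps)
      ultimately have "\<bar>(volume_below n K r - volume_below n K s) / (r - s) - ?a s\<bar> \<le> e/2"
        using r by (simp add: abs_divide divide_le_eq)
      then show ?thesis using e by simp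
    qed
    then show "\<forall>\<^sub>F r in at s. dist ((volume_below n K r - volume_below n K s) / (r - s)) (?a s) < e"
      unfolding eventually_at using d(1) by (intro exI[of _ d]) (auto simp: dist_real_def)
  qed
qed

section \<open>Hausdorff measure of subsets of a hyperplane\<close>

definition tube :: "'a::euclidean_space \<Rightarrow> real \<Rightarrow> 'a set" where
  "tube n \<rho> = {y. norm (y - (y \<bullet> n) *\<^sub>R n) \<le> \<rho>}"

lemma tube_borel [measurable]: "tube n \<rho> \<in> sets borel"
  unfolding tube_def by measurable

lemma perp_along:
  fixes n :: "'a::euclidean_space"
  assumes n: "norm n = 1"
  shows "(y + t *\<^sub>R n) - ((y + t *\<^sub>R n) \<bullet> n) *\<^sub>R n = y - (y \<bullet> n) *\<^sub>R n"
  by (simp only: inner_along[OF n]) (simp add: algebra_simps)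

lemma slice_tube:
  assumes n: "norm n = 1"
  shows "slice_cylinder n (tube n \<rho>) r = {y. 0 \<le> y \<bullet> n \<and> y \<bullet> n \<le> 1} \<inter> tube n \<rho>"
  by (auto simp: slice_cylinder_def tube_def perp_along[OF n])

lemma slice_area_tube:
  assumes n: "norm n = 1"
  shows "slice_area n (tube n \<rho>) r = slice_area n (tube n \<rho>) 0"
  by (simp add: slice_area_def slice_tube[OF n])

text \<open>
  Scaling by \<open>\<rho>\<close> takes the unit tube of height one to the tube of radius \<open>\<rho>\<close> and height \<open>\<rho>\<close>; the
  height takes one of the \<open>d\<close> factors.
\<close>

lemma slice_area_tube_scale:
  fixes n :: "'a::euclidean_space"
  assumes n: "norm n = 1" and \<rho>: "0 < \<rho>"
  shows "slice_area n (tube n \<rho>) 0 = ennreal (\<rho> ^ (DIM('a) - 1)) * slice_area n (tube n 1) 0"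
proof -
  let ?S = "tube n \<rho> \<inter> {x. x \<bullet> n \<in> {0..\<rho>}}"
  have "emeasure lborel ?S = (\<integral>\<^sup>+r. indicator {0..\<rho>} r * slice_area n (tube n \<rho>) r \<partial>lborel)"
    by (rule cavalieri_Int[OF _ _ n]) auto
  also have "\<dots> = (\<integral>\<^sup>+r. slice_area n (tube n \<rho>) 0 * indicator {0..\<rho>} r \<partial>lborel)"
    by (intro nn_integral_cong, subst slice_area_tube[OF n]) (rule mult.commute)
  also have "\<dots> = ennreal \<rho> * slice_area n (tube n \<rho>) 0"
    using \<rho> by (subst nn_integral_cmult_indicator) (auto simp: mult.commute)
  finally have 1: "emeasure lborel ?S = ennreal \<rho> * slice_area n (tube n \<rho>) 0" .
  have S: "{x. 0 + \<rho> *\<^sub>R x \<in> ?S} = slice_cylinder n (tube n 1) 0"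
  proof (rule set_eqI)
    fix x :: 'a
    have "norm (\<rho> *\<^sub>R x - (\<rho> * (x \<bullet> n)) *\<^sub>R n) = \<rho> * norm (x - (x \<bullet> n) *\<^sub>R n)"
      using \<rho> by (simp add: scaleR_diff_right[symmetric] flip: scaleR_scaleR)
    then show "x \<in> {x. 0 + \<rho> *\<^sub>R x \<in> ?S} \<longleftrightarrow> x \<in> slice_cylinder n (tube n 1) 0"
      unfolding slice_tube[OF n] using \<rho> by (auto simp: tube_def zero_le_mult_iff)
  qed
  have "emeasure lborel ?S = ennreal (\<bar>\<rho>\<bar> ^ DIM('a)) * emeasure lborel {x. 0 + \<rho> *\<^sub>R x \<in> ?S}"
    using \<rho> by (intro emeasure_lborel_affine) auto
  also have "\<dots> = ennreal (\<rho> ^ DIM('a)) * slice_area n (tube n 1) 0"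
    unfolding S slice_area_def using \<rho> by simp
  also have "\<rho> ^ DIM('a) = \<rho> * \<rho> ^ (DIM('a) - 1)"
    by (metis DIM_positive Suc_diff_1 power_Suc)
  finally have 2: "emeasure lborel ?S = ennreal \<rho> * (ennreal (\<rho> ^ (DIM('a) - 1)) * slice_area n (tube n 1) 0)"
    using \<rho> by (simp add: ennreal_mult mult.assoc)
  from 1 2 show ?thesis using \<rho> by (simp add: ennreal_mult_cancel_left)
qed

lemma unit_ball_vol_recursion:
  assumes "0 < d"
  shows "unit_ball_vol (real d) = unit_ball_vol (real (d - 1)) * Beta (1/2) (real (d - 1) / 2 + 1)"
proof -
  have e: "real d = real (d - 1) + 1" using assms by simp
  have pos: "Gamma (real (d - 1) / 2 + 1) > 0" "Gamma (real d / 2 + 1) > 0"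
    by (intro Gamma_real_pos; simp)+
  have pw: "pi powr (real d / 2) = pi powr (real (d - 1) / 2) * sqrt pi"
    by (subst e) (simp add: add_divide_distrib powr_add powr_half_sqrt)
  have arg: "1/2 + (real (d - 1) / 2 + 1) = real d / 2 + 1"
    by (subst e) (simp add: add_divide_distrib)
  have cancel: "P * s / G2 = P / G1 * (s * G1 / G2)" if "0 < G1" for P s G1 G2 :: real
    using that by simp
  show ?thesis
    unfolding unit_ball_vol_def Beta_def arg pw Gamma_one_half_real by (rule cancel[OF pos(1)])
qed

text \<open>
  Slicing the unit ball orthogonally to \<open>n\<close> writes its volume as the area of the unit disc times a
  Beta integral. The volumes of the unit balls in consecutive dimensions differ by the same factor, which
  identifies the area whatever the direction of \<open>n\<close>.
\<close>

lemma slice_area_unit_tube: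
  fixes n :: "'a::euclidean_space"
  assumes n: "norm n = 1"
  shows "slice_area n (tube n 1) 0 = ennreal (unit_ball_vol (real (DIM('a) - 1)))"
proof -
  let ?d = "DIM('a)"
  let ?B = "Beta (1/2) (real (?d - 1) / 2 + 1)"
  have Bpos: "0 < ?B" 
  proof -
    have "0 \<le> real (?d - 1)" by simp
    then show ?thesis unfolding Beta_def
      by (intro divide_pos_pos mult_pos_pos Gamma_real_pos; linarith)
  qed
  have slice: "slice_area n (cball 0 1) r = slice_area n (tube n 1) 0 * (indicator {-1..1} r * sqrt (1 - r\<^sup>2) ^ (?d - 1))"
    if r: "r \<noteq> 1" "r \<noteq> -1" for r
  proof -
    have pyth: "(norm (y + (r - y \<bullet> n) *\<^sub>R n))\<^sup>2 = (norm (y - (y \<bullet> n) *\<^sub>R n))\<^sup>2 + r\<^sup>2" for y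
    proof -
      have "orthogonal (y - (y \<bullet> n) *\<^sub>R n) (r *\<^sub>R n)"
        using n by (simp add: orthogonal_def inner_diff_left dot_square_norm)
      then have "(norm ((y - (y \<bullet> n) *\<^sub>R n) + r *\<^sub>R n))\<^sup>2 = (norm (y - (y \<bullet> n) *\<^sub>R n))\<^sup>2 + (norm (r *\<^sub>R n))\<^sup>2"
        by (rule norm_add_Pythagorean)
      then show ?thesis using n by (simp add: scaleR_left_diff_distrib algebra_simps)
    qed
    have mem: "y + (r - y \<bullet> n) *\<^sub>R n \<in> cball 0 1 \<longleftrightarrow> (norm (y - (y \<bullet> n) *\<^sub>R n))\<^sup>2 \<le> 1 - r\<^sup>2" for y
    proof -
      have "y + (r - y \<bullet> n) *\<^sub>R n \<in> cball 0 1 \<longleftrightarrow> (norm (y + (r - y \<bullet> n) *\<^sub>R n))\<^sup>2 \<le> 1"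
        by (simp add: abs_square_le_1)
      then show ?thesis unfolding pyth by auto
    qed
    show ?thesis
    proof (cases "\<bar>r\<bar> < 1")
      case True
      then have r1: "0 < 1 - r\<^sup>2" by (simp add: abs_square_less_1)
      have "slice_cylinder n (cball 0 1) r = slice_cylinder n (tube n (sqrt (1 - r\<^sup>2))) 0"
      proof (rule set_eqI)
        fix y :: 'a
        have "(norm (y - (y \<bullet> n) *\<^sub>R n))\<^sup>2 \<le> 1 - r\<^sup>2 \<longleftrightarrow> norm (y - (y \<bullet> n) *\<^sub>R n) \<le> sqrt (1 - r\<^sup>2)"
          using r1 by (metis norm_ge_zero real_le_lsqrt real_sqrt_le_iff real_sqrt_unique less_imp_le)
        then show "y \<in> slice_cylinder n (cball 0 1) r \<longleftrightarrow> y \<in> slice_cylinder n (tube n (sqrt (1 - r\<^sup>2))) 0"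
          unfolding slice_tube[OF n] by (simp only: slice_cylinder_def mem mem_Collect_eq tube_def Int_iff conj_assoc)
      qed
      then have "slice_area n (cball 0 1) r = ennreal (sqrt (1 - r\<^sup>2) ^ (?d - 1)) * slice_area n (tube n 1) 0"
        using slice_area_tube_scale[OF n, of "sqrt (1 - r\<^sup>2)"] r1 by (simp add: slice_area_def)
      then show ?thesis using True by (simp add: mult.commute abs_less_iff less_imp_le)
    next
      case False
      then have "1 < \<bar>r\<bar>" using r by auto
      then have "1 - r\<^sup>2 < 0" by (metis abs_square_less_1 diff_less_0_iff_less abs_square_le_1 not_less)
      then have no: "\<not> (norm (y - (y \<bullet> n) *\<^sub>R n))\<^sup>2 \<le> 1 - r\<^sup>2" for y
        using zero_le_power2[of "norm (y - (y \<bullet> n) *\<^sub>R n)"] by linarith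
      then have "slice_cylinder n (cball 0 1) r = {}"
        unfolding slice_cylinder_def mem using no by blast
      moreover have "r \<notin> {-1..1}" using \<open>1 < \<bar>r\<bar>\<close> by auto
      ultimately show ?thesis by (simp add: slice_area_def)
    qed
  qed
  have "ennreal (unit_ball_vol (real ?d)) = emeasure lborel (cball (0::'a) 1)"
    by (simp add: emeasure_cball)
  also have "\<dots> = (\<integral>\<^sup>+r. slice_area n (cball 0 1) r \<partial>lborel)" by (rule cavalieri[OF _ n]) simp
  also have "\<dots> = (\<integral>\<^sup>+r. slice_area n (tube n 1) 0 * ennreal (indicator {-1..1} r * sqrt (1 - r\<^sup>2) ^ (?d - 1)) \<partial>lborel)"
    using slice by (intro nn_integral_cong_AE AE_I[of _ _ "{1, -1}"]) (auto simp: emeasure_lborel_countable)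
  also have "\<dots> = slice_area n (tube n 1) 0 * ennreal ?B"
    by (subst nn_integral_cmult) (auto simp: emeasure_cball_aux_integral)
  finally have "ennreal ?B * slice_area n (tube n 1) 0 = ennreal ?B * ennreal (unit_ball_vol (real (?d - 1)))"
    using Bpos by (subst (asm) unit_ball_vol_recursion) (auto simp: ennreal_mult mult.commute)
  then show ?thesis using Bpos by (simp add: ennreal_mult_cancel_left del: of_nat_diff)
qed

lemma slice_area_tube_eq:
  fixes n :: "'a::euclidean_space"
  assumes n: "norm n = 1" and \<rho>: "0 < \<rho>"
  shows "slice_area n (tube n \<rho>) r = ennreal (unit_ball_vol (real (DIM('a) - 1)) * \<rho> ^ (DIM('a) - 1))"
  unfolding slice_area_tube[OF n, of \<rho> r] slice_area_tube_scale[OF n \<rho>] slice_area_unit_tube[OF n]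
  using \<rho> by (simp add: ennreal_mult mult.commute)

text \<open>
  The limit of positive radii. At radius 0 the right-hand side is 1 in dimension one and 0 in higher
  dimensions.
\<close>

lemma slice_area_tube_le:
  fixes n :: "'a::euclidean_space"
  assumes n: "norm n = 1" and \<rho>: "0 \<le> \<rho>"
  shows "slice_area n (tube n \<rho>) r \<le> ennreal (unit_ball_vol (real (DIM('a) - 1)) * \<rho> ^ (DIM('a) - 1))"
proof -
  let ?w = "\<lambda>t. ennreal (unit_ball_vol (real (DIM('a) - 1)) * t ^ (DIM('a) - 1))"
  have "(?w \<longlongrightarrow> ?w \<rho>) (at_right \<rho>)"
    by (intro tendsto_ennrealI tendsto_intros)
  moreover have "slice_area n (tube n \<rho>) r \<le> ?w t" if "\<rho> < t" for t
  proof -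
    have "tube n \<rho> \<subseteq> tube n t" using that by (auto simp: tube_def)
    then have "slice_area n (tube n \<rho>) r \<le> slice_area n (tube n t) r"
      unfolding slice_area_def by (intro emeasure_mono) (auto simp: slice_cylinder_def)
    then show ?thesis using that \<rho> slice_area_tube_eq[OF n, of t r] by simp
  qed
  ultimately show ?thesis
    by (intro tendsto_lowerbound[of ?w _ "at_right \<rho>"]) (auto simp: eventually_at_filter)
qed

lemma ennreal_square_le:
  fixes x y :: ennreal
  assumes "x\<^sup>2 \<le> y\<^sup>2"
  shows "x \<le> y"
proof (cases y)
  case y: (real b)
  show ?thesis
  proof (cases x)
    case (real a)
    then have "a\<^sup>2 \<le> b\<^sup>2" using assms y by (simp add: ennreal_power)
    then have "a \<le> b" by (rule power2_le_imp_le) (rule y)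
    then show ?thesis unfolding real y by (rule ennreal_leI)
  next
    case top
    have "(top::ennreal)\<^sup>2 = top" by (simp add: power2_eq_square)
    then have "top \<le> ennreal (b\<^sup>2)" using assms y unfolding top by (simp add: ennreal_power)
    then show ?thesis by (simp add: top_unique)
  qed
qed simp

text \<open>
  The cylinder \<open>Y\<close> over the slice and its mirror image have equal volumes, and their midpoints
  lie in a cylinder over a disc: the component of a difference of two points of \<open>Y\<close> orthogonal to
  \<open>n\<close> is a difference of two points of \<open>T\<close>, so its length is at most the diameter.
\<close>

theorem isodiametric_slice:
  fixes T :: "'a::euclidean_space set"
  assumes T: "compact T" and n: "norm n = 1"
  shows "slice_area n T c \<le> hausdorff_weight (DIM('a) - 1) T"
proof (cases "T = {}")
  case True then show ?thesis by (simp add: slice_area_def slice_cylinder_def)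
next
  case False
  define Y where "Y = slice_cylinder n T c"
  define D where "D = diameter T / 2"
  \<comment> \<open>The disc cylinder of height one, centred at the origin: hence the shift by half of n.\<close>
  define M where "M = {z. n /\<^sub>R 2 + z \<in> slice_cylinder n (tube n D) 0}"
  have T' [measurable]: "T \<in> sets borel" using T by (rule borel_compact)
  have [measurable]: "Y \<in> sets borel" by (simp add: Y_def)
  have [measurable]: "M \<in> sets borel" unfolding M_def by measurable
  have D: "0 \<le> D" using diameter_ge_0[OF compact_imp_bounded[OF T]] by (simp add: D_def)
  have nn: "n \<bullet> n = 1" using n by (simp add: dot_square_norm)
  have neg: "emeasure lborel {x. - x \<in> Y} = emeasure lborel Y"
    using emeasure_lborel_affine[of Y "-1" 0] by simp
  have "emeasure lborel Y * emeasure lborel {x. - x \<in> Y} \<le> (emeasure lborel M)\<^sup>2"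
  proof (rule brunn_minkowski_midpoint)
    fix x y assume "x \<in> Y" "y \<in> {x. - x \<in> Y}"
    then have x: "0 \<le> x \<bullet> n" "x \<bullet> n \<le> 1" "x + (c - x \<bullet> n) *\<^sub>R n \<in> T"
      and y: "- y \<bullet> n \<ge> 0" "- y \<bullet> n \<le> 1" "- y + (c + y \<bullet> n) *\<^sub>R n \<in> T"
      by (auto simp: Y_def slice_cylinder_def)
    let ?z = "n /\<^sub>R 2 + (1/2) *\<^sub>R (x + y)"
    have zn: "?z \<bullet> n = 1/2 + (x \<bullet> n + y \<bullet> n) / 2" using nn by (simp add: inner_left_distrib)
    have "?z - (?z \<bullet> n) *\<^sub>R n = (1/2) *\<^sub>R ((x + (c - x \<bullet> n) *\<^sub>R n) - (- y + (c + y \<bullet> n) *\<^sub>R n))"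
      unfolding zn by (simp add: scaleR_add_right scaleR_diff_right scaleR_left_diff_distrib scaleR_left_distrib add_divide_distrib)
    then have "norm (?z - (?z \<bullet> n) *\<^sub>R n) = dist (x + (c - x \<bullet> n) *\<^sub>R n) (- y + (c + y \<bullet> n) *\<^sub>R n) / 2"
      by (simp add: dist_norm)
    also have "\<dots> \<le> D" unfolding D_def
      using diameter_bounded_bound[OF compact_imp_bounded[OF T] x(3) y(3)] by simp
    finally have "norm (?z - (?z \<bullet> n) *\<^sub>R n) \<le> D" .
    moreover have "0 \<le> ?z \<bullet> n" "?z \<bullet> n \<le> 1" unfolding zn using x(1,2) y(1,2) by (simp_all add: field_simps)
    ultimately show "(1/2) *\<^sub>R (x + y) \<in> M"
      unfolding M_def slice_tube[OF n] by (simp add: tube_def)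
  qed auto
  then have "(slice_area n T c)\<^sup>2 \<le> (emeasure lborel M)\<^sup>2"
    unfolding neg by (simp add: Y_def slice_area_def power2_eq_square)
  then have "slice_area n T c \<le> emeasure lborel M"
    by (rule ennreal_square_le)
  also have "\<dots> = slice_area n (tube n D) 0"
    unfolding M_def slice_area_def by (rule emeasure_lborel_translate) simp
  also have "\<dots> \<le> hausdorff_weight (DIM('a) - 1) T"
    using slice_area_tube_le[OF n D, of 0] False by (simp add: hausdorff_weight_def D_def)
  finally show ?thesis .
qed

text \<open>
  Passing to closures does not change the diameters of the members of a covering, and each member
  has at least the area of its slice by the isodiametric inequality.
\<close>

lemma slice_area_le_hausdorff:
  fixes F :: "'a::euclidean_space set"
  assumes n: "norm n = 1"
  shows "slice_area n F c \<le> hausdorff_measure (DIM('a) - 1) F"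
proof -
  have "slice_area n F c \<le> hausdorff_premeasure (DIM('a) - 1) 1 F"
    unfolding hausdorff_premeasure_def
  proof (rule INF_greatest)
    fix U :: "nat \<Rightarrow> 'a set" assume "U \<in> {U. F \<subseteq> (\<Union>i. U i) \<and> (\<forall>i. bounded (U i) \<and> diameter (U i) \<le> 1)}"
    then have U: "F \<subseteq> (\<Union>i. U i)" "\<And>i. bounded (U i)" by auto
    have "slice_area n F c \<le> emeasure lborel (\<Union>i. slice_cylinder n (closure (U i)) c)"
      unfolding slice_area_def
    proof (rule emeasure_mono)
      have "F \<subseteq> (\<Union>i. closure (U i))" using U(1) closure_subset by blast
      then show "slice_cylinder n F c \<subseteq> (\<Union>i. slice_cylinder n (closure (U i)) c)"
        unfolding slice_cylinder_def by blast
    qed measurable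
    also have "\<dots> \<le> (\<Sum>i. slice_area n (closure (U i)) c)"
      unfolding slice_area_def by (rule emeasure_subadditive_countably) auto
    also have "\<dots> \<le> (\<Sum>i. hausdorff_weight (DIM('a) - 1) (U i))"
    proof (rule suminf_le)
      fix i
      have "slice_area n (closure (U i)) c \<le> hausdorff_weight (DIM('a) - 1) (closure (U i))"
        using U(2) by (intro isodiametric_slice[OF _ n]) (simp add: compact_closure)
      also have "\<dots> = hausdorff_weight (DIM('a) - 1) (U i)"
        using diameter_closure[OF U(2)[of i]] by (simp add: hausdorff_weight_def)
      finally show "slice_area n (closure (U i)) c \<le> hausdorff_weight (DIM('a) - 1) (U i)" .
    qed auto
    finally show "slice_area n F c \<le> (\<Sum>i. hausdorff_weight (DIM('a) - 1) (U i))" .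
  qed
  also have "\<dots> \<le> hausdorff_measure (DIM('a) - 1) F"
    unfolding hausdorff_measure_def by (rule SUP_upper) simp
  finally show ?thesis .
qed

lemma hausdorff_premeasure_le:
  assumes "A \<subseteq> (\<Union>i. U i)" "\<And>i::nat. bounded (U i)" "\<And>i. diameter (U i) \<le> \<delta>"
  shows "hausdorff_premeasure s \<delta> A \<le> (\<Sum>i. hausdorff_weight s (U i))"
  unfolding hausdorff_premeasure_def by (rule INF_lower) (use assms in auto)

lemma hausdorff_premeasure_mono:
  assumes "A \<subseteq> B"
  shows "hausdorff_premeasure s \<delta> A \<le> hausdorff_premeasure s \<delta> B"
  unfolding hausdorff_premeasure_def by (rule INF_superset_mono) (use assms in auto)

lemma hausdorff_premeasure_remove:
  assumes D: "bounded D" "diameter D \<le> \<delta>"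
  shows "hausdorff_premeasure s \<delta> A \<le> hausdorff_weight s D + hausdorff_premeasure s \<delta> (A - D)"
proof -
  have "hausdorff_premeasure s \<delta> A \<le> hausdorff_weight s D + (\<Sum>i. hausdorff_weight s (U i))"
    if U: "A - D \<subseteq> (\<Union>i. U i)" "\<forall>i::nat. bounded (U i) \<and> diameter (U i) \<le> \<delta>" for U
  proof -
    let ?U = "\<lambda>i. case i of 0 \<Rightarrow> D | Suc j \<Rightarrow> U j"
    have "A \<subseteq> (\<Union>i. ?U i)"
    proof
      fix x assume x: "x \<in> A"
      show "x \<in> (\<Union>i. ?U i)"
      proof (cases "x \<in> D")
        case True then show ?thesis by (intro UN_I[of 0]) auto
      next
        case False
        then obtain j where "x \<in> U j" using U x by auto
        then show ?thesis by (intro UN_I[of "Suc j"]) auto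
      qed
    qed
    then have "hausdorff_premeasure s \<delta> A \<le> (\<Sum>i. hausdorff_weight s (?U i))"
      by (rule hausdorff_premeasure_le) (use U D in \<open>auto split: nat.split\<close>)
    also have "\<dots> = hausdorff_weight s D + (\<Sum>i. hausdorff_weight s (U i))"
      using suminf_offset[of "\<lambda>i. hausdorff_weight s (?U i)" 1] by (simp add: add.commute)
    finally show ?thesis .
  qed
  note le = this
  show ?thesis
  proof (rule ennreal_le_epsilon)
    fix e :: real assume e: "0 < e" and fin: "hausdorff_weight s D + hausdorff_premeasure s \<delta> (A - D) < top"
    have "hausdorff_premeasure s \<delta> (A - D) < hausdorff_premeasure s \<delta> (A - D) + ennreal e"
      using e fin by (cases "hausdorff_premeasure s \<delta> (A - D)") (auto simp: ennreal_less_iff simp flip: ennreal_plus)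
    then obtain U where U: "A - D \<subseteq> (\<Union>i. U i)" "\<forall>i::nat. bounded (U i) \<and> diameter (U i) \<le> \<delta>"
        and lt: "(\<Sum>i. hausdorff_weight s (U i)) < hausdorff_premeasure s \<delta> (A - D) + ennreal e"
      unfolding hausdorff_premeasure_def[of s \<delta> "A - D"] by (auto simp: INF_less_iff)
    show "hausdorff_premeasure s \<delta> A \<le> hausdorff_weight s D + hausdorff_premeasure s \<delta> (A - D) + ennreal e"
      using order_trans[OF le[OF U] add_left_mono[OF less_imp_le[OF lt]]] by (simp add: add.assoc)
  qed
qed

lemma slice_area_disc:
  fixes p :: "'a::euclidean_space"
  assumes n: "norm n = 1" and p: "p \<bullet> n = c" and \<rho>: "0 < \<rho>"
  shows "slice_area n (cball p \<rho>) c = hausdorff_weight (DIM('a) - 1) (cball p \<rho>)"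
proof -
  define t where "t = p - c *\<^sub>R n"
  have tn: "t \<bullet> n = 0" using n p by (simp add: t_def inner_diff_left dot_square_norm)
  have "{x. t + x \<in> slice_cylinder n (cball p \<rho>) c} = slice_cylinder n (tube n \<rho>) 0"
  proof (rule set_eqI)
    fix x :: 'a
    have "dist p (t + x + (c - (t + x) \<bullet> n) *\<^sub>R n) = norm (x - (x \<bullet> n) *\<^sub>R n)"
      by (subst dist_commute) (simp add: dist_norm inner_left_distrib tn scaleR_left_diff_distrib, simp add: t_def)
    then show "x \<in> {x. t + x \<in> slice_cylinder n (cball p \<rho>) c} \<longleftrightarrow> x \<in> slice_cylinder n (tube n \<rho>) 0"
      unfolding slice_tube[OF n] by (auto simp: slice_cylinder_def tube_def inner_left_distrib tn)
  qed
  then have "slice_area n (cball p \<rho>) c = slice_area n (tube n \<rho>) 0"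
    unfolding slice_area_def by (subst emeasure_lborel_translate[of _ t, symmetric]) auto
  also have "\<dots> = hausdorff_weight (DIM('a) - 1) (cball p \<rho>)"
    using \<rho> slice_area_tube_eq[OF n \<rho>, of 0] by (simp add: hausdorff_weight_def)
  finally show ?thesis .
qed

lemma hausdorff_weight_cball_5:
  fixes p :: "'a::euclidean_space"
  assumes "0 < \<rho>"
  shows "hausdorff_weight s (cball p (5 * \<rho>)) = ennreal (5 ^ s) * hausdorff_weight s (cball p \<rho>)"
  using assms by (simp add: hausdorff_weight_def power_mult_distrib flip: ennreal_mult)

text \<open>
  The radii are at most \<open>\<delta> / 10\<close> in order that the discs enlarged five times have diameter at most
  \<open>\<delta>\<close>.
\<close>

lemma vitali_discs:
  fixes O' :: "'a::euclidean_space set"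
  assumes O: "open O'" and \<delta>: "0 < \<delta>"
  obtains a :: "nat \<Rightarrow> 'a" and r J where
    "\<forall>i\<in>J. 0 < r i \<and> 10 * r i \<le> \<delta> \<and> a i \<bullet> n = c \<and> cball (a i) (r i) \<subseteq> O'"
    "\<forall>i\<in>J. \<forall>j\<in>J. i \<noteq> j \<longrightarrow> disjnt (cball (a i) (r i)) (cball (a j) (r j))"
    "O' \<inter> {x. x \<bullet> n = c} \<subseteq> (\<Union>i\<in>J. cball (a i) (5 * r i))"
proof -
  define K where "K = {(p, \<rho>). p \<bullet> n = c \<and> 0 < \<rho> \<and> 10 * \<rho> \<le> \<delta> \<and> cball p \<rho> \<subseteq> O'}"
  have "O' \<inter> {x. x \<bullet> n = c} \<subseteq> (\<Union>i\<in>K. cball (fst i) (snd i))"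
  proof
    fix p assume p: "p \<in> O' \<inter> {x. x \<bullet> n = c}"
    then obtain e where e: "0 < e" "cball p e \<subseteq> O'" using O open_contains_cball by blast
    have "(p, min e (\<delta> / 10)) \<in> K" using p e \<delta> by (auto simp: K_def)
    moreover have "p \<in> cball p (min e (\<delta> / 10))" using e \<delta> by auto
    ultimately show "p \<in> (\<Union>i\<in>K. cball (fst i) (snd i))" by force
  qed
  moreover have "\<And>i. i \<in> K \<Longrightarrow> 0 < snd i \<and> snd i \<le> \<delta>" by (auto simp: K_def)
  ultimately obtain C where C: "countable C" "C \<subseteq> K"
     "pairwise (\<lambda>i j. disjnt (cball (fst i) (snd i)) (cball (fst j) (snd j))) C"
     "O' \<inter> {x. x \<bullet> n = c} \<subseteq> (\<Union>i\<in>C. cball (fst i) (5 * snd i))"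
    by (rule Vitali_covering_lemma_cballs)
  define f where "f = from_nat_into C"
  define J where "J = to_nat_on C ` C"
  have fC: "f i \<in> C" if "i \<in> J" for i using that C(1) by (auto simp: f_def J_def)
  have inj: "inj_on f J" using C(1) by (auto simp: f_def J_def inj_on_def)
  have fJ: "f ` J = C" using C(1) by (force simp: f_def J_def image_image)
  show ?thesis
  proof (rule that[of J "snd \<circ> f" "fst \<circ> f"])
    have "0 < (snd \<circ> f) i \<and> 10 * (snd \<circ> f) i \<le> \<delta> \<and> (fst \<circ> f) i \<bullet> n = c \<and> cball ((fst \<circ> f) i) ((snd \<circ> f) i) \<subseteq> O'"
      if "i \<in> J" for i
    proof -
      have "f i \<in> K" using fC[OF that] C(2) by blast
      then show ?thesis by (simp add: K_def case_prod_beta)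
    qed
    then show "\<forall>i\<in>J. 0 < (snd \<circ> f) i \<and> 10 * (snd \<circ> f) i \<le> \<delta> \<and> (fst \<circ> f) i \<bullet> n = c \<and> cball ((fst \<circ> f) i) ((snd \<circ> f) i) \<subseteq> O'"
      by blast
    have "disjnt (cball ((fst \<circ> f) i) ((snd \<circ> f) i)) (cball ((fst \<circ> f) j) ((snd \<circ> f) j))"
      if "i \<in> J" "j \<in> J" "i \<noteq> j" for i j
      using pairwiseD[OF C(3) fC[OF that(1)] fC[OF that(2)]] inj_onD[OF inj _ that(1,2)] that(3) by auto
    then show "\<forall>i\<in>J. \<forall>j\<in>J. i \<noteq> j \<longrightarrow> disjnt (cball ((fst \<circ> f) i) ((snd \<circ> f) i)) (cball ((fst \<circ> f) j) ((snd \<circ> f) j))"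
      by blast
    show "O' \<inter> {x. x \<bullet> n = c} \<subseteq> (\<Union>i\<in>J. cball ((fst \<circ> f) i) (5 * (snd \<circ> f) i))"
      using C(4) unfolding fJ[symmetric] by simp
  qed
qed

text \<open>
  The discs \<open>K i\<close> and the enlarged discs \<open>U i\<close> of the covering lemma, completed to sequences by empty sets.
\<close>

lemma disjoint_discs:
  fixes O' :: "'a::euclidean_space set"
  assumes O: "open O'" and \<delta>: "0 < \<delta>" and n: "norm n = 1"
  defines "s \<equiv> DIM('a) - 1"
  obtains K U :: "nat \<Rightarrow> 'a set" where
    "\<forall>i. closed (K i) \<and> bounded (K i) \<and> diameter (K i) \<le> \<delta> \<and> K i \<subseteq> O'"
    "\<forall>i. closed (U i) \<and> bounded (U i) \<and> diameter (U i) \<le> \<delta>"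
    "disjoint_family K" "O' \<inter> {x. x \<bullet> n = c} \<subseteq> (\<Union>i. U i)"
    "\<forall>i. hausdorff_weight s (K i) = slice_area n (K i) c"
    "\<forall>i. hausdorff_weight s (U i) = ennreal (5 ^ s) * slice_area n (K i) c"
    "\<forall>i. slice_area n (U i) c = ennreal (5 ^ s) * slice_area n (K i) c"
proof -
  obtain a :: "nat \<Rightarrow> 'a" and r J where J0: "\<forall>i\<in>J. 0 < r i \<and> 10 * r i \<le> \<delta> \<and> a i \<bullet> n = c \<and> cball (a i) (r i) \<subseteq> O'"
    "\<forall>i\<in>J. \<forall>j\<in>J. i \<noteq> j \<longrightarrow> disjnt (cball (a i) (r i)) (cball (a j) (r j))"
    "O' \<inter> {x. x \<bullet> n = c} \<subseteq> (\<Union>i\<in>J. cball (a i) (5 * r i))"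
    by (rule vitali_discs[OF O \<delta>, where n=n and c=c])
  note J = J0[rule_format]
  have J2: "2 * r i \<le> \<delta>" if "i \<in> J" for i using J(1)[OF that] by linarith
  define K where "K i = (if i \<in> J then cball (a i) (r i) else {})" for i
  define U where "U i = (if i \<in> J then cball (a i) (5 * r i) else {})" for i
  have e: "hausdorff_weight t ({} :: 'a set) = 0" "slice_area n {} c = 0" for t
    by (auto simp: hausdorff_weight_def slice_area_def slice_cylinder_def)
  have w5: "hausdorff_weight s (U i) = ennreal (5 ^ s) * slice_area n (K i) c" for i
    using J(1)[of i] by (auto simp: U_def K_def e hausdorff_weight_cball_5 s_def slice_area_disc[OF n])
  show ?thesis
  proof (rule that[of K U])
    show "\<forall>i. closed (K i) \<and> bounded (K i) \<and> diameter (K i) \<le> \<delta> \<and> K i \<subseteq> O'"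
      using J(1) J2 \<delta> by (auto simp: K_def)
    show "\<forall>i. closed (U i) \<and> bounded (U i) \<and> diameter (U i) \<le> \<delta>"
      using J(1) J2 \<delta> by (auto simp: U_def)
    show "disjoint_family K" using J(2) by (auto simp: disjoint_family_on_def K_def disjnt_def)
    show "O' \<inter> {x. x \<bullet> n = c} \<subseteq> (\<Union>i. U i)" using J(3) by (auto simp: U_def)
    show "\<forall>i. hausdorff_weight s (K i) = slice_area n (K i) c"
      using J(1) by (auto simp: K_def e s_def slice_area_disc[OF n])
    show "\<forall>i. hausdorff_weight s (U i) = ennreal (5 ^ s) * slice_area n (K i) c" using w5 by blast
    show "\<forall>i. slice_area n (U i) c = ennreal (5 ^ s) * slice_area n (K i) c"
      unfolding w5[symmetric] using J(1) by (auto simp: U_def e s_def slice_area_disc[OF n])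
  qed
qed

lemma slice_cylinder_Union: "slice_cylinder n (\<Union>i\<in>I. K i) c = (\<Union>i\<in>I. slice_cylinder n (K i) c)"
  by (auto simp: slice_cylinder_def)

lemma slice_cylinder_mono: "K \<subseteq> L \<Longrightarrow> slice_cylinder n K c \<subseteq> slice_cylinder n L c"
  by (auto simp: slice_cylinder_def)

lemma disjoint_family_slice_cylinder:
  "disjoint_family_on K I \<Longrightarrow> disjoint_family_on (\<lambda>i. slice_cylinder n (K i) c) I"
  by (auto simp: disjoint_family_on_def slice_cylinder_def)

text \<open>
  The enlarged discs cover the set; the disjoint discs inside it bound the sum of their weights.
\<close>

lemma hausdorff_premeasure_open_crude:
  fixes O' :: "'a::euclidean_space set"
  assumes O: "open O'" and \<delta>: "0 < \<delta>" and n: "norm n = 1"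
  defines "s \<equiv> DIM('a) - 1"
  shows "hausdorff_premeasure s \<delta> (O' \<inter> {x. x \<bullet> n = c}) \<le> ennreal (5 ^ s) * slice_area n O' c"
proof -
  obtain K U :: "nat \<Rightarrow> 'a set" where
    K0: "\<forall>i. closed (K i) \<and> bounded (K i) \<and> diameter (K i) \<le> \<delta> \<and> K i \<subseteq> O'"
    and U0: "\<forall>i. closed (U i) \<and> bounded (U i) \<and> diameter (U i) \<le> \<delta>"
    and dis: "disjoint_family K" and cov: "O' \<inter> {x. x \<bullet> n = c} \<subseteq> (\<Union>i. U i)"
    and wK0: "\<forall>i. hausdorff_weight s (K i) = slice_area n (K i) c"
    and w0: "\<forall>i. hausdorff_weight s (U i) = ennreal (5 ^ s) * slice_area n (K i) c"
    and aU0: "\<forall>i. slice_area n (U i) c = ennreal (5 ^ s) * slice_area n (K i) c"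
    by (rule disjoint_discs[OF O \<delta> n, where c=c, folded s_def]) 
  note K = K0[rule_format] and U = U0[rule_format] and wK = wK0[rule_format] and w = w0[rule_format] and aU = aU0[rule_format]
  have [measurable]: "O' \<in> sets borel" "K i \<in> sets borel" for i using K O by auto
  have "hausdorff_premeasure s \<delta> (O' \<inter> {x. x \<bullet> n = c}) \<le> (\<Sum>i. hausdorff_weight s (U i))"
    by (rule hausdorff_premeasure_le[OF cov]) (use U in auto)
  also have "\<dots> = ennreal (5 ^ s) * (\<Sum>i. slice_area n (K i) c)" by (simp add: w)
  also have "(\<Sum>i. slice_area n (K i) c) = emeasure lborel (\<Union>i. slice_cylinder n (K i) c)"
    unfolding slice_area_def by (rule suminf_emeasure) (auto intro: disjoint_family_slice_cylinder dis)
  also have "\<dots> \<le> slice_area n O' c"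
    unfolding slice_area_def using K by (intro emeasure_mono) (auto simp: slice_cylinder_def)
  finally show ?thesis by (simp add: mult_left_mono)
qed

lemma hausdorff_premeasure_remove_finite:
  fixes K :: "nat \<Rightarrow> 'a::metric_space set"
  assumes "\<And>i. bounded (K i) \<and> diameter (K i) \<le> \<delta>"
  shows "hausdorff_premeasure s \<delta> A \<le> (\<Sum>i<N. hausdorff_weight s (K i)) + hausdorff_premeasure s \<delta> (A - (\<Union>i<N. K i))"
proof (induction N)
  case (Suc N)
  have "A - (\<Union>i<N. K i) - K N = A - (\<Union>i<Suc N. K i)" by (auto simp: less_Suc_eq)
  then have "hausdorff_premeasure s \<delta> (A - (\<Union>i<N. K i))
      \<le> hausdorff_weight s (K N) + hausdorff_premeasure s \<delta> (A - (\<Union>i<Suc N. K i))"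
    using hausdorff_premeasure_remove[of "K N" \<delta> s "A - (\<Union>i<N. K i)"] assms by auto
  from order_trans[OF Suc add_left_mono[OF this]] show ?case by (simp add: add.assoc)
qed simp

lemma slice_area_bounded_finite:
  assumes "bounded S" "norm n = 1"
  shows "slice_area n S c < \<infinity>"
proof -
  have "slice_area n S c \<le> slice_area n (closure S) c"
    unfolding slice_area_def by (intro emeasure_mono slice_cylinder_mono closure_subset) simp
  also have "\<dots> < \<infinity>" using assms by (intro slice_area_finite) (simp_all add: compact_closure)
  finally show ?thesis .
qed

text \<open>
  Since the enlarged discs cover the set, finitely many of the disjoint discs fill at least the
  fraction \<open>1 / (2 * 5\<^sup>s)\<close> of its area. The weights of these discs equal their areas, so the factor
  \<open>\<kappa>\<close> is spent only on what remains, which is relatively open again.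
\<close>

lemma hausdorff_premeasure_open_improve:
  fixes O' :: "'a::euclidean_space set"
  assumes O: "open O'" "bounded O'" and \<delta>: "0 < \<delta>" and n: "norm n = 1" and \<kappa>: "1 \<le> \<kappa>"
  defines "s \<equiv> DIM('a) - 1"
  assumes hyp: "\<And>O'::'a set. open O' \<Longrightarrow> bounded O' \<Longrightarrow>
      hausdorff_premeasure s \<delta> (O' \<inter> {x. x \<bullet> n = c}) \<le> ennreal \<kappa> * slice_area n O' c"
  shows "hausdorff_premeasure s \<delta> (O' \<inter> {x. x \<bullet> n = c}) \<le> ennreal (\<kappa> - (\<kappa> - 1) / (2 * 5 ^ s)) * slice_area n O' c"
proof (cases "slice_area n O' c = 0")
  case True
  then show ?thesis using hyp[OF O] by simp
next
  case False
  obtain K U :: "nat \<Rightarrow> 'a set" where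
    K0: "\<forall>i. closed (K i) \<and> bounded (K i) \<and> diameter (K i) \<le> \<delta> \<and> K i \<subseteq> O'"
    and U0: "\<forall>i. closed (U i) \<and> bounded (U i) \<and> diameter (U i) \<le> \<delta>"
    and dis: "disjoint_family K" and cov: "O' \<inter> {x. x \<bullet> n = c} \<subseteq> (\<Union>i. U i)"
    and wK0: "\<forall>i. hausdorff_weight s (K i) = slice_area n (K i) c"
    and w0: "\<forall>i. hausdorff_weight s (U i) = ennreal (5 ^ s) * slice_area n (K i) c"
    and aU0: "\<forall>i. slice_area n (U i) c = ennreal (5 ^ s) * slice_area n (K i) c"
    by (rule disjoint_discs[OF O(1) \<delta> n, where c=c, folded s_def]) 
  note K = K0[rule_format] and U = U0[rule_format] and wK = wK0[rule_format] and w = w0[rule_format] and aU = aU0[rule_format]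
  have [measurable]: "O' \<in> sets borel" "K i \<in> sets borel" "U i \<in> sets borel" for i using K U O by auto
  have fin: "slice_area n O' c < \<infinity>" by (rule slice_area_bounded_finite[OF O(2) n])
  define A where "A = enn2real (slice_area n O' c)"
  have A: "slice_area n O' c = ennreal A" "0 < A"
    using fin False by (auto simp: A_def enn2real_positive_iff zero_less_iff_neq_zero)
  define k where "k i = enn2real (slice_area n (K i) c)" for i
  have k: "slice_area n (K i) c = ennreal (k i)" "0 \<le> k i" for i
    using slice_area_bounded_finite[OF _ n, of "K i" c] K[of i] by (auto simp: k_def)
  have "ennreal A \<le> emeasure lborel (\<Union>i. slice_cylinder n (U i) c)"
    unfolding A(1)[symmetric] slice_area_def
  proof (rule emeasure_mono)
    show "slice_cylinder n O' c \<subseteq> (\<Union>i. slice_cylinder n (U i) c)"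
    proof
      fix y assume y: "y \<in> slice_cylinder n O' c"
      then have "y + (c - y \<bullet> n) *\<^sub>R n \<in> O' \<inter> {x. x \<bullet> n = c}"
        by (simp add: slice_cylinder_def inner_along[OF n])
      then show "y \<in> (\<Union>i. slice_cylinder n (U i) c)" using cov y by (auto simp: slice_cylinder_def)
    qed
  qed measurable
  also have "\<dots> \<le> (\<Sum>i. slice_area n (U i) c)"
    unfolding slice_area_def by (rule emeasure_subadditive_countably) auto
  also have "\<dots> = (\<Sum>i. ennreal (5 ^ s) * ennreal (k i))" by (simp only: aU k(1))
  finally have "ennreal A \<le> (\<Sum>i. ennreal (5 ^ s) * ennreal (k i))" .
  moreover have "ennreal (A / 2) < ennreal A" using A(2) by (simp add: ennreal_less_iff)
  ultimately have "ennreal (A / 2) < (\<Sum>i. ennreal (5 ^ s) * ennreal (k i))" by (rule less_le_trans[rotated])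
  then have "\<forall>\<^sub>F N in sequentially. ennreal (A / 2) < (\<Sum>i<N. ennreal (5 ^ s) * ennreal (k i))"
    by (rule order_tendstoD(1)[OF summable_LIMSEQ[OF summableI]])
  then obtain N where N: "ennreal (A / 2) < (\<Sum>i<N. ennreal (5 ^ s) * ennreal (k i))"
    by (auto simp: eventually_sequentially)
  define S where "S = (\<Sum>i<N. k i)"
  have S0: "0 \<le> S" using k(2) by (auto simp: S_def intro: sum_nonneg)
  have "(\<Sum>i<N. ennreal (5 ^ s) * ennreal (k i)) = ennreal (5 ^ s * S)"
    using k(2) by (simp add: S_def sum_distrib_left flip: ennreal_mult sum_ennreal)
  with N have S: "A / 2 < 5 ^ s * S" using S0 A(2) by (simp add: ennreal_less_iff)
  define O2 where "O2 = O' - (\<Union>i<N. K i)"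
  have O2: "open O2" "bounded O2" unfolding O2_def using O K
    by (auto intro!: open_Diff closed_UN bounded_subset[OF O(2)])
  have [measurable]: "O2 \<in> sets borel" using O2 by simp
  define A2 where "A2 = enn2real (slice_area n O2 c)"
  have A2: "slice_area n O2 c = ennreal A2" "0 \<le> A2"
    using slice_area_bounded_finite[OF O2(2) n, of c] by (auto simp: A2_def)
  have "ennreal A = emeasure lborel (slice_cylinder n O2 c \<union> (\<Union>i<N. slice_cylinder n (K i) c))"
    unfolding A(1)[symmetric] slice_area_def O2_def slice_cylinder_Union[symmetric]
    using K by (intro arg_cong[where f="emeasure lborel"]) (auto simp: slice_cylinder_def)
  also have "\<dots> = emeasure lborel (slice_cylinder n O2 c) + emeasure lborel (\<Union>i<N. slice_cylinder n (K i) c)"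
    by (rule plus_emeasure[symmetric]) (auto simp: O2_def slice_cylinder_def)
  also have "emeasure lborel (\<Union>i<N. slice_cylinder n (K i) c) = (\<Sum>i<N. emeasure lborel (slice_cylinder n (K i) c))"
    by (rule sum_emeasure[symmetric])
       (auto intro!: disjoint_family_slice_cylinder disjoint_family_on_mono[OF _ dis])
  also have "\<dots> = ennreal S" using k by (simp add: S_def slice_area_def[symmetric])
  finally have AS: "A = A2 + S" using A2 S0 A by (simp add: slice_area_def flip: ennreal_plus)
  have "O' \<inter> {x. x \<bullet> n = c} - (\<Union>i<N. K i) = O2 \<inter> {x. x \<bullet> n = c}" by (auto simp: O2_def)
  then have "hausdorff_premeasure s \<delta> (O' \<inter> {x. x \<bullet> n = c})
      \<le> (\<Sum>i<N. hausdorff_weight s (K i)) + hausdorff_premeasure s \<delta> (O2 \<inter> {x. x \<bullet> n = c})"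
    using hausdorff_premeasure_remove_finite[of K \<delta> s "O' \<inter> {x. x \<bullet> n = c}" N] K by auto
  also have "\<dots> \<le> ennreal S + ennreal \<kappa> * ennreal A2"
    using hyp[OF O2] k by (intro add_mono) (simp_all add: wK S_def A2(1))
  also have "\<dots> = ennreal (S + \<kappa> * A2)" using S0 A2 \<kappa> by (simp add: ennreal_mult)
  also have "\<dots> \<le> ennreal ((\<kappa> - (\<kappa> - 1) / (2 * 5 ^ s)) * A)"
  proof (rule ennreal_leI)
    have "(\<kappa> - 1) * (A / (2 * 5 ^ s)) \<le> (\<kappa> - 1) * S"
      using S \<kappa> by (intro mult_left_mono) (auto simp: field_simps)
    then show "S + \<kappa> * A2 \<le> (\<kappa> - (\<kappa> - 1) / (2 * 5 ^ s)) * A"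
      unfolding AS by (simp add: algebra_simps)
  qed
  also have "\<dots> = ennreal (\<kappa> - (\<kappa> - 1) / (2 * 5 ^ s)) * slice_area n O' c"
  proof -
    have "(\<kappa> - 1) / (2 * 5 ^ s) \<le> (\<kappa> - 1) / 1"
      using \<kappa> one_le_power[of "5::real" s] by (intro divide_left_mono) (auto intro: order_trans[of 1 "5 ^ s"])
    then have "0 \<le> \<kappa> - (\<kappa> - 1) / (2 * 5 ^ s)" by simp
    then show ?thesis unfolding A(1) by (rule ennreal_mult')
  qed
  finally show ?thesis .
qed

theorem hausdorff_premeasure_open_le:
  fixes O' :: "'a::euclidean_space set"
  assumes O: "open O'" "bounded O'" and \<delta>: "0 < \<delta>" and n: "norm n = 1"
  shows "hausdorff_premeasure (DIM('a) - 1) \<delta> (O' \<inter> {x. x \<bullet> n = c}) \<le> slice_area n O' c"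
proof -
  define s where "s = DIM('a) - 1"
  define q where "q = 1 - 1 / (2 * 5 ^ s :: real)"
  have one: "(1::real) \<le> 5 ^ s" by simp
  have q: "0 \<le> q" "q < 1" using one by (auto simp: q_def divide_le_eq intro: order_trans[OF one])
  \<comment> \<open>The iterates of kappa - (kappa - 1) / (2 * 5^s), starting from the crude constant 5^s; they tend to 1.\<close>
  define \<kappa> where "\<kappa> j = 1 + (5 ^ s - 1) * q ^ j" for j
  have \<kappa>: "1 \<le> \<kappa> j" for j using q one by (simp add: \<kappa>_def)
  have step: "hausdorff_premeasure s \<delta> (G \<inter> {x. x \<bullet> n = c}) \<le> ennreal (\<kappa> j) * slice_area n G c"
    if "open G" "bounded G" for G :: "'a set" and j
    using that
  proof (induction j arbitrary: G)
    case 0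
    then show ?case using hausdorff_premeasure_open_crude[OF _ \<delta> n, of G c] by (simp add: \<kappa>_def s_def)
  next
    case (Suc j)
    have "hausdorff_premeasure s \<delta> (G \<inter> {x. x \<bullet> n = c}) \<le> ennreal (\<kappa> j - (\<kappa> j - 1) / (2 * 5 ^ s)) * slice_area n G c"
      unfolding s_def by (rule hausdorff_premeasure_open_improve[OF Suc.prems \<delta> n \<kappa>])
         (use Suc.IH in \<open>simp add: s_def\<close>)
    also have "\<kappa> j - (\<kappa> j - 1) / (2 * 5 ^ s) = \<kappa> (Suc j)"
      by (simp add: \<kappa>_def q_def algebra_simps)
    finally show ?case .
  qed
  have "(\<lambda>j. ennreal (\<kappa> j) * slice_area n O' c) \<longlonglongrightarrow> ennreal (1 + (5 ^ s - 1) * 0) * slice_area n O' c"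
    unfolding \<kappa>_def using q slice_area_bounded_finite[OF O(2) n, of c]
    by (intro tendsto_mult_ennreal tendsto_ennrealI tendsto_intros LIMSEQ_power_zero) auto
  then have "hausdorff_premeasure s \<delta> (O' \<inter> {x. x \<bullet> n = c}) \<le> ennreal (1 + (5 ^ s - 1) * 0) * slice_area n O' c"
    by (rule LIMSEQ_le_const) (use step[OF O] in auto)
  then show ?thesis by (simp add: s_def)
qed

text \<open>
  A compact set is the intersection of its open neighbourhoods of radius \<open>1 / (i + 1)\<close>.
\<close>

theorem hausdorff_measure_compact_slice:
  fixes F :: "'a::euclidean_space set"
  assumes F: "compact F" "F \<subseteq> {x. x \<bullet> n = c}" and n: "norm n = 1"
  shows "hausdorff_measure (DIM('a) - 1) F = slice_area n F c"
proof (rule antisym[OF _ slice_area_le_hausdorff[OF n]])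
  show "hausdorff_measure (DIM('a) - 1) F \<le> slice_area n F c"
    unfolding hausdorff_measure_def
  proof (rule SUP_least)
    fix \<delta> :: real assume "\<delta> \<in> {0<..}"
    then have \<delta>: "0 < \<delta>" by simp
    define G where "G i = (\<Union>x\<in>F. ball x (1 / real (Suc i)))" for i
    have G: "open (G i)" "bounded (G i)" "F \<subseteq> G i" for i
    proof -
      show "open (G i)" by (auto simp: G_def)
      obtain B where B: "\<And>x. x \<in> F \<Longrightarrow> norm x \<le> B" using compact_imp_bounded[OF F(1)] by (auto simp: bounded_iff)
      have "norm y \<le> B + 1" if "y \<in> G i" for y
      proof -
        obtain x where x: "x \<in> F" "dist x y < 1 / real (Suc i)" using \<open>y \<in> G i\<close> by (auto simp: G_def)
        have "1 / real (Suc i) \<le> 1" by simp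
        then have "dist x y \<le> 1" using x(2) by linarith
        then show ?thesis using B[OF x(1)] norm_triangle_sub[of y x] by (simp add: dist_norm norm_minus_commute)
      qed
      then show "bounded (G i)" by (auto simp: bounded_iff)
      show "F \<subseteq> G i" by (force simp: G_def)
    qed
    have [measurable]: "G i \<in> sets borel" for i using G by simp
    have le: "hausdorff_premeasure (DIM('a) - 1) \<delta> F \<le> slice_area n (G i) c" for i
      using F(2) G(3)[of i]
      by (intro order_trans[OF hausdorff_premeasure_mono hausdorff_premeasure_open_le[OF G(1,2) \<delta> n, of i c]]) auto
    have dec: "G (Suc i) \<subseteq> G i" for i
    proof -
      have "1 / real (Suc (Suc i)) \<le> 1 / real (Suc i)" by (simp add: frac_le)
      then show ?thesis unfolding G_def by (intro UN_mono subset_ball) auto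
    qed
    have "(\<lambda>i. slice_area n (G i) c) \<longlonglongrightarrow> emeasure lborel (\<Inter>i. slice_cylinder n (G i) c)"
      unfolding slice_area_def
    proof (rule Lim_emeasure_decseq)
      show "decseq (\<lambda>i. slice_cylinder n (G i) c)"
        using dec by (intro decseq_SucI slice_cylinder_mono)
      show "emeasure lborel (slice_cylinder n (G i) c) \<noteq> \<infinity>" for i
        using slice_area_bounded_finite[OF G(2) n, of i c] by (simp add: slice_area_def)
    qed auto
    also have "(\<Inter>i. slice_cylinder n (G i) c) = slice_cylinder n F c"
    proof -
      have "x \<in> F" if x: "\<And>i. x \<in> G i" for x
      proof -
        have "x \<in> closure F"
        proof (subst closure_approachable, intro allI impI)
          fix e :: real assume "0 < e"
          then obtain i where i: "1 / real (Suc i) < e" using nat_approx_posE by metis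
          obtain y where "y \<in> F" "dist y x < 1 / real (Suc i)" using x[of i] by (auto simp: G_def)
          then show "\<exists>y\<in>F. dist y x < e" using i by (intro bexI[of _ y]) auto
        qed
        then show ?thesis using compact_imp_closed[OF F(1)] by simp
      qed
      then have "(\<Inter>i. G i) = F" using G(3) by blast
      then show ?thesis by (auto simp: slice_cylinder_def)
    qed
    finally have "(\<lambda>i. slice_area n (G i) c) \<longlonglongrightarrow> slice_area n F c" by (simp add: slice_area_def)
    then show "hausdorff_premeasure (DIM('a) - 1) \<delta> F \<le> slice_area n F c"
      by (rule LIMSEQ_le_const) (use le in auto)
  qed
qed

lemma hausdorff_premeasure_null_Union:
  fixes F :: "nat \<Rightarrow> 'a::metric_space set"
  assumes "\<And>i. hausdorff_premeasure s \<delta> (F i) = 0"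
  shows "hausdorff_premeasure s \<delta> (\<Union>i. F i) = 0"
proof -
  have "hausdorff_premeasure s \<delta> (\<Union>i. F i) \<le> ennreal e" if e: "0 < e" for e
  proof -
    have "\<exists>U. F i \<subseteq> (\<Union>j. U j) \<and> (\<forall>j::nat. bounded (U j) \<and> diameter (U j) \<le> \<delta>) \<and>
        (\<Sum>j. hausdorff_weight s (U j)) < ennreal (e * (1/2) ^ Suc i)" for i
    proof -
      have "hausdorff_premeasure s \<delta> (F i) < ennreal (e * (1/2) ^ Suc i)"
        unfolding assms using e by (simp add: ennreal_less_zero_iff)
      then show ?thesis unfolding hausdorff_premeasure_def by (auto simp: INF_less_iff)
    qed
    then obtain U :: "nat \<Rightarrow> nat \<Rightarrow> 'a set" where U: "\<And>i. F i \<subseteq> (\<Union>j. U i j)"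
      "\<And>i j. bounded (U i j) \<and> diameter (U i j) \<le> \<delta>"
      "\<And>i. (\<Sum>j. hausdorff_weight s (U i j)) < ennreal (e * (1/2) ^ Suc i)"
      by metis
    let ?W = "\<lambda>m. case prod_decode m of (i, j) \<Rightarrow> U i j"
    have "(\<Union>i. F i) \<subseteq> (\<Union>m. ?W m)"
    proof
      fix x assume "x \<in> (\<Union>i. F i)"
      then obtain i j where "x \<in> U i j" using U(1) by blast
      then show "x \<in> (\<Union>m. ?W m)" by (intro UN_I[of "prod_encode (i, j)"]) auto
    qed
    then have "hausdorff_premeasure s \<delta> (\<Union>i. F i) \<le> (\<Sum>m. hausdorff_weight s (?W m))"
      by (rule hausdorff_premeasure_le) (use U(2) in \<open>auto split: prod.split\<close>)
    also have "\<dots> = (\<Sum>m. (\<lambda>(i, j). hausdorff_weight s (U i j)) (prod_decode m))"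
      by (simp add: case_prod_beta)
    also have "\<dots> = (\<Sum>i. \<Sum>j. hausdorff_weight s (U i j))"
      by (rule suminf_ennreal_2dimen) simp
    also have "\<dots> \<le> (\<Sum>i. ennreal (e * (1/2) ^ Suc i))"
      by (rule suminf_le) (use U(3) in \<open>auto intro: less_imp_le\<close>)
    also have "\<dots> = ennreal (e * 1)"
      using e by (intro suminf_ennreal_eq sums_mult power_half_series) auto
    finally show ?thesis by simp
  qed
  note le = this
  have "hausdorff_premeasure s \<delta> (\<Union>i. F i) \<le> 0"
  proof (rule ennreal_le_epsilon)
    fix e :: real assume "0 < e"
    then show "hausdorff_premeasure s \<delta> (\<Union>i. F i) \<le> 0 + ennreal e" unfolding add_0 by (rule le)
  qed
  then show ?thesis by simp
qed

lemma hausdorff_measure_null_slice: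
  fixes F :: "'a::euclidean_space set"
  assumes F: "closed F" "F \<subseteq> {x. x \<bullet> n = c}" and n: "norm n = 1" and null: "slice_area n F c = 0"
  shows "hausdorff_measure (DIM('a) - 1) F = 0"
proof -
  have "hausdorff_premeasure (DIM('a) - 1) \<delta> F = 0" if "0 < \<delta>" for \<delta>
  proof -
    have "hausdorff_premeasure (DIM('a) - 1) \<delta> (F \<inter> cball 0 (real k)) = 0" for k
    proof -
      have "hausdorff_premeasure (DIM('a) - 1) \<delta> (F \<inter> cball 0 (real k)) \<le> hausdorff_measure (DIM('a) - 1) (F \<inter> cball 0 (real k))"
        unfolding hausdorff_measure_def using that by (intro SUP_upper) simp
      also have "\<dots> = slice_area n (F \<inter> cball 0 (real k)) c"
        using F n by (intro hausdorff_measure_compact_slice) (auto simp: closed_Int_compact)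
      also have "\<dots> \<le> slice_area n F c"
        unfolding slice_area_def using F(1) by (intro emeasure_mono slice_cylinder_mono) auto
      finally show ?thesis using null by simp
    qed
    then have "hausdorff_premeasure (DIM('a) - 1) \<delta> (\<Union>k. F \<inter> cball 0 (real k)) = 0"
      by (rule hausdorff_premeasure_null_Union)
    moreover have "(\<Union>k. F \<inter> cball 0 (real k)) = F"
      using real_arch_simple by auto
    ultimately show ?thesis by simp
  qed
  then show ?thesis unfolding hausdorff_measure_def by simp
qed

section \<open>Polyhedra with prescribed normals\<close>

definition cell :: "'i set \<Rightarrow> ('i \<Rightarrow> 'a::euclidean_space) \<Rightarrow> ('i \<Rightarrow> real) \<Rightarrow> 'a set" where
  "cell I v c = (\<Inter>i\<in>I. {p. p \<bullet> v i \<le> c i})"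

lemma mem_cell: "p \<in> cell I v c \<longleftrightarrow> (\<forall>i\<in>I. p \<bullet> v i \<le> c i)"
  by (simp add: cell_def)

lemma mem_cell_upd:
  "i \<in> I \<Longrightarrow> p \<in> cell I v (c(i := b)) \<longleftrightarrow> p \<bullet> v i \<le> b \<and> (\<forall>j\<in>I - {i}. p \<bullet> v j \<le> c j)"
  by (auto simp: mem_cell)

lemma closed_cell: "closed (cell I v c)"
  unfolding cell_def by (intro closed_INT ballI closed_Collect_le continuous_intros)

lemma cell_borel [measurable]: "cell I v c \<in> sets borel"
  using closed_cell by (rule borel_closed)

lemma convex_cell: "convex (cell I v c)"
  unfolding cell_def
proof (intro convex_INT)
  fix i
  have "{p. p \<bullet> v i \<le> c i} = {p. v i \<bullet> p \<le> c i}" by (simp add: inner_commute)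
  then show "convex {p. p \<bullet> v i \<le> c i}" by (simp add: convex_halfspace_le)
qed

lemma cell_mono: "(\<And>i. i \<in> I \<Longrightarrow> c i \<le> c' i) \<Longrightarrow> cell I v c \<subseteq> cell I v c'"
  by (force simp: mem_cell)

lemma cell_cong: "(\<And>i. i \<in> I \<Longrightarrow> c i = c' i) \<Longrightarrow> cell I v c = cell I v c'"
  by (auto simp: cell_def)

lemma emeasure_cell_translate:
  "emeasure lborel (cell I v (\<lambda>i. c i + t \<bullet> v i)) = emeasure lborel (cell I v c)"
proof -
  have "{x. - t + x \<in> cell I v c} = cell I v (\<lambda>i. c i + t \<bullet> v i)"
    by (auto simp: mem_cell inner_diff_left algebra_simps)
  then show ?thesis using emeasure_lborel_translate[OF cell_borel, of "-t" I v c] by simp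
qed

lemma emeasure_cell_scale:
  fixes v :: "'i \<Rightarrow> 'a::euclidean_space"
  assumes s: "0 < s"
  shows "emeasure lborel (cell I v (\<lambda>i. s * c i)) = ennreal (s ^ DIM('a)) * emeasure lborel (cell I v c)"
proof -
  have "{x. 0 + s *\<^sub>R x \<in> cell I v (\<lambda>i. s * c i)} = cell I v c"
    using s by (simp add: mem_cell set_eq_iff)
  then show ?thesis
    using emeasure_lborel_affine[OF cell_borel, of s I v "\<lambda>i. s * c i" 0] s by simp
qed

lemma cell_midpoint:
  "x \<in> cell I v c \<Longrightarrow> y \<in> cell I v c' \<Longrightarrow> (1/2) *\<^sub>R (x + y) \<in> cell I v (\<lambda>i. (c i + c' i) / 2)"
  by (auto simp: mem_cell inner_left_distrib intro!: add_mono divide_right_mono)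

lemma emeasure_cell_midpoint:
  "emeasure lborel (cell I v c) * emeasure lborel (cell I v c') \<le> (emeasure lborel (cell I v (\<lambda>i. (c i + c' i) / 2)))\<^sup>2"
  by (intro brunn_minkowski_midpoint cell_borel cell_midpoint)

lemma emeasure_hyperplane:
  fixes a :: "'a::euclidean_space"
  assumes "a \<noteq> 0"
  shows "emeasure lborel {x. x \<bullet> a = b} = 0"
proof -
  have "negligible {x. a \<bullet> x = b}" using assms by (intro negligible_hyperplane) auto
  moreover have "{x. a \<bullet> x = b} = {x. x \<bullet> a = b}" by (simp add: inner_commute)
  ultimately have "{x. x \<bullet> a = b} \<in> null_sets lebesgue" by (simp add: negligible_iff_null_sets)
  then show ?thesis by (auto simp: null_sets_def)
qed

lemma emeasure_pos_avoiding_hyperplanes: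
  fixes a :: "'i \<Rightarrow> 'a::euclidean_space"
  assumes S: "S \<in> sets borel" "0 < emeasure lborel S" and J: "finite J" "\<And>j. j \<in> J \<Longrightarrow> a j \<noteq> 0"
  obtains x where "x \<in> S" "\<forall>j\<in>J. x \<bullet> a j \<noteq> b j"
proof (rule ccontr)
  assume "\<not> thesis"
  then have "S \<subseteq> (\<Union>j\<in>J. {x. x \<bullet> a j = b j})" using that by blast
  then have "emeasure lborel S \<le> emeasure lborel (\<Union>j\<in>J. {x. x \<bullet> a j = b j})"
    by (rule emeasure_mono) (use J in auto)
  also have "\<dots> \<le> (\<Sum>j\<in>J. emeasure lborel {x. x \<bullet> a j = b j})"
    using J by (intro emeasure_subadditive_finite) auto
  also have "\<dots> = 0" using J by (simp add: emeasure_hyperplane)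
  finally show False using S by simp
qed

text \<open>
  A bounded part of \<open>S\<close> of positive volume has infinitely many disjoint translates in direction
  \<open>q\<close> inside \<open>S\<close>.
\<close>

lemma emeasure_recession_infinite:
  fixes S :: "'a::euclidean_space set"
  assumes [measurable]: "S \<in> sets borel" and pos: "0 < emeasure lborel S" and q: "q \<noteq> 0"
    and rec: "\<And>x t. x \<in> S \<Longrightarrow> 0 \<le> t \<Longrightarrow> x + t *\<^sub>R q \<in> S"
  shows "emeasure lborel S = \<infinity>"
proof -
  have "(\<lambda>k. emeasure lborel (S \<inter> cball 0 (real k))) \<longlonglongrightarrow> emeasure lborel (\<Union>k. S \<inter> cball 0 (real k))"
    by (intro Lim_emeasure_incseq) (auto simp: incseq_def)
  moreover have "(\<Union>k. S \<inter> cball 0 (real k)) = S" using real_arch_simple by auto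
  ultimately have "\<forall>\<^sub>F k in sequentially. 0 < emeasure lborel (S \<inter> cball 0 (real k))"
    using pos by (auto intro: order_tendstoD)
  then obtain R where R: "0 < emeasure lborel (S \<inter> cball 0 (real R))" by (auto simp: eventually_sequentially)
  define T where "T = S \<inter> cball 0 (real R)"
  have [measurable]: "T \<in> sets borel" by (simp add: T_def)
  \<comment> \<open>Translates of a subset of the ball of radius R by more than 2 R are disjoint.\<close>
  define m where "m = (2 * real R + 1) / norm q"
  have m: "0 < m" "m * norm q = 2 * real R + 1" using q by (auto simp: m_def intro!: divide_pos_pos)
  define U where "U k = {x. - ((real k * m) *\<^sub>R q) + x \<in> T}" for k
  have [measurable]: "U k \<in> sets borel" for k unfolding U_def by measurable
  have U: "emeasure lborel (U k) = emeasure lborel T" for k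
    unfolding U_def by (rule emeasure_lborel_translate) simp
  have sub: "(\<Union>k. U k) \<subseteq> S"
  proof
    fix x assume "x \<in> (\<Union>k. U k)"
    then obtain k where k: "- ((real k * m) *\<^sub>R q) + x \<in> T" by (auto simp: U_def)
    then have "(- ((real k * m) *\<^sub>R q) + x) + (real k * m) *\<^sub>R q \<in> S"
      using m by (intro rec) (auto simp: T_def)
    then show "x \<in> S" by simp
  qed
  have dis: "disjoint_family U"
    unfolding disjoint_family_on_def
  proof (intro ballI impI)
    fix j k :: nat assume jk: "j \<noteq> k"
    show "U j \<inter> U k = {}"
    proof (rule ccontr)
      assume "U j \<inter> U k \<noteq> {}"
      then obtain x where x: "norm (- ((real j * m) *\<^sub>R q) + x) \<le> real R" "norm (- ((real k * m) *\<^sub>R q) + x) \<le> real R"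
        by (auto simp: U_def T_def)
      have "norm ((- ((real j * m) *\<^sub>R q) + x) - (- ((real k * m) *\<^sub>R q) + x)) \<le> 2 * real R"
        using norm_triangle_ineq4[of "- ((real j * m) *\<^sub>R q) + x" "- ((real k * m) *\<^sub>R q) + x"] x by linarith
      also have "(- ((real j * m) *\<^sub>R q) + x) - (- ((real k * m) *\<^sub>R q) + x) = ((real k - real j) * m) *\<^sub>R q"
        by (simp add: algebra_simps)
      also have "norm \<dots> = \<bar>real k - real j\<bar> * (m * norm q)" using m by (simp add: abs_mult)
      also have "\<dots> = \<bar>real k - real j\<bar> * (2 * real R + 1)" by (simp only: m(2))
      finally have le: "\<bar>real k - real j\<bar> * (2 * real R + 1) \<le> 2 * real R" .
      have "1 \<le> \<bar>real k - real j\<bar>" using jk by linarith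
      then have "1 * (2 * real R + 1) \<le> \<bar>real k - real j\<bar> * (2 * real R + 1)" by (intro mult_right_mono) auto
      from order_trans[OF this le] show False by simp
    qed
  qed
  have "(\<Sum>k. emeasure lborel (U k)) \<le> emeasure lborel S"
    using sub dis by (subst suminf_emeasure) (auto intro!: emeasure_mono)
  moreover have "(\<Sum>k. emeasure lborel (U k)) = \<infinity>"
  proof -
    have "(\<Sum>k::nat. emeasure lborel T) = emeasure lborel T * \<infinity>"
      by (simp flip: nn_integral_count_space_nat)
    then show ?thesis using R unfolding U by (simp add: T_def ennreal_mult_top)
  qed
  ultimately show ?thesis by (simp add: top_unique)
qed

text \<open>
  For finite \<open>I\<close> this says that the cells are bounded, see \<open>compact_cell\<close>.
\<close>

definition no_recession :: "'i set \<Rightarrow> ('i \<Rightarrow> 'a::euclidean_space) \<Rightarrow> bool" where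
  "no_recession I v \<longleftrightarrow> (\<forall>q. (\<forall>i\<in>I. q \<bullet> v i \<le> 0) \<longrightarrow> q = 0)"

lemma no_recession_of_finite_volume:
  assumes "0 < emeasure lborel (cell I v c)" "emeasure lborel (cell I v c) < \<infinity>"
  shows "no_recession I v"
  unfolding no_recession_def
proof (intro allI impI, rule ccontr)
  fix q assume q: "\<forall>i\<in>I. q \<bullet> v i \<le> 0" "q \<noteq> 0"
  have "x + t *\<^sub>R q \<in> cell I v c" if "x \<in> cell I v c" "0 \<le> t" for x t
  proof -
    have "x \<bullet> v i + t * (q \<bullet> v i) \<le> c i" if "i \<in> I" for i
      using \<open>x \<in> cell I v c\<close> mult_nonneg_nonpos[OF \<open>0 \<le> t\<close>, of "q \<bullet> v i"] q(1) that by (force simp: mem_cell)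
    then show ?thesis by (simp add: mem_cell inner_left_distrib)
  qed
  then have "emeasure lborel (cell I v c) = \<infinity>"
    by (intro emeasure_recession_infinite[OF cell_borel assms(1) q(2)])
  with assms(2) show False by simp
qed

text \<open>
  The function \<open>q \<mapsto> (\<Sum>i\<in>I. max 0 (q \<bullet> v i))\<close> is bounded on the cell, positively homogeneous,
  and positive on the unit sphere.
\<close>

lemma compact_cell:
  fixes v :: "'i \<Rightarrow> 'a::euclidean_space"
  assumes I: "finite I" and rec: "no_recession I v"
  shows "compact (cell I v c)"
proof -
  let ?f = "\<lambda>q. \<Sum>i\<in>I. max 0 (q \<bullet> v i)"
  obtain e where e: "e \<in> sphere 0 1" "\<And>q. q \<in> sphere 0 1 \<Longrightarrow> ?f e \<le> ?f q"
  proof -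
    obtain b :: 'a where b: "b \<in> Basis" using nonempty_Basis by blast
    then have "sphere (0::'a) 1 \<noteq> {}" by (auto intro!: exI[of _ b])
    moreover have "continuous_on (sphere 0 1) ?f" by (intro continuous_intros)
    ultimately show ?thesis using continuous_attains_inf[of "sphere (0::'a) 1" ?f] that by auto
  qed
  have pos: "0 < ?f e"
  proof (rule ccontr)
    assume "\<not> 0 < ?f e"
    then have "?f e = 0" using sum_nonneg[of I "\<lambda>i. max 0 (e \<bullet> v i)"] by simp
    then have "\<forall>i\<in>I. e \<bullet> v i \<le> 0" using I by (subst (asm) sum_nonneg_eq_0_iff) (auto simp: max_def split: if_splits)
    then have "e = 0" using rec by (simp add: no_recession_def)
    then show False using e by simp
  qed
  have "norm p \<le> (\<Sum>i\<in>I. \<bar>c i\<bar>) / ?f e" if p: "p \<in> cell I v c" for p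
  proof (cases "p = 0")
    case True then show ?thesis using pos by (simp add: sum_nonneg)
  next
    case False
    have "?f e \<le> ?f (p /\<^sub>R norm p)" using False by (intro e) simp
    also have "\<dots> = ?f p / norm p"
    proof -
      have "max 0 ((p /\<^sub>R norm p) \<bullet> v i) = max 0 (p \<bullet> v i) / norm p" for i
        using False by (auto simp: max_def divide_inverse mult.commute zero_le_mult_iff mult_le_0_iff)
      then show ?thesis by (simp add: sum_divide_distrib)
    qed
    finally have "?f e * norm p \<le> ?f p" using False by (simp add: field_simps)
    also have "\<dots> \<le> (\<Sum>i\<in>I. \<bar>c i\<bar>)" using p by (intro sum_mono) (force simp: mem_cell)
    finally show ?thesis using pos by (simp add: field_simps)
  qed
  then have "bounded (cell I v c)" by (auto simp: bounded_iff)
  then show ?thesis using closed_cell by (simp add: compact_eq_bounded_closed)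
qed

lemma emeasure_cell_strict_point:
  fixes v :: "'i \<Rightarrow> 'a::euclidean_space"
  assumes I: "finite I" and p: "\<And>i. i \<in> I \<Longrightarrow> p \<bullet> v i < c i"
  shows "0 < emeasure lborel (cell I v c)"
proof -
  define U where "U = (\<Inter>i\<in>I. {p. p \<bullet> v i < c i})"
  have "open U" unfolding U_def using I by (intro open_INT ballI open_Collect_less continuous_intros)
  moreover have "p \<in> U" using p by (simp add: U_def)
  ultimately obtain e where e: "0 < e" "ball p e \<subseteq> U" using open_contains_ball by metis
  have "U \<subseteq> cell I v c"
  proof
    fix x assume "x \<in> U"
    then have "x \<bullet> v i \<le> c i" if "i \<in> I" for i using that by (simp add: U_def less_imp_le)
    then show "x \<in> cell I v c" by (simp add: mem_cell)
  qed
  then have "emeasure lborel (ball p e) \<le> emeasure lborel (cell I v c)"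
    using e(2) by (intro emeasure_mono) simp_all
  moreover have "0 < emeasure lborel (ball p e)"
    using e(1) by (simp add: emeasure_ball)
  ultimately show ?thesis by (rule less_le_trans[rotated])
qed

lemma cell_strict_point:
  assumes I: "finite I" and v: "\<And>i. i \<in> I \<Longrightarrow> v i \<noteq> 0" and pos: "0 < emeasure lborel (cell I v c)"
  obtains p where "\<forall>i\<in>I. p \<bullet> v i < c i"
proof -
  obtain p where "p \<in> cell I v c" "\<forall>i\<in>I. p \<bullet> v i \<noteq> c i"
    by (rule emeasure_pos_avoiding_hyperplanes[OF cell_borel pos I v, where b=c])
  then show ?thesis by (intro that[of p]) (force simp: mem_cell)
qed

section \<open>The extremal constant\<close>

lemma polyhedron_const_ge:
  fixes v :: "'i \<Rightarrow> 'a::euclidean_space"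
  assumes s: "(\<Sum>i\<in>I. c i) = s" "0 < s"
  shows "emeasure lborel (cell I v c) \<le> polyhedron_const I v * ennreal (s ^ DIM('a))"
proof -
  let ?c = "\<lambda>i. c i / s"
  have "emeasure lborel (cell I v ?c) \<le> polyhedron_const I v"
    unfolding polyhedron_const_def cell_def using s by (intro SUP_upper) (simp flip: sum_divide_distrib)
  moreover have "emeasure lborel (cell I v c) = ennreal (s ^ DIM('a)) * emeasure lborel (cell I v ?c)"
    using s emeasure_cell_scale[OF s(2), of I v ?c] by simp
  ultimately show ?thesis by (metis mult.commute mult_right_mono zero_le)
qed

lemma polyhedron_const_least:
  assumes "\<And>c. (\<Sum>i\<in>I. c i) = 1 \<Longrightarrow> emeasure lborel (cell I v c) \<le> K"
  shows "polyhedron_const I v \<le> K"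
  unfolding polyhedron_const_def cell_def[symmetric] by (rule SUP_least) (use assms in auto)

lemma polyhedron_const_pos:
  assumes I: "finite I" "I \<noteq> {}"
  shows "0 < polyhedron_const I v"
proof -
  let ?c = "\<lambda>i. 1 / real (card I)"
  have "0 < emeasure lborel (cell I v ?c)" using I by (intro emeasure_cell_strict_point[of _ 0]) (auto simp: card_gt_0_iff)
  also have "\<dots> \<le> polyhedron_const I v * ennreal (1 ^ DIM('b))"
    using I by (intro polyhedron_const_ge) auto
  finally show ?thesis by simp
qed

text \<open>
  A translation of a cell by a multiple of \<open>w = (\<Sum>i\<in>I. v i)\<close> changes the sum of the heights and not the
  volume. If \<open>w \<noteq> 0\<close>, cells of arbitrarily large volume can thus be given heights with sum one.
\<close>

lemma polyhedron_const_finite_imp: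
  fixes v :: "'i \<Rightarrow> 'a::euclidean_space"
  assumes I: "finite I" "I \<noteq> {}" and fin: "polyhedron_const I v < \<infinity>"
  shows "no_recession I v" and "(\<Sum>i\<in>I. v i) = 0"
proof -
  let ?c = "\<lambda>i. 1 / real (card I)"
  have sum1: "(\<Sum>i\<in>I. ?c i) = 1" using I by simp
  have pos: "0 < emeasure lborel (cell I v ?c)" using I by (intro emeasure_cell_strict_point[of _ 0]) (auto simp: card_gt_0_iff)
  have "emeasure lborel (cell I v ?c) \<le> polyhedron_const I v"
    using polyhedron_const_ge[OF sum1, where v=v] by simp
  then have fin1: "emeasure lborel (cell I v ?c) < \<infinity>" using fin by simp
  show "no_recession I v" by (rule no_recession_of_finite_volume[OF pos fin1])
  show "(\<Sum>i\<in>I. v i) = 0"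
  proof (rule ccontr)
    define w where "w = (\<Sum>i\<in>I. v i)"
    assume "(\<Sum>i\<in>I. v i) \<noteq> 0"
    then have w: "w \<noteq> 0" by (simp add: w_def)
    have le: "ennreal (l ^ DIM('a)) * emeasure lborel (cell I v ?c) \<le> polyhedron_const I v" if l: "0 < l" for l
    proof -
      \<comment> \<open>This translation brings the sum of the heights from l back to 1.\<close>
      define t where "t = ((1 - l) / (w \<bullet> w)) *\<^sub>R w"
      have "(\<Sum>i\<in>I. l * ?c i + t \<bullet> v i) = l * (\<Sum>i\<in>I. ?c i) + t \<bullet> w"
        by (simp add: sum.distrib sum_distrib_left w_def inner_sum_right)
      also have "\<dots> = 1" unfolding sum1 using w by (simp add: t_def)
      finally have "emeasure lborel (cell I v (\<lambda>i. l * ?c i + t \<bullet> v i)) \<le> polyhedron_const I v"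
        using polyhedron_const_ge[where I=I and c="\<lambda>i. l * ?c i + t \<bullet> v i" and s=1 and v=v] by simp
      then show ?thesis unfolding emeasure_cell_translate emeasure_cell_scale[OF l] .
    qed
    obtain a where a: "emeasure lborel (cell I v ?c) = ennreal a" "0 < a"
      using pos fin1 by (cases "emeasure lborel (cell I v ?c)") auto
    obtain K where K: "polyhedron_const I v = ennreal K" "0 \<le> K" using fin by (cases "polyhedron_const I v") auto
    \<comment> \<open>So large that the volume l * a, and with it l^d * a, exceeds the constant K.\<close>
    define l where "l = max 1 ((K + 1) / a)"
    have l: "1 \<le> l" "K + 1 \<le> l * a" using a by (auto simp: l_def max_def field_simps)
    have "l * a \<le> l ^ DIM('a) * a" using l a self_le_power[of l "DIM('a)"] by (intro mult_right_mono) auto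
    moreover have "l ^ DIM('a) * a \<le> K"
      using le[of l] l a K unfolding a(1) K(1) by (simp flip: ennreal_mult)
    ultimately show False using l by linarith
  qed
qed

lemma no_recession_of_span:
  fixes v :: "'i \<Rightarrow> 'a::euclidean_space"
  assumes I: "finite I" and sp: "span (v ` I) = UNIV" and sum0: "(\<Sum>i\<in>I. v i) = 0"
  shows "no_recession I v"
  unfolding no_recession_def
proof (intro allI impI)
  fix q assume q: "\<forall>i\<in>I. q \<bullet> v i \<le> 0"
  have "(\<Sum>i\<in>I. - (q \<bullet> v i)) = 0" using sum0 by (simp add: sum_negf flip: inner_sum_right)
  then have "\<forall>i\<in>I. q \<bullet> v i = 0" using q I by (subst (asm) sum_nonneg_eq_0_iff) auto
  then have "orthogonal q x" if "x \<in> v ` I" for x using that by (auto simp: orthogonal_def)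
  then have "orthogonal q q" using sp by (intro orthogonal_to_span[of q "v ` I"]) auto
  then show "q = 0" by (simp add: orthogonal_self)
qed

lemma span_of_no_recession:
  fixes v :: "'i \<Rightarrow> 'a::euclidean_space"
  assumes "no_recession I v"
  shows "span (v ` I) = UNIV"
proof (rule ccontr)
  assume "span (v ` I) \<noteq> UNIV"
  then obtain q where "q \<noteq> 0" "\<forall>x\<in>span (v ` I). q \<bullet> x = 0" using span_not_UNIV_orthogonal by blast
  then show False using assms by (auto simp: no_recession_def span_base)
qed

lemma finite_index_subsequence:
  fixes c :: "nat \<Rightarrow> 'i \<Rightarrow> real"
  assumes "finite I" "\<And>k i. i \<in> I \<Longrightarrow> 0 \<le> c k i \<and> c k i \<le> 1"
  shows "\<exists>r l. strict_mono (r :: nat \<Rightarrow> nat) \<and> (\<forall>i\<in>I. (\<lambda>k. c (r k) i) \<longlonglongrightarrow> l i)"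
  using assms
proof (induction I)
  case empty
  then show ?case using strict_mono_id by auto
next
  case (insert j I)
  then obtain r l where r: "strict_mono r" "\<forall>i\<in>I. (\<lambda>k. c (r k) i) \<longlonglongrightarrow> l i" by auto
  have "bounded (range (\<lambda>k. c (r k) j))" using insert.prems by (intro boundedI[of _ 1]) auto
  then obtain l' r' where r': "strict_mono r'" "((\<lambda>k. c (r k) j) \<circ> r') \<longlonglongrightarrow> l'"
    using bounded_imp_convergent_subsequence by metis
  have "(\<lambda>k. c ((r \<circ> r') k) i) \<longlonglongrightarrow> (l(j := l')) i" if "i \<in> insert j I" for i
  proof (cases "i = j")
    case True then show ?thesis using r'(2) by (simp add: o_def)
  next
    case False
    then have "(\<lambda>k. c (r k) i) \<longlonglongrightarrow> l i" using r(2) that by auto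
    from LIMSEQ_subseq_LIMSEQ[OF this r'(1)] show ?thesis using False by (simp add: o_def)
  qed
  moreover have "strict_mono (r \<circ> r')" by (rule strict_mono_o[OF r(1) r'(1)])
  ultimately show ?case by blast
qed

text \<open>
  After a translation the heights are nonnegative, so a maximizing sequence of heights has a convergent
  subsequence. The volume is upper semicontinuous in the heights, because a cell is the intersection
  of the cells with heights increased by \<open>1 / (j + 1)\<close>.
\<close>

theorem polyhedron_const_attained:
  fixes v :: "'i \<Rightarrow> 'a::euclidean_space"
  assumes I: "finite I" "I \<noteq> {}" and rec: "no_recession I v" and sum0: "(\<Sum>i\<in>I. v i) = 0"
  obtains c where "(\<Sum>i\<in>I. c i) = 1" "emeasure lborel (cell I v c) = polyhedron_const I v"
    "polyhedron_const I v < \<infinity>"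
proof -
  let ?C = "polyhedron_const I v"
  let ?vol = "\<lambda>c. emeasure lborel (cell I v c)"
  have norm_c: "\<exists>c'. (\<Sum>i\<in>I. c' i) = 1 \<and> (\<forall>i\<in>I. 0 \<le> c' i \<and> c' i \<le> 1) \<and> ?vol c \<le> ?vol c'"
    if c: "(\<Sum>i\<in>I. c i) = 1" for c
  proof -
    have "\<exists>c'. (\<Sum>i\<in>I. c' i) = 1 \<and> (\<forall>i\<in>I. 0 \<le> c' i) \<and> ?vol c \<le> ?vol c'"
    proof (cases "cell I v c = {}")
      case True
      then show ?thesis using I by (intro exI[of _ "\<lambda>i. 1 / real (card I)"]) auto
    next
      case False
      then obtain p where p: "p \<in> cell I v c" by auto
      have "(\<Sum>i\<in>I. c i + (- p) \<bullet> v i) = 1"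
        using c sum0 by (simp add: sum_subtractf flip: inner_sum_right)
      moreover have "\<forall>i\<in>I. 0 \<le> c i + (- p) \<bullet> v i" using p by (simp add: mem_cell)
      ultimately show ?thesis
        using emeasure_cell_translate[of I v c "-p"] by (intro exI[of _ "\<lambda>i. c i + (- p) \<bullet> v i"]) (simp only: order_refl simp_thms)
    qed
    then obtain c' where c': "(\<Sum>i\<in>I. c' i) = 1" "\<forall>i\<in>I. 0 \<le> c' i" "?vol c \<le> ?vol c'" by blast
    have "c' i \<le> 1" if "i \<in> I" for i
      using member_le_sum[of i I c'] that c' I by auto
    then show ?thesis using c' by blast
  qed
  have "\<exists>f::nat \<Rightarrow> ennreal. incseq f \<and> range f \<subseteq> ?vol ` {c. (\<Sum>i\<in>I. c i) = 1} \<and> ?C = (SUP i. f i)"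
    unfolding polyhedron_const_def cell_def
  proof (rule ennreal_Sup_countable_SUP)
    have "(\<lambda>i. 1 / real (card I)) \<in> {c. (\<Sum>i\<in>I. c i) = 1}" using I by simp
    then show "(\<lambda>c. emeasure lborel (\<Inter>i\<in>I. {p. p \<bullet> v i \<le> c i})) ` {c. (\<Sum>i\<in>I. c i) = 1} \<noteq> {}" by blast
  qed
  then obtain f where f: "incseq f" "range f \<subseteq> ?vol ` {c. (\<Sum>i\<in>I. c i) = 1}" "?C = (SUP i. f i)" by blast
  have "\<exists>c'. (\<Sum>i\<in>I. c' i) = 1 \<and> (\<forall>i\<in>I. 0 \<le> c' i \<and> c' i \<le> 1) \<and> f k \<le> ?vol c'" for k
  proof -
    obtain c where "f k = ?vol c" "(\<Sum>i\<in>I. c i) = 1" using f(2) by blast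
    then show ?thesis using norm_c by metis
  qed
  then obtain c where c: "\<And>k. (\<Sum>i\<in>I. c k i) = 1" "\<And>k i. i \<in> I \<Longrightarrow> 0 \<le> c k i \<and> c k i \<le> 1" "\<And>k. f k \<le> ?vol (c k)"
    by metis
  obtain r l where r: "strict_mono (r :: nat \<Rightarrow> nat)" "\<forall>i\<in>I. (\<lambda>k. c (r k) i) \<longlonglongrightarrow> l i"
    using finite_index_subsequence[OF I(1), of c] c(2) by blast
  have "(\<lambda>k. \<Sum>i\<in>I. c (r k) i) \<longlonglongrightarrow> (\<Sum>i\<in>I. l i)" using r(2) by (intro tendsto_sum) auto
  then have l: "(\<Sum>i\<in>I. l i) = 1" unfolding c(1) by (simp add: LIMSEQ_const_iff)
  have frlim: "(\<lambda>k. f (r k)) \<longlonglongrightarrow> ?C"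
    using LIMSEQ_subseq_LIMSEQ[OF LIMSEQ_SUP[OF f(1)] r(1)] by (simp add: f(3) o_def)
  have le: "?C \<le> ?vol (\<lambda>i. l i + e)" if e: "0 < e" for e
  proof -
    have "\<forall>\<^sub>F k in sequentially. \<forall>i\<in>I. c (r k) i < l i + e"
      using I r(2) e by (intro eventually_ball_finite ballI order_tendstoD(2)) auto
    then have "\<forall>\<^sub>F k in sequentially. f (r k) \<le> ?vol (\<lambda>i. l i + e)"
    proof eventually_elim
      case (elim k)
      have "f (r k) \<le> ?vol (c (r k))" by (rule c)
      also have "\<dots> \<le> ?vol (\<lambda>i. l i + e)" using elim by (intro emeasure_mono cell_mono) (auto intro: less_imp_le)
      finally show ?case .
    qed
    then show ?thesis by (rule tendsto_upperbound[OF frlim]) simp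
  qed
  let ?Z = "\<lambda>j. cell I v (\<lambda>i. l i + 1 / real (Suc j))"
  have fin: "?vol c < \<infinity>" for c using emeasure_compact_finite[OF compact_cell[OF I(1) rec]] by auto
  have "(\<lambda>j. emeasure lborel (?Z j)) \<longlonglongrightarrow> emeasure lborel (\<Inter>j. ?Z j)"
  proof (rule Lim_emeasure_decseq)
    show "decseq ?Z" by (intro decseq_SucI cell_mono) (simp add: frac_le)
    show "emeasure lborel (?Z j) \<noteq> \<infinity>" for j using fin[of "\<lambda>i. l i + 1 / real (Suc j)"] by simp
  qed auto
  then have "?C \<le> emeasure lborel (\<Inter>j. ?Z j)"
    by (rule LIMSEQ_le_const) (use le in auto)
  also have "(\<Inter>j. ?Z j) \<subseteq> cell I v l"
  proof
    fix p assume p: "p \<in> (\<Inter>j. ?Z j)"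
    have "p \<bullet> v i \<le> l i" if "i \<in> I" for i
    proof (rule LIMSEQ_le_const)
      show "(\<lambda>j. l i + 1 / real (Suc j)) \<longlonglongrightarrow> l i"
        using tendsto_add[OF tendsto_const LIMSEQ_inverse_real_of_nat, of "l i"] by (simp add: inverse_eq_divide)
      show "\<exists>N. \<forall>j\<ge>N. p \<bullet> v i \<le> l i + 1 / real (Suc j)" using p that by (auto simp: mem_cell)
    qed
    then show "p \<in> cell I v l" by (simp add: mem_cell)
  qed
  then have "emeasure lborel (\<Inter>j. ?Z j) \<le> ?vol l" by (rule emeasure_mono) simp
  finally have "?C \<le> ?vol l" .
  moreover have "?vol l \<le> ?C" using polyhedron_const_ge[OF l, where v=v] by simp
  ultimately show ?thesis using l fin[of l] by (intro that[of l]) auto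
qed

section \<open>Facets of a polyhedron and derivatives of its volume\<close>

lemma inner_sgn:
  fixes w :: "'a::euclidean_space"
  shows "w \<noteq> 0 \<Longrightarrow> p \<bullet> w = norm w * (p \<bullet> sgn w)"
  by (simp add: sgn_div_norm)

text \<open>
  Changing the height \<open>c i\<close> moves a hyperplane through the larger cell with height \<open>c i + 1\<close>. The points
  \<open>p\<close> and \<open>q\<close> keep its level away from the extreme ones; \<open>q\<close> witnesses that the \<open>i\<close>-th
  inequality does not follow from the others.
\<close>

lemma facet_derivative:
  fixes v :: "'i \<Rightarrow> 'a::euclidean_space"
  assumes I: "finite I" and rec: "no_recession I v" and i: "i \<in> I" "v i \<noteq> 0"
    and p: "p \<in> cell I v c" "p \<bullet> v i < c i"
    and q: "q \<in> cell I v (c(i := c i + 1))" "c i < q \<bullet> v i"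
  shows "((\<lambda>t. measure lborel (cell I v (c(i := c i + t)))) has_real_derivative
      enn2real (slice_area (sgn (v i)) (cell I v c) (c i / norm (v i))) / norm (v i)) (at 0)"
proof -
  define K where "K = cell I v (c(i := c i + 1))"
  define n where "n = sgn (v i)"
  define L where "L = norm (v i)"
  have L: "0 < L" using i by (simp add: L_def)
  have n: "norm n = 1" using i by (simp add: n_def norm_sgn)
  have vn: "x \<bullet> v i = L * (x \<bullet> n)" for x using inner_sgn[OF i(2)] by (simp add: L_def n_def)
  have K: "compact K" "convex K" unfolding K_def by (rule compact_cell[OF I rec] convex_cell)+
  have "cell I v c \<subseteq> K" unfolding K_def by (intro cell_mono) simp
  then have pK: "p \<in> K" "p \<bullet> n < c i / L" using p L by (auto simp: vn field_simps)
  have qK: "q \<in> K" "c i / L < q \<bullet> n" using q L by (auto simp: K_def vn field_simps)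
  have slice: "slice_area n K (c i / L) = slice_area n (cell I v c) (c i / L)"
  proof -
    have "x \<in> K \<longleftrightarrow> x \<in> cell I v c" if "x \<bullet> n = c i / L" for x
    proof -
      have "x \<bullet> v i = c i" using that L by (simp add: vn)
      then show ?thesis using i by (auto simp: K_def mem_cell)
    qed
    then have "slice_cylinder n K (c i / L) = slice_cylinder n (cell I v c) (c i / L)"
      unfolding slice_cylinder_def by (auto simp: inner_along[OF n])
    then show ?thesis by (simp add: slice_area_def)
  qed
  have D: "((\<lambda>t. volume_below n K ((c i + t) / L)) has_real_derivative
      enn2real (slice_area n (cell I v c) (c i / L)) * (1 / L)) (at 0)"
  proof (rule DERIV_chain2[where f="volume_below n K" and g="\<lambda>t. (c i + t) / L"])
    show "(volume_below n K has_real_derivative enn2real (slice_area n (cell I v c) (c i / L))) (at ((c i + 0) / L))"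
      using volume_below_has_derivative[OF K n pK qK] by (simp add: slice)
    show "((\<lambda>t. (c i + t) / L) has_real_derivative 1 / L) (at 0)"
      using L by (auto intro!: derivative_eq_intros)
  qed
  have eq: "volume_below n K ((c i + t) / L) = measure lborel (cell I v (c(i := c i + t)))" if "t \<in> {..<1}" for t
  proof -
    have "K \<inter> {x. x \<bullet> n \<le> (c i + t) / L} = cell I v (c(i := c i + t))"
    proof -
      have iff: "x \<bullet> n \<le> (c i + t) / L \<longleftrightarrow> x \<bullet> v i \<le> c i + t" for x using L by (simp add: vn field_simps)
      have "x \<in> K \<inter> {x. x \<bullet> n \<le> (c i + t) / L} \<longleftrightarrow> x \<in> cell I v (c(i := c i + t))" for x
        unfolding K_def Int_iff mem_Collect_eq mem_cell_upd[OF i(1)] iff using that by auto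
      then show ?thesis by blast
    qed
    then show ?thesis by (simp add: volume_below_def)
  qed
  have "((\<lambda>t. measure lborel (cell I v (c(i := c i + t)))) has_real_derivative
      enn2real (slice_area n (cell I v c) (c i / L)) * (1 / L)) (at 0)"
    by (rule has_field_derivative_transform_within_open[OF D open_lessThan[of 1] _ eq]) simp_all
  then show ?thesis by (simp add: n_def L_def)
qed

text \<open>
  No other \<open>v j\<close> has the direction of \<open>v i\<close>, and where \<open>v j\<close> has the opposite direction its inequality
  is strict on the face because of \<open>p0\<close>. So the other bounding hyperplanes meet the face in null sets, and
  the face has a point at which all other inequalities are strict. From there a small
  step along the normal leads beyond \<open>m\<close>; this leaves the cell, so it violates the \<open>i\<close>-th inequality.
\<close>

lemma facet_of_positive_area:
  fixes v :: "'i \<Rightarrow> 'a::euclidean_space"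
  assumes I: "finite I" and v: "\<And>i. i \<in> I \<Longrightarrow> v i \<noteq> 0" and inj: "inj_on (\<lambda>i. sgn (v i)) I" and i: "i \<in> I"
    and p0: "\<And>j. j \<in> I \<Longrightarrow> p0 \<bullet> v j < c j"
    and m: "\<And>p. p \<in> cell I v c \<Longrightarrow> p \<bullet> sgn (v i) \<le> m"
    and area: "0 < slice_area (sgn (v i)) (cell I v c) m"
  shows "m = c i / norm (v i)" and "\<exists>q\<in>cell I v (c(i := c i + 1)). c i < q \<bullet> v i"
proof -
  define n where "n = sgn (v i)"
  define L where "L = norm (v i)"
  have L: "0 < L" using v i by (simp add: L_def)
  have n: "norm n = 1" using v i by (simp add: n_def norm_sgn)
  have vn: "x \<bullet> v i = L * (x \<bullet> n)" for x using inner_sgn[OF v[OF i]] by (simp add: L_def n_def)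
  have p0m: "p0 \<bullet> n \<le> m" using m[of p0] p0 by (simp add: n_def mem_cell less_imp_le)
  \<comment> \<open>The part of v j orthogonal to n decides how the hyperplane of v j meets the face.\<close>
  define a where "a j = v j - (v j \<bullet> n) *\<^sub>R n" for j
  define J where "J = {j \<in> I - {i}. a j \<noteq> 0}"
  have expand: "(y + (m - y \<bullet> n) *\<^sub>R n) \<bullet> v j = y \<bullet> a j + m * (v j \<bullet> n)" for y j
    by (simp add: a_def inner_left_distrib inner_diff_right algebra_simps inner_commute)
  obtain y where y: "y \<in> slice_cylinder n (cell I v c) m" "\<forall>j\<in>J. y \<bullet> a j \<noteq> c j - m * (v j \<bullet> n)"
    by (rule emeasure_pos_avoiding_hyperplanes[of "slice_cylinder n (cell I v c) m" J a "\<lambda>j. c j - m * (v j \<bullet> n)"])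
       (use area I in \<open>auto simp: slice_area_def n_def J_def\<close>)
  define p where "p = y + (m - y \<bullet> n) *\<^sub>R n"
  have p: "p \<in> cell I v c" using y by (simp add: slice_cylinder_def p_def)
  have pn: "p \<bullet> n = m" by (simp add: p_def inner_along[OF n])
  have strict: "p \<bullet> v j < c j" if j: "j \<in> I" "j \<noteq> i" for j
  proof (cases "a j = 0")
    case False
    then have "p \<bullet> v j \<noteq> c j" using y(2) j by (auto simp: p_def expand J_def)
    then show ?thesis using p j by (force simp: mem_cell)
  next
    case True
    define b where "b = v j \<bullet> n"
    have vj: "v j = b *\<^sub>R n" using True by (simp add: a_def b_def)
    have "b \<noteq> 0" using vj v[OF j(1)] by auto
    have "\<not> 0 < b"
    proof
      assume "0 < b"
      then have "sgn (v j) = sgn n" by (simp add: vj sgn_scaleR)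
      then have "sgn (v j) = sgn (v i)" using n by (simp add: n_def[symmetric] sgn_div_norm[of n])
      then show False using inj j i by (auto dest: inj_onD)
    qed
    then have b: "b < 0" using \<open>b \<noteq> 0\<close> by simp
    have "p \<bullet> v j = b * m" by (simp add: vj pn)
    also have "\<dots> \<le> b * (p0 \<bullet> n)" using p0m b by (simp add: mult_left_mono_neg)
    also have "\<dots> = p0 \<bullet> v j" by (simp add: vj)
    also have "\<dots> < c j" by (rule p0[OF j(1)])
    finally show ?thesis .
  qed
  obtain e where e: "0 < e" "e * L \<le> 1" "\<And>j. j \<in> I \<Longrightarrow> j \<noteq> i \<Longrightarrow> (p + e *\<^sub>R n) \<bullet> v j \<le> c j"
      "p \<bullet> v i < c i \<Longrightarrow> (p + e *\<^sub>R n) \<bullet> v i \<le> c i"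
  proof -
    have lim: "((\<lambda>e. (p + e *\<^sub>R n) \<bullet> v j) \<longlongrightarrow> (p + 0 *\<^sub>R n) \<bullet> v j) (at_right 0)" for j
      by (intro tendsto_intros)
    have "\<forall>\<^sub>F e in at_right 0. \<forall>j\<in>I - {i}. (p + e *\<^sub>R n) \<bullet> v j < c j"
      using I strict by (intro eventually_ball_finite ballI order_tendstoD(2)[OF lim]) auto
    moreover have "\<forall>\<^sub>F e in at_right 0. p \<bullet> v i < c i \<longrightarrow> (p + e *\<^sub>R n) \<bullet> v i < c i"
    proof (cases "p \<bullet> v i < c i")
      case True then show ?thesis using order_tendstoD(2)[OF lim, of i "c i"] by simp
    qed simp
    moreover have "\<forall>\<^sub>F e in at_right 0. e < 1 / L"
      using L by (intro eventually_at_right_less[THEN eventually_mono] order_tendstoD(2)[OF tendsto_ident_at]) auto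
    moreover have "\<forall>\<^sub>F e::real in at_right 0. 0 < e" by (simp add: eventually_at_filter)
    ultimately have "\<forall>\<^sub>F e in at_right 0. 0 < e \<and> e < 1 / L \<and> (\<forall>j\<in>I - {i}. (p + e *\<^sub>R n) \<bullet> v j < c j)
        \<and> (p \<bullet> v i < c i \<longrightarrow> (p + e *\<^sub>R n) \<bullet> v i < c i)"
      by eventually_elim auto
    then obtain e where "0 < e \<and> e < 1 / L \<and> (\<forall>j\<in>I - {i}. (p + e *\<^sub>R n) \<bullet> v j < c j)
        \<and> (p \<bullet> v i < c i \<longrightarrow> (p + e *\<^sub>R n) \<bullet> v i < c i)"
      using eventually_happens'[OF trivial_limit_at_right_real] by blast
    then show ?thesis using L by (intro that[of e]) (auto simp: field_simps less_imp_le)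
  qed
  have beyond: "(p + e *\<^sub>R n) \<bullet> n = m + e" by (simp add: inner_along[OF n] pn)
  have "p \<bullet> v i = c i"
  proof (rule ccontr)
    assume "p \<bullet> v i \<noteq> c i"
    then have "p \<bullet> v i < c i" using p i by (force simp: mem_cell)
    then have "p + e *\<^sub>R n \<in> cell I v c" using e(3,4) unfolding mem_cell by metis
    then show False using m[of "p + e *\<^sub>R n"] e(1) beyond by (simp add: n_def)
  qed
  then have Lm: "L * m = c i" by (simp add: vn pn)
  then show "m = c i / norm (v i)" using L by (simp add: L_def[symmetric] field_simps)
  have up: "(p + e *\<^sub>R n) \<bullet> v i = c i + e * L" using Lm by (simp add: vn beyond distrib_left mult.commute)
  show "\<exists>q\<in>cell I v (c(i := c i + 1)). c i < q \<bullet> v i"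
  proof
    show "c i < (p + e *\<^sub>R n) \<bullet> v i" using up e(1) L by simp
    show "p + e *\<^sub>R n \<in> cell I v (c(i := c i + 1))" using e up unfolding mem_cell by auto
  qed
qed

text \<open>
  A height that is not attained could be lowered without changing the cell, which would increase the
  ratio of the volume to the power of the sum.
\<close>

lemma optimal_tight:
  fixes v :: "'i \<Rightarrow> 'a::euclidean_space"
  assumes I: "finite I" and rec: "no_recession I v" and C: "0 < C"
    and le: "\<And>c. 0 < (\<Sum>i\<in>I. c i) \<Longrightarrow> measure lborel (cell I v c) \<le> C * (\<Sum>i\<in>I. c i) ^ DIM('a)"
    and s: "(\<Sum>i\<in>I. c i) = s" "0 < s" and eq: "measure lborel (cell I v c) = C * s ^ DIM('a)"
    and i: "i \<in> I"
  obtains p where "p \<in> cell I v c" "p \<bullet> v i = c i"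
proof -
  have "0 < measure lborel (cell I v c)" using eq C s by simp
  then have "cell I v c \<noteq> {}" by auto
  moreover have "continuous_on (cell I v c) (\<lambda>p. p \<bullet> v i)" by (intro continuous_intros)
  ultimately obtain p where p: "p \<in> cell I v c" "\<And>q. q \<in> cell I v c \<Longrightarrow> q \<bullet> v i \<le> p \<bullet> v i"
    using continuous_attains_sup[OF compact_cell[OF I rec]] by metis
  show ?thesis
  proof (rule that[OF p(1)], rule ccontr)
    assume "p \<bullet> v i \<noteq> c i"
    then have lt: "p \<bullet> v i < c i" using p i by (force simp: mem_cell)
    \<comment> \<open>Lowering by at most s / 2 keeps the sum of the heights positive.\<close>
    define c' where "c' = c(i := max (p \<bullet> v i) (c i - s / 2))"
    have "cell I v c' = cell I v c"
    proof
      show "cell I v c' \<subseteq> cell I v c" using lt s by (intro cell_mono) (auto simp: c'_def)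
      show "cell I v c \<subseteq> cell I v c'"
        using p(2) by (auto simp: mem_cell c'_def le_max_iff_disj)
    qed
    moreover define \<delta> where "\<delta> = c i - max (p \<bullet> v i) (c i - s / 2)"
    have sum: "(\<Sum>i\<in>I. c' i) = s - \<delta>"
      using I i s(1) by (simp add: c'_def \<delta>_def sum.remove[of I i])
    have "0 < \<delta>" using lt s by (auto simp: \<delta>_def)
    moreover have "\<delta> \<le> s / 2"
      unfolding \<delta>_def using max.cobounded2[of "c i - s / 2" "p \<bullet> v i"] unfolding diff_le_eq by (simp only: add.commute)
    ultimately have s': "0 < (\<Sum>i\<in>I. c' i)" "(\<Sum>i\<in>I. c' i) < s" and "measure lborel (cell I v c) \<le> C * (\<Sum>i\<in>I. c' i) ^ DIM('a)"
      using le[of c'] s(2) unfolding sum by (auto simp: field_simps)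
    then have "C * s ^ DIM('a) \<le> C * (\<Sum>i\<in>I. c' i) ^ DIM('a)" using eq by simp
    moreover have "(\<Sum>i\<in>I. c' i) ^ DIM('a) < s ^ DIM('a)" using s' by (intro power_strict_mono) auto
    ultimately show False using C by simp
  qed
qed

text \<open>
  The difference of \<open>C (s + t)\<^sup>d\<close> and the volume at height \<open>c i + t\<close> is nonnegative near \<open>t = 0\<close> and vanishes
  there. For \<open>t < 0\<close> this shows that the volume drops at a positive rate, so the face has positive area; then
  the volume is differentiable at 0 and the derivative of the difference is 0.
\<close>

lemma optimal_facet_area:
  fixes v :: "'i \<Rightarrow> 'a::euclidean_space"
  assumes I: "finite I" and rec: "no_recession I v" and C: "0 < C"
    and v: "\<And>i. i \<in> I \<Longrightarrow> v i \<noteq> 0" and inj: "inj_on (\<lambda>i. sgn (v i)) I"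
    and le: "\<And>c. 0 < (\<Sum>i\<in>I. c i) \<Longrightarrow> measure lborel (cell I v c) \<le> C * (\<Sum>i\<in>I. c i) ^ DIM('a)"
    and s: "(\<Sum>i\<in>I. c i) = s" "0 < s" and eq: "measure lborel (cell I v c) = C * s ^ DIM('a)"
    and i: "i \<in> I"
  shows "enn2real (slice_area (sgn (v i)) (cell I v c) (c i / norm (v i))) / norm (v i)
    = real DIM('a) * C * s ^ (DIM('a) - 1)"
proof -
  define n where "n = sgn (v i)"
  define L where "L = norm (v i)"
  define m where "m = c i / L"
  define d where "d = DIM('a)"
  have d: "0 < d" by (simp add: d_def)
  have L: "0 < L" using v i by (simp add: L_def)
  have n: "norm n = 1" using v i by (simp add: n_def norm_sgn)
  have vn: "x \<bullet> v i = L * (x \<bullet> n)" for x using inner_sgn[OF v[OF i]] by (simp add: L_def n_def)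
  have K: "compact (cell I v c)" for c by (rule compact_cell[OF I rec])
  have sum_upd: "(\<Sum>j\<in>I. (c(i := c i + t)) j) = s + t" for t
    using I i s(1) by (simp add: sum.remove[of I i])
  let ?f = "\<lambda>t. measure lborel (cell I v (c(i := c i + t)))"
  have f0: "?f 0 = C * s ^ d" using eq by (simp add: d_def)
  have fle: "?f t \<le> C * (s + t) ^ d" if "- s < t" for t
    using le[of "c(i := c i + t)"] that unfolding sum_upd by (simp add: d_def)
  have "0 < measure lborel (cell I v c)" using eq C s by simp
  then have pos: "0 < emeasure lborel (cell I v c)" using K by (simp add: measure_def enn2real_positive_iff)
  obtain p0 where "\<forall>j\<in>I. p0 \<bullet> v j < c j" by (rule cell_strict_point[OF I v pos])
  then have p0: "\<And>j. j \<in> I \<Longrightarrow> p0 \<bullet> v j < c j" by blast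
  have m: "p \<bullet> n \<le> m" if "p \<in> cell I v c" for p
    using that i L by (auto simp: mem_cell vn m_def field_simps)
  have area: "0 < slice_area n (cell I v c) m"
  proof (rule ccontr)
    assume "\<not> 0 < slice_area n (cell I v c) m"
    \<comment> \<open>If the area were 0, nearby slices would be too small for half of the required decrease of the volume.\<close>
    define k where "k = L * (C * s ^ (d - 1)) / 2"
    have k: "0 < k" using L C s by (simp add: k_def)
    have "slice_area n (cell I v c) m < ennreal k" using \<open>\<not> 0 < _\<close> k by (simp add: not_less)
    then obtain e where e: "0 < e" "\<And>r. \<bar>r - m\<bar> \<le> e \<Longrightarrow> slice_area n (cell I v c) r < ennreal k"
      using slice_area_usc[OF K n] by metis
    define t where "t = min (L * e) (s / 2)"
    have t: "0 < t" "t \<le> L * e" "t < s" using L e s by (auto simp: t_def min_def)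
    have "volume_below n (cell I v c) m - volume_below n (cell I v c) (m - t / L) \<le> k * (m - (m - t / L))"
    proof (rule volume_below_diff_bounds(2)[OF K n, where l=0])
      fix r assume "m - t / L \<le> r" "r \<le> m"
      moreover have "t / L \<le> e" using t(2) L by (simp add: pos_divide_le_eq mult.commute)
      ultimately have "m - r \<le> e" "r - m \<le> 0" by simp_all
      then have "\<bar>r - m\<bar> \<le> e" using e(1) by linarith
      then show "ennreal 0 \<le> slice_area n (cell I v c) r \<and> slice_area n (cell I v c) r \<le> ennreal k"
        using e(2)[of r] by (simp add: less_imp_le)
    qed (use t L k in auto)
    moreover have "volume_below n (cell I v c) m = ?f 0"
    proof -
      have "cell I v c \<inter> {x. x \<bullet> n \<le> m} = cell I v c" using m by auto
      then show ?thesis by (simp add: volume_below_def)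
    qed
    moreover have "volume_below n (cell I v c) (m - t / L) = ?f (- t)"
    proof -
      have "(x \<bullet> n \<le> m - t / L) = (x \<bullet> v i \<le> c i - t)" for x using L by (simp add: vn m_def field_simps)
      moreover have "x \<in> cell I v c \<longleftrightarrow> x \<bullet> v i \<le> c i \<and> (\<forall>j\<in>I - {i}. x \<bullet> v j \<le> c j)" for x
        using mem_cell_upd[OF i, of x v c "c i"] by simp
      ultimately have "x \<in> cell I v c \<inter> {x. x \<bullet> n \<le> m - t / L} \<longleftrightarrow> x \<in> cell I v (c(i := c i + - t))" for x
        unfolding Int_iff mem_Collect_eq mem_cell_upd[OF i] using t by auto
      then have "cell I v c \<inter> {x. x \<bullet> n \<le> m - t / L} = cell I v (c(i := c i + - t))" by blast
      then show ?thesis by (simp add: volume_below_def)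
    qed
    ultimately have "?f 0 - ?f (- t) \<le> k * (t / L)" by simp
    also have "k * (t / L) = C * s ^ (d - 1) * t / 2" using L by (simp add: k_def)
    finally have 1: "?f 0 - ?f (- t) \<le> C * s ^ (d - 1) * t / 2" .
    have "(s - t) ^ d \<le> (s - t) * s ^ (d - 1)"
    proof -
      have "(s - t) ^ d = (s - t) * (s - t) ^ (d - 1)" using d by (metis Suc_diff_1 power_Suc)
      also have "\<dots> \<le> (s - t) * s ^ (d - 1)" using t by (intro mult_left_mono power_mono) auto
      finally show ?thesis .
    qed
    then have "C * (s - t) ^ d \<le> C * ((s - t) * s ^ (d - 1))" using C by (intro mult_left_mono) auto
    also have "\<dots> = C * s ^ d - C * s ^ (d - 1) * t"
      using d by (cases d) (simp_all add: algebra_simps)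
    finally have 2: "C * s ^ (d - 1) * t \<le> ?f 0 - ?f (- t)"
      using fle[of "-t"] t unfolding f0 by simp
    have "0 < C * s ^ (d - 1) * t" using C s t by simp
    with 1 2 show False by simp
  qed
  obtain q where q: "q \<in> cell I v (c(i := c i + 1))" "c i < q \<bullet> v i"
    using facet_of_positive_area(2)[OF I v inj i p0, of m] m area by (auto simp: n_def)
  have p0c: "p0 \<in> cell I v c" using p0 by (simp add: mem_cell less_imp_le)
  have D: "(?f has_real_derivative enn2real (slice_area n (cell I v c) m) / L) (at 0)"
    using facet_derivative[OF I rec i v[OF i] p0c p0[OF i] q] by (simp add: n_def L_def m_def)
  have "((\<lambda>t. C * (s + t) ^ d - ?f t) has_real_derivative
      C * (real d * s ^ (d - 1)) - enn2real (slice_area n (cell I v c) m) / L) (at 0)"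
    by (rule DERIV_diff[OF _ D]) (auto intro!: derivative_eq_intros)
  then have "C * (real d * s ^ (d - 1)) - enn2real (slice_area n (cell I v c) m) / L = 0"
    by (rule DERIV_local_min[OF _ s(2)]) (use fle f0 in auto)
  then show ?thesis by (simp add: n_def L_def m_def d_def mult.assoc mult.left_commute)
qed

section \<open>The tangent inequality and sufficiency of equal facet densities\<close>

lemma ln_volume_midpoint:
  fixes v :: "'i \<Rightarrow> 'a::euclidean_space"
  assumes I: "finite I" and rec: "no_recession I v"
    and c: "0 < measure lborel (cell I v c)" and c': "0 < measure lborel (cell I v c')"
    and mid: "\<And>i. i \<in> I \<Longrightarrow> b i = (c i + c' i) / 2"
  shows "0 < measure lborel (cell I v b)"
    and "ln (measure lborel (cell I v c)) + ln (measure lborel (cell I v c')) \<le> 2 * ln (measure lborel (cell I v b))"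
proof -
  let ?V = "\<lambda>c. measure lborel (cell I v c)"
  have e: "emeasure lborel (cell I v c) = ennreal (?V c)" for c
    using emeasure_compact_finite[OF compact_cell[OF I rec, of c]] by (intro emeasure_eq_ennreal_measure) auto
  have "cell I v b = cell I v (\<lambda>i. (c i + c' i) / 2)" by (rule cell_cong) (rule mid)
  then have "ennreal (?V c * ?V c') \<le> ennreal ((?V b)\<^sup>2)"
    using emeasure_cell_midpoint[of I v c c'] unfolding e by (simp add: ennreal_mult ennreal_power)
  then have le: "?V c * ?V c' \<le> (?V b)\<^sup>2" by simp
  then have "(?V b)\<^sup>2 \<noteq> 0" using mult_pos_pos[OF c c'] by auto
  then show b: "0 < ?V b" by (simp add: less_le)
  have "ln (?V c * ?V c') \<le> ln ((?V b)\<^sup>2)" using le c c' b by (subst ln_le_cancel_iff) auto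
  then show "ln (?V c) + ln (?V c') \<le> 2 * ln (?V b)"
    using c c' b by (simp add: ln_mult ln_realpow)
qed

text \<open>
  A change of the heights in \<open>insert j J\<close> is the midpoint of twice the change of the height \<open>j\<close> and
  twice the change of those in \<open>J\<close>. By midpoint concavity the partial derivatives therefore control
  all directions from below.
\<close>

lemma volume_lower_expansion:
  fixes I :: "'i set" and v :: "'i \<Rightarrow> 'a::euclidean_space" and c :: "'i \<Rightarrow> real"
  defines "V \<equiv> \<lambda>c. measure lborel (cell I v c)"
  assumes I: "finite I" and rec: "no_recession I v" and pos: "0 < V c"
    and D: "\<And>i. i \<in> I \<Longrightarrow> ((\<lambda>t. V (c(i := c i + t))) has_real_derivative g i) (at 0)"
    and J: "J \<subseteq> I" and e: "0 < e"
  shows "\<forall>\<^sub>F t in at_right 0. 0 < V (\<lambda>i. c i + t * (if i \<in> J then \<zeta> i else 0)) \<and>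
      ln (V c) + t * ((\<Sum>j\<in>J. \<zeta> j * g j) / V c - e) \<le> ln (V (\<lambda>i. c i + t * (if i \<in> J then \<zeta> i else 0)))"
proof -
  have "finite J" using I J by (rule rev_finite_subset)
  then show ?thesis using J e
  proof (induction J arbitrary: e)
    case empty
    have "\<forall>\<^sub>F t::real in at_right 0. 0 < t" by (simp add: eventually_at_filter)
    then show ?case by eventually_elim (use pos empty in simp)
  next
    case (insert j J)
    have j: "j \<in> I" "j \<notin> J" using insert by auto
    define c1 where "c1 t = (\<lambda>i. c i + 2 * t * (if i = j then \<zeta> j else 0))" for t
    define c2 where "c2 t = (\<lambda>i. c i + 2 * t * (if i \<in> J then \<zeta> i else 0))" for t
    have c1: "c1 t = c(j := c j + 2 * t * \<zeta> j)" for t by (auto simp: c1_def)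
    have V1: "((\<lambda>t. V (c1 t)) has_real_derivative g j * (2 * \<zeta> j)) (at 0)"
      unfolding c1
    proof (rule DERIV_chain2[where f="\<lambda>t. V (c(j := c j + t))" and g="\<lambda>t. 2 * t * \<zeta> j"])
      show "((\<lambda>t. V (c(j := c j + t))) has_real_derivative g j) (at (2 * 0 * \<zeta> j))"
        using D[OF j(1)] by simp
    qed (auto intro!: derivative_eq_intros)
    have V10: "V (c1 0) = V c" by (simp add: c1)
    have "((\<lambda>t. ln (V (c1 t))) has_real_derivative 1 / V c * (g j * (2 * \<zeta> j))) (at 0)"
      by (rule DERIV_chain2[where f=ln, OF _ V1]) (use pos V10 in \<open>auto intro!: derivative_eq_intros\<close>)
    then have "((\<lambda>t. (ln (V (c1 t)) - ln (V c)) / t) \<longlongrightarrow> 1 / V c * (g j * (2 * \<zeta> j))) (at 0)"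
      unfolding has_field_derivative_iff V10 by simp
    then have "((\<lambda>t. (ln (V (c1 t)) - ln (V c)) / t) \<longlongrightarrow> 1 / V c * (g j * (2 * \<zeta> j))) (at_right 0)"
      by (rule tendsto_mono[OF at_le, rotated]) simp
    then have "\<forall>\<^sub>F t in at_right 0. 2 * (\<zeta> j * g j / V c - e / 2) < (ln (V (c1 t)) - ln (V c)) / t"
      by (rule order_tendstoD) (use insert.prems in \<open>simp add: algebra_simps\<close>)
    moreover have "((\<lambda>t. V (c1 t)) \<longlongrightarrow> V c) (at_right 0)"
      using DERIV_isCont[OF V1] V10 unfolding isCont_def
      by (auto intro: tendsto_mono[OF at_le, rotated])
    then have "\<forall>\<^sub>F t in at_right 0. 0 < V (c1 t)" using pos by (rule order_tendstoD)
    moreover have "\<forall>\<^sub>F t in at_right 0. 0 < V (c2 t) \<and>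
        ln (V c) + 2 * t * ((\<Sum>j\<in>J. \<zeta> j * g j) / V c - e / 2) \<le> ln (V (c2 t))"
    proof -
      have "\<forall>\<^sub>F t in at_right 0. 0 < V (\<lambda>i. c i + t * (if i \<in> J then \<zeta> i else 0)) \<and>
          ln (V c) + t * ((\<Sum>j\<in>J. \<zeta> j * g j) / V c - e / 2) \<le> ln (V (\<lambda>i. c i + t * (if i \<in> J then \<zeta> i else 0)))"
        using insert by (intro insert.IH) auto
      then obtain b where b: "0 < b" "\<And>t. 0 < t \<Longrightarrow> t < b \<Longrightarrow> 0 < V (\<lambda>i. c i + t * (if i \<in> J then \<zeta> i else 0)) \<and>
          ln (V c) + t * ((\<Sum>j\<in>J. \<zeta> j * g j) / V c - e / 2) \<le> ln (V (\<lambda>i. c i + t * (if i \<in> J then \<zeta> i else 0)))"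
        by (auto simp: eventually_at_right[of 0 1])
      show ?thesis unfolding eventually_at_right[OF zero_less_one]
      proof (intro exI[of _ "b / 2"] conjI allI impI)
        fix t :: real assume "0 < t" "t < b / 2"
        then have t: "0 < 2 * t" "2 * t < b" by simp_all
        show "0 < V (c2 t)" "ln (V c) + 2 * t * ((\<Sum>j\<in>J. \<zeta> j * g j) / V c - e / 2) \<le> ln (V (c2 t))"
          using b(2)[OF t] by (simp_all only: c2_def)
      qed (use b in auto)
    qed
    moreover have "\<forall>\<^sub>F t::real in at_right 0. 0 < t" by (simp add: eventually_at_filter)
    ultimately show ?case
    proof eventually_elim
      case (elim t)
      let ?b = "\<lambda>i. c i + t * (if i \<in> insert j J then \<zeta> i else 0)"
      have mid: "?b i = (c1 t i + c2 t i) / 2" for i using j by (auto simp: c1_def c2_def field_simps)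
      have p1: "0 < measure lborel (cell I v (c1 t))" and p2: "0 < measure lborel (cell I v (c2 t))"
        using elim by (auto simp: V_def)
      note M = ln_volume_midpoint[OF I rec p1 p2 mid]
      have 1: "2 * (\<zeta> j * g j / V c - e / 2) * t \<le> ln (V (c1 t)) - ln (V c)"
        using elim by (simp add: pos_less_divide_eq)
      have 2: "ln (V c) + 2 * t * ((\<Sum>j\<in>J. \<zeta> j * g j) / V c - e / 2) \<le> ln (V (c2 t))" using elim by simp
      have "2 * (ln (V c) + t * ((\<Sum>j\<in>insert j J. \<zeta> j * g j) / V c - e))
          = (ln (V c) + 2 * (\<zeta> j * g j / V c - e / 2) * t) + (ln (V c) + 2 * t * ((\<Sum>j\<in>J. \<zeta> j * g j) / V c - e / 2))"
        using insert.hyps by (simp add: algebra_simps add_divide_distrib)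
      also have "\<dots> \<le> ln (V (c1 t)) + ln (V (c2 t))" using 1 2 by (intro add_mono) simp_all
      also have "\<dots> \<le> 2 * ln (V ?b)" unfolding V_def by (rule M(2))
      finally show ?case using M(1) by (simp add: V_def)
    qed
  qed
qed

text \<open>
  Let \<open>\<eta> = c' - c\<close>. Bisecting the segment from \<open>c\<close> to \<open>c'\<close> bounds the increase of the logarithm from \<open>c\<close>
  to \<open>c + t \<eta>\<close> from below for \<open>t = (1/2)\<^sup>k\<close>. Concavity at the midpoint \<open>c\<close> bounds it from above by the
  decrease from \<open>c\<close> to \<open>c - t \<eta>\<close>, to which the lower expansion applies.
\<close>

theorem volume_tangent:
  fixes I :: "'i set" and v :: "'i \<Rightarrow> 'a::euclidean_space" and c :: "'i \<Rightarrow> real"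
  defines "V \<equiv> \<lambda>c. measure lborel (cell I v c)"
  assumes I: "finite I" and rec: "no_recession I v" and pos: "0 < V c" and pos': "0 < V c'"
    and D: "\<And>i. i \<in> I \<Longrightarrow> ((\<lambda>t. V (c(i := c i + t))) has_real_derivative g i) (at 0)"
  shows "ln (V c') - ln (V c) \<le> (\<Sum>i\<in>I. (c' i - c i) * g i) / V c"
proof (rule field_le_epsilon)
  fix e :: real assume e: "0 < e"
  define \<eta> where "\<eta> i = c' i - c i" for i
  define S where "S = (\<Sum>i\<in>I. \<eta> i * g i) / V c"
  have "\<forall>\<^sub>F t in at_right 0. 0 < V (\<lambda>i. c i + t * (if i \<in> I then - \<eta> i else 0)) \<and>
      ln (V c) + t * ((\<Sum>j\<in>I. (- \<eta> j) * g j) / V c - e) \<le> ln (V (\<lambda>i. c i + t * (if i \<in> I then - \<eta> i else 0)))"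
    using volume_lower_expansion[where I=I and J=I and v=v and c=c and g=g and e=e and \<zeta>="\<lambda>i. - \<eta> i"] I rec pos D e
    by (simp add: V_def)
  moreover have "V (\<lambda>i. c i + t * (if i \<in> I then - \<eta> i else 0)) = V (\<lambda>i. c i - t * \<eta> i)" for t
    unfolding V_def by (intro arg_cong[where f="measure lborel"] cell_cong) simp
  ultimately have "\<forall>\<^sub>F t in at_right 0. 0 < V (\<lambda>i. c i - t * \<eta> i) \<and>
      ln (V c) + t * (- S - e) \<le> ln (V (\<lambda>i. c i - t * \<eta> i))"
    by (simp add: S_def sum_negf)
  then obtain b where b: "0 < b" "\<And>t. 0 < t \<Longrightarrow> t < b \<Longrightarrow> 0 < V (\<lambda>i. c i - t * \<eta> i) \<and>
      ln (V c) + t * (- S - e) \<le> ln (V (\<lambda>i. c i - t * \<eta> i))"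
    by (auto simp: eventually_at_right[of 0 1])
  have dyadic: "0 < V (\<lambda>i. c i + (1/2) ^ k * \<eta> i) \<and>
      ln (V c) + (1/2) ^ k * (ln (V c') - ln (V c)) \<le> ln (V (\<lambda>i. c i + (1/2) ^ k * \<eta> i))" for k
  proof (induction k)
    case 0
    then show ?case using pos' by (simp add: \<eta>_def)
  next
    case (Suc k)
    have mid: "c i + (1/2) ^ Suc k * \<eta> i = (c i + (c i + (1/2) ^ k * \<eta> i)) / 2" for i
      by (simp add: field_simps)
    have p: "0 < measure lborel (cell I v c)" "0 < measure lborel (cell I v (\<lambda>i. c i + (1/2) ^ k * \<eta> i))"
      using pos Suc by (auto simp: V_def)
    note M = ln_volume_midpoint[OF I rec p mid]
    have "2 * (ln (V c) + (1/2) ^ Suc k * (ln (V c') - ln (V c)))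
        = ln (V c) + (ln (V c) + (1/2) ^ k * (ln (V c') - ln (V c)))" by simp
    also have "\<dots> \<le> ln (V c) + ln (V (\<lambda>i. c i + (1/2) ^ k * \<eta> i))" using Suc by simp
    also have "\<dots> \<le> 2 * ln (V (\<lambda>i. c i + (1/2) ^ Suc k * \<eta> i))" unfolding V_def by (rule M(2))
    finally show ?case using M(1) by (simp add: V_def)
  qed
  obtain k where k: "(1/2) ^ k < b" using real_arch_pow_inv[OF b(1), of "1/2"] by auto
  define t where "t = (1/2::real) ^ k"
  have t: "0 < t" "t < b" using k by (auto simp: t_def)
  have p: "0 < measure lborel (cell I v (\<lambda>i. c i + t * \<eta> i))" "0 < measure lborel (cell I v (\<lambda>i. c i - t * \<eta> i))"
    using dyadic[of k] b(2)[OF t] by (auto simp: V_def t_def)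
  have "ln (V (\<lambda>i. c i + t * \<eta> i)) + ln (V (\<lambda>i. c i - t * \<eta> i)) \<le> 2 * ln (V c)"
    using ln_volume_midpoint(2)[OF I rec p, of c] by (simp add: V_def)
  moreover have "ln (V c) + t * (ln (V c') - ln (V c)) \<le> ln (V (\<lambda>i. c i + t * \<eta> i))"
    using dyadic[of k] by (simp add: t_def)
  moreover have "ln (V c) + t * (- S - e) \<le> ln (V (\<lambda>i. c i - t * \<eta> i))" using b(2)[OF t] by simp
  ultimately have "t * (ln (V c') - ln (V c)) + t * (- S - e) \<le> 0" by linarith
  then have "t * ((ln (V c') - ln (V c)) - (S + e)) \<le> 0" by (simp add: algebra_simps)
  then show "ln (V c') - ln (V c) \<le> (\<Sum>i\<in>I. (c' i - c i) * g i) / V c + e"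
    using t by (simp add: mult_le_0_iff S_def \<eta>_def)
qed

text \<open>
  With equal partial derivatives the tangent inequality compares volumes by the sums of the heights.
  Translates have the same volume, so by moving in direction \<open>- (\<Sum>i\<in>I. v i)\<close> the sum cannot decrease;
  doubling the heights increases the volume, so it increases the sum.
\<close>

theorem equal_densities_optimal:
  fixes I :: "'i set" and v :: "'i \<Rightarrow> 'a::euclidean_space" and c :: "'i \<Rightarrow> real"
  defines "V \<equiv> \<lambda>c. measure lborel (cell I v c)"
  assumes I: "finite I" and rec: "no_recession I v" and pos: "0 < V c" and \<alpha>: "0 < \<alpha>"
    and D: "\<And>i. i \<in> I \<Longrightarrow> ((\<lambda>t. V (c(i := c i + t))) has_real_derivative \<alpha>) (at 0)"
  shows "(\<Sum>i\<in>I. v i) = 0" and "0 < (\<Sum>i\<in>I. c i)"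
    and "\<And>c'. (\<Sum>i\<in>I. c' i) = (\<Sum>i\<in>I. c i) \<Longrightarrow> V c' \<le> V c"
proof -
  have tan: "ln (V c') - ln (V c) \<le> \<alpha> * ((\<Sum>i\<in>I. c' i) - (\<Sum>i\<in>I. c i)) / V c" if "0 < V c'" for c'
  proof -
    have "(\<Sum>i\<in>I. (c' i - c i) * \<alpha>) = \<alpha> * ((\<Sum>i\<in>I. c' i) - (\<Sum>i\<in>I. c i))"
      unfolding sum_distrib_right[symmetric] sum_subtractf by (rule mult.commute)
    then show ?thesis
      using volume_tangent[of I v c c' "\<lambda>_. \<alpha>"] I rec pos that D by (simp add: V_def)
  qed
  show "(\<Sum>i\<in>I. v i) = 0"
  proof -
    define w where "w = (\<Sum>i\<in>I. v i)"
    have "V (\<lambda>i. c i + (- w) \<bullet> v i) = V c" unfolding V_def measure_def emeasure_cell_translate ..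
    then have "0 \<le> \<alpha> * ((\<Sum>i\<in>I. c i + (- w) \<bullet> v i) - (\<Sum>i\<in>I. c i)) / V c"
      using tan[of "\<lambda>i. c i + (- w) \<bullet> v i"] pos by simp
    also have "(\<Sum>i\<in>I. c i + (- w) \<bullet> v i) - (\<Sum>i\<in>I. c i) = - (w \<bullet> w)"
      by (simp add: sum_subtractf w_def inner_sum_right)
    finally have "w \<bullet> w \<le> 0" using pos \<alpha> by (simp add: divide_le_0_iff mult_le_0_iff)
    then have "w \<bullet> w = 0" using inner_ge_zero[of w] by simp
    then show ?thesis by (simp add: w_def)
  qed
  show "0 < (\<Sum>i\<in>I. c i)"
  proof -
    have "emeasure lborel (cell I v (\<lambda>i. 2 * c i)) = ennreal (2 ^ DIM('a)) * emeasure lborel (cell I v c)"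
      by (rule emeasure_cell_scale) simp
    then have V2: "V (\<lambda>i. 2 * c i) = 2 ^ DIM('a) * V c" by (simp add: V_def measure_def enn2real_mult)
    then have "0 < V (\<lambda>i. 2 * c i)" using pos by simp
    from tan[OF this] have "ln (2 ^ DIM('a) * V c) - ln (V c) \<le> \<alpha> * (\<Sum>i\<in>I. c i) / V c"
      by (simp add: V2 flip: sum_distrib_left)
    moreover have "ln (2 ^ DIM('a) * V c) - ln (V c) = real DIM('a) * ln 2"
      using pos by (simp add: ln_mult ln_realpow)
    moreover have "0 < real DIM('a) * ln 2" by simp
    ultimately have "0 < \<alpha> * (\<Sum>i\<in>I. c i) / V c" by linarith
    then show ?thesis using pos \<alpha> by (simp add: zero_less_divide_iff zero_less_mult_iff)
  qed
  show "V c' \<le> V c" if s: "(\<Sum>i\<in>I. c' i) = (\<Sum>i\<in>I. c i)" for c'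
  proof (cases "0 < V c'")
    case True
    have "ln (V c') \<le> ln (V c)" using tan[OF True] s by simp
    then show ?thesis using True pos by simp
  next
    case False
    then show ?thesis using pos by simp
  qed
qed

section \<open>Polyhedra with facets of finite area\<close>

text \<open>
  A recession direction tangential to the face \<open>i\<close> would make its area infinite. Any other recession
  direction \<open>q\<close> points strictly inwards at all faces; tilted towards an orthogonal direction it becomes
  tangential to one of them. If the cell had volume 0, it would lie in a hyperplane parallel to
  all faces, and every direction of this hyperplane would be a tangential recession direction.
\<close>

lemma finite_facets_nondegenerate:
  fixes v :: "'i \<Rightarrow> 'a::euclidean_space"
  assumes d: "2 \<le> DIM('a)" and I: "finite I" "I \<noteq> {}" and v: "\<And>i. i \<in> I \<Longrightarrow> v i \<noteq> 0"
    and area: "\<And>i. i \<in> I \<Longrightarrow> 0 < slice_area (sgn (v i)) (cell I v c) (m i)"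
    and fin: "\<And>i. i \<in> I \<Longrightarrow> slice_area (sgn (v i)) (cell I v c) (m i) < \<infinity>"
  shows "no_recession I v" and "0 < emeasure lborel (cell I v c)"
proof -
  have n: "norm (sgn (v i)) = 1" if "i \<in> I" for i using v[OF that] by (simp add: norm_sgn)
  have R: "q = 0" if q: "\<And>j. j \<in> I \<Longrightarrow> q \<bullet> v j \<le> 0" and i: "i \<in> I" "q \<bullet> v i = 0" for q i
  proof (rule ccontr)
    assume "q \<noteq> 0"
    have "q \<bullet> sgn (v i) = 0" using i inner_sgn[OF v[OF i(1)], of q] v by auto
    then have "y + t *\<^sub>R q \<in> slice_cylinder (sgn (v i)) (cell I v c) (m i)"
      if y: "y \<in> slice_cylinder (sgn (v i)) (cell I v c) (m i)" and t: "0 \<le> t" for y t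
    proof -
      let ?p = "y + (m i - y \<bullet> sgn (v i)) *\<^sub>R sgn (v i)"
      have "?p + t *\<^sub>R q \<in> cell I v c"
        unfolding mem_cell
      proof
        fix j assume j: "j \<in> I"
        have "?p \<bullet> v j \<le> c j" using y j by (simp add: slice_cylinder_def mem_cell)
        moreover have "t * (q \<bullet> v j) \<le> 0" using t q[OF j] by (rule mult_nonneg_nonpos)
        ultimately show "(?p + t *\<^sub>R q) \<bullet> v j \<le> c j" unfolding inner_left_distrib[of _ "t *\<^sub>R q"] by simp
      qed
      then show ?thesis using y \<open>q \<bullet> sgn (v i) = 0\<close>
        by (simp add: slice_cylinder_def inner_left_distrib add.assoc add.commute[of "t *\<^sub>R q"])
    qed
    then have "slice_area (sgn (v i)) (cell I v c) (m i) = \<infinity>"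
      unfolding slice_area_def using area[OF i(1)] \<open>q \<noteq> 0\<close>
      by (intro emeasure_recession_infinite) (auto simp: slice_area_def)
    then show False using fin[OF i(1)] by simp
  qed
  show "no_recession I v"
    unfolding no_recession_def
  proof (intro allI impI, rule ccontr)
    fix q assume q: "\<forall>i\<in>I. q \<bullet> v i \<le> 0" "q \<noteq> 0"
    have neg: "q \<bullet> v i < 0" if "i \<in> I" for i using R[of q i] q that by force
    obtain w0 where w0: "w0 \<noteq> 0" "orthogonal q w0" using orthogonal_to_vector_exists[OF d] by blast
    have "\<exists>i\<in>I. w0 \<bullet> v i \<noteq> 0" using R[of w0] w0(1) I by (metis all_not_in_conv order_refl)
    then obtain w where w: "orthogonal q w" "\<exists>i\<in>I. 0 < w \<bullet> v i"
    proof
      fix i assume i: "i \<in> I" "w0 \<bullet> v i \<noteq> 0"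
      show ?thesis
      proof (cases "0 < w0 \<bullet> v i")
        case True then show ?thesis using that[of w0] w0 i by blast
      next
        case False
        then have "0 < (- w0) \<bullet> v i" using i by simp
        then show ?thesis using that[of "- w0"] w0 i by (auto simp: orthogonal_def)
      qed
    qed
    define P where "P = {i \<in> I. 0 < w \<bullet> v i}"
    define h where "h i = - (q \<bullet> v i) / (w \<bullet> v i)" for i
    have P: "finite P" "P \<noteq> {}" using I w by (auto simp: P_def)
    define k where "k = arg_min_on h P"
    have k: "k \<in> P" "\<And>j. j \<in> P \<Longrightarrow> h k \<le> h j"
      using arg_min_if_finite[OF P, of h] arg_min_least[OF P, of _ h] by (auto simp: k_def)
    have hk: "0 < h k" using k(1) neg[of k] by (auto simp: h_def P_def divide_neg_pos)
    \<comment> \<open>The first multiple of w at which q becomes tangential to some face.\<close>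
    define q' where "q' = q + h k *\<^sub>R w"
    have "q' \<bullet> v j \<le> 0" if j: "j \<in> I" for j
    proof (cases "j \<in> P")
      case True
      then have "h k * (w \<bullet> v j) \<le> h j * (w \<bullet> v j)" using k(2)[OF True] by (intro mult_right_mono) (auto simp: P_def)
      also have "\<dots> = - (q \<bullet> v j)" using True by (simp add: h_def P_def)
      finally show ?thesis by (simp add: q'_def inner_left_distrib)
    next
      case False
      then have "h k * (w \<bullet> v j) \<le> 0" using hk j by (auto simp: P_def not_less mult_le_0_iff)
      then show ?thesis using neg[OF j] by (simp add: q'_def inner_left_distrib)
    qed
    moreover have "q' \<bullet> v k = 0" 
    proof -
      have "h k * (w \<bullet> v k) = - (q \<bullet> v k)" using k(1) by (simp add: h_def P_def)
      then show ?thesis by (simp add: q'_def inner_left_distrib)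
    qed
    ultimately have "q' = 0" using R[of q' k] k(1) by (auto simp: P_def)
    moreover have "q' \<bullet> q = q \<bullet> q" using w(1) by (simp add: q'_def inner_left_distrib orthogonal_def inner_commute[of w q])
    ultimately show False using q(2) by simp
  qed
  show "0 < emeasure lborel (cell I v c)"
  proof (rule ccontr)
    assume "\<not> 0 < emeasure lborel (cell I v c)"
    then have "cell I v c \<in> null_sets lebesgue" by (auto simp: null_sets_def)
    then have "interior (cell I v c) = {}"
      using negligible_convex_interior[OF convex_cell[of I v c]] by (simp add: negligible_iff_null_sets)
    then obtain a b where a: "a \<noteq> 0" "cell I v c \<subseteq> {x. a \<bullet> x = b}"
      using empty_interior_subset_hyperplane[OF convex_cell] by metis
    have par: "a = (a \<bullet> sgn (v i)) *\<^sub>R sgn (v i)" if i: "i \<in> I" for i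
    proof (rule ccontr)
      let ?n = "sgn (v i)"
      define a' where "a' = a - (a \<bullet> ?n) *\<^sub>R ?n"
      assume "a \<noteq> (a \<bullet> ?n) *\<^sub>R ?n"
      then have "a' \<noteq> 0" by (simp add: a'_def)
      have "slice_cylinder ?n (cell I v c) (m i) \<subseteq> {y. y \<bullet> a' = b - m i * (a \<bullet> ?n)}"
      proof
        fix y assume "y \<in> slice_cylinder ?n (cell I v c) (m i)"
        then have "a \<bullet> (y + (m i - y \<bullet> ?n) *\<^sub>R ?n) = b" using a(2) by (auto simp: slice_cylinder_def)
        then show "y \<in> {y. y \<bullet> a' = b - m i * (a \<bullet> ?n)}"
          by (simp add: a'_def inner_right_distrib inner_diff_right algebra_simps inner_commute)
      qed
      then have "slice_area ?n (cell I v c) (m i) \<le> emeasure lborel {y. y \<bullet> a' = b - m i * (a \<bullet> ?n)}"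
        unfolding slice_area_def by (rule emeasure_mono) measurable
      also have "\<dots> = 0" using \<open>a' \<noteq> 0\<close> by (rule emeasure_hyperplane)
      finally have "slice_area ?n (cell I v c) (m i) \<le> 0" .
      then show False using area[OF i] by simp
    qed
    obtain w where w: "w \<noteq> 0" "orthogonal a w" using orthogonal_to_vector_exists[OF d] by blast
    have "w \<bullet> v i = 0" if i: "i \<in> I" for i
    proof -
      have "a \<bullet> w = (a \<bullet> sgn (v i)) * (sgn (v i) \<bullet> w)" by (subst par[OF i]) simp
      moreover have "a \<bullet> sgn (v i) \<noteq> 0" using par[OF i] a(1) by auto
      ultimately have "sgn (v i) \<bullet> w = 0" using w by (simp add: orthogonal_def)
      then show ?thesis using inner_sgn[OF v[OF i], of w] by (simp add: inner_commute)
    qed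
    then have "w = 0" using R[of w] I by fastforce
    then show False using w by simp
  qed
qed

section \<open>Equality in the Brunn-Minkowski inequality\<close>

lemma slice_area_bounded:
  fixes K :: "'a::euclidean_space set"
  assumes K: "compact K" and n: "norm n = 1"
  obtains B where "0 \<le> B" "\<forall>r. slice_area n K r \<le> ennreal B"
proof -
  obtain R where R: "0 < R" "\<forall>x\<in>K. norm x \<le> R" using compact_imp_bounded[OF K] bounded_pos by blast
  have "slice_area n K r \<le> slice_area n (tube n (2 * R)) r" for r
    unfolding slice_area_def
  proof (intro emeasure_mono slice_cylinder_mono subsetI)
    fix x assume x: "x \<in> K"
    have "norm (x - (x \<bullet> n) *\<^sub>R n) \<le> norm x + norm ((x \<bullet> n) *\<^sub>R n)" by (rule norm_triangle_ineq4)
    also have "\<dots> \<le> norm x + norm x" using Cauchy_Schwarz_ineq2[of x n] n by simp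
    also have "\<dots> \<le> 2 * R" using R x by auto
    finally show "x \<in> tube n (2 * R)" by (simp add: tube_def)
  qed measurable
  moreover have "slice_area n (tube n (2 * R)) r = ennreal (unit_ball_vol (real (DIM('a) - 1)) * (2 * R) ^ (DIM('a) - 1))" for r
    using R by (intro slice_area_tube_eq[OF n]) simp
  ultimately show ?thesis
    using R by (intro that[of "unit_ball_vol (real (DIM('a) - 1)) * (2 * R) ^ (DIM('a) - 1)"]) auto
qed

lemma continuous_volume_below:
  fixes K :: "'a::euclidean_space set"
  assumes K: "compact K" and n: "norm n = 1"
  shows "continuous_on S (volume_below n K)"
proof -
  obtain B where B: "0 \<le> B" "\<forall>r. slice_area n K r \<le> ennreal B" by (rule slice_area_bounded[OF K n])
  have le: "\<bar>volume_below n K v - volume_below n K u\<bar> \<le> B * \<bar>v - u\<bar>" if "u \<le> v" for u v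
    using volume_below_diff_bounds[OF K n that order_refl B(1)] B(2) that by auto
  have "B-lipschitz_on S (volume_below n K)"
  proof (rule lipschitz_onI[OF _ B(1)])
    fix u v
    show "dist (volume_below n K u) (volume_below n K v) \<le> B * dist u v"
      using le[of u v] le[of v u] by (cases "u \<le> v") (auto simp: dist_real_def abs_minus_commute)
  qed
  then show ?thesis by (rule lipschitz_on_continuous_on)
qed

lemma volume_above:
  assumes K: "compact K"
  shows "measure lborel (K \<inter> {x. s < x \<bullet> n}) = measure lborel K - volume_below n K s"
proof -
  have [measurable]: "K \<in> sets borel" using K by (rule borel_compact)
  have fin: "emeasure lborel (K \<inter> S) \<noteq> \<infinity>" for S
    using emeasure_mono[of "K \<inter> S" K lborel] emeasure_compact_finite[OF K] by (auto simp: top_unique)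
  have "measure lborel ((K \<inter> {x. x \<bullet> n \<le> s}) \<union> (K \<inter> {x. s < x \<bullet> n}))
     = measure lborel (K \<inter> {x. x \<bullet> n \<le> s}) + measure lborel (K \<inter> {x. s < x \<bullet> n})"
    using fin by (intro measure_Union) auto
  moreover have "(K \<inter> {x. x \<bullet> n \<le> s}) \<union> (K \<inter> {x. s < x \<bullet> n}) = K" by auto
  ultimately show ?thesis by (simp add: volume_below_def)
qed

text \<open>
  \<open>Q\<close> is the inverse of \<open>volume_below n K\<close> on the interior of the range \<open>{lo..hi}\<close> of \<open>x \<bullet> n\<close> on \<open>K\<close>.
\<close>

definition is_quantile :: "'a::euclidean_space \<Rightarrow> 'a set \<Rightarrow> real \<Rightarrow> real \<Rightarrow> (real \<Rightarrow> real) \<Rightarrow> bool" where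
  "is_quantile n K lo hi Q \<longleftrightarrow>
     lo < hi \<and> (\<forall>p\<in>K. lo \<le> p \<bullet> n \<and> p \<bullet> n \<le> hi) \<and> (\<exists>p\<in>K. p \<bullet> n = hi) \<and>
     (\<forall>s\<le>lo. volume_below n K s = 0) \<and> (\<forall>s\<ge>hi. volume_below n K s = measure lborel K) \<and>
     (\<forall>s. lo < s \<longrightarrow> s < hi \<longrightarrow> 0 < enn2real (slice_area n K s) \<and>
        (volume_below n K has_real_derivative enn2real (slice_area n K s)) (at s) \<and>
        0 < volume_below n K s \<and> volume_below n K s < measure lborel K \<and> Q (volume_below n K s) = s) \<and>
     (\<forall>\<tau>. 0 < \<tau> \<longrightarrow> \<tau> < measure lborel K \<longrightarrow> lo < Q \<tau> \<and> Q \<tau> < hi \<and> volume_below n K (Q \<tau>) = \<tau> \<and>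
        (Q has_real_derivative inverse (enn2real (slice_area n K (Q \<tau>)))) (at \<tau>))"

text \<open>
  Every slice can be contracted towards an extreme point into the slice at \<open>s\<close>; if the latter had area
  0, all slices would, and so \<open>K\<close> would have volume 0.
\<close>

lemma slice_area_pos:
  fixes K :: "'a::euclidean_space set"
  assumes K: "compact K" "convex K" and n: "norm n = 1" and pos: "0 < emeasure lborel K"
    and p: "p \<in> K" "p \<bullet> n < s" and q: "q \<in> K" "s < q \<bullet> n"
  shows "0 < slice_area n K s"
proof (rule ccontr)
  assume "\<not> 0 < slice_area n K s"
  then have zero: "slice_area n K s = 0" by simp
  have Kb: "K \<in> sets borel" using K by (simp add: borel_compact)
  have step: "slice_area n K r = 0" if z: "z \<in> K" and "(s - r) / (z \<bullet> n - r) \<in> {0..<1}" "z \<bullet> n \<noteq> r" for r z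
  proof -
    define \<theta> where "\<theta> = (s - r) / (z \<bullet> n - r)"
    have \<theta>: "0 \<le> \<theta>" "\<theta> < 1" using that by (auto simp: \<theta>_def)
    have "\<theta> * (z \<bullet> n - r) = s - r" using that by (simp add: \<theta>_def)
    then have "(1 - \<theta>) * r + \<theta> * (z \<bullet> n) = s" by (simp add: algebra_simps)
    then have "ennreal ((1 - \<theta>) ^ DIM('a)) * slice_area n K r \<le> 0"
      using slice_area_towards[OF K(2) Kb n z \<theta>, of r] zero by simp
    then show ?thesis using \<theta> by (simp add: not_le)
  qed
  have "slice_area n K r = 0" for r
  proof (cases r s rule: linorder_cases)
    case less
    then show ?thesis using q by (intro step[of q]) (auto simp: divide_less_eq)
  next
    case greater
    then have "(s - r) / (p \<bullet> n - r) = (r - s) / (r - p \<bullet> n)" by (simp add: divide_simps) (simp add: algebra_simps)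
    then show ?thesis using p greater by (intro step[of p]) (auto simp: divide_less_eq)
  qed (use zero in simp)
  then show False using cavalieri[OF Kb n] pos by simp
qed

lemma is_quantile_exists:
  fixes K :: "'a::euclidean_space set"
  assumes K: "compact K" "convex K" and n: "norm n = 1" and pos: "0 < measure lborel K"
  obtains lo hi Q where "is_quantile n K lo hi Q"
proof -
  let ?\<phi> = "volume_below n K" and ?C = "measure lborel K" and ?a = "\<lambda>s. enn2real (slice_area n K s)"
  have pos': "0 < emeasure lborel K" using pos by (simp add: measure_def enn2real_positive_iff)
  have "K \<noteq> {}" using pos by auto
  have cont: "continuous_on K (\<lambda>x. x \<bullet> n)" by (intro continuous_intros)
  obtain p where p: "p \<in> K" "\<forall>x\<in>K. p \<bullet> n \<le> x \<bullet> n" using continuous_attains_inf[OF K(1) \<open>K \<noteq> {}\<close> cont] by blast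
  obtain q where q: "q \<in> K" "\<forall>x\<in>K. x \<bullet> n \<le> q \<bullet> n" using continuous_attains_sup[OF K(1) \<open>K \<noteq> {}\<close> cont] by blast
  define lo hi where "lo = p \<bullet> n" and "hi = q \<bullet> n"
  have n0: "n \<noteq> 0" using n by auto
  have hyp: "measure lborel (K \<inter> {x. x \<bullet> n = s}) = 0" for s
  proof -
    have "emeasure lborel (K \<inter> {x. x \<bullet> n = s}) \<le> emeasure lborel {x. x \<bullet> n = s}"
      by (intro emeasure_mono) auto
    then show ?thesis by (simp add: emeasure_hyperplane[OF n0] measure_def)
  qed
  have low: "?\<phi> s = 0" if "s \<le> lo" for s
  proof -
    have "K \<inter> {x. x \<bullet> n \<le> s} = (if s = lo then K \<inter> {x. x \<bullet> n = s} else {})"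
      using p that by (auto simp: lo_def)
    then show ?thesis using hyp[of s] by (simp add: volume_below_def split: if_splits)
  qed
  have high: "?\<phi> s = ?C" if "hi \<le> s" for s
  proof -
    have "K \<inter> {x. x \<bullet> n \<le> s} = K" using q that by (auto simp: hi_def)
    then show ?thesis by (simp add: volume_below_def)
  qed
  have "lo < hi" using low[of lo] high[of lo] pos by (cases "lo < hi") auto
  have D: "0 < ?a s" "(?\<phi> has_real_derivative ?a s) (at s)" if "lo < s" "s < hi" for s
  proof -
    have "0 < slice_area n K s" using that p q by (intro slice_area_pos[OF K n pos', of p _ q]) (auto simp: lo_def hi_def)
    then show "0 < ?a s" using slice_area_finite[OF K(1) n, of s] by (simp add: enn2real_positive_iff)
    show "(?\<phi> has_real_derivative ?a s) (at s)"
      using that p q by (intro volume_below_has_derivative[OF K n, of p _ q]) (auto simp: lo_def hi_def)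
  qed
  have mono: "?\<phi> u < ?\<phi> v" if "lo \<le> u" "u < v" "v \<le> hi" for u v
  proof (rule DERIV_pos_imp_increasing_open[OF that(2) _ continuous_volume_below[OF K(1) n]])
    fix x assume "u < x" "x < v"
    then have "lo < x" "x < hi" using that by simp_all
    then show "\<exists>y. (?\<phi> has_real_derivative y) (at x) \<and> 0 < y" using D by blast
  qed
  define Q where "Q \<tau> = (SOME s. lo < s \<and> s < hi \<and> ?\<phi> s = \<tau>)" for \<tau>
  have Q: "lo < Q \<tau>" "Q \<tau> < hi" "?\<phi> (Q \<tau>) = \<tau>" if \<tau>: "0 < \<tau>" "\<tau> < ?C" for \<tau>
  proof -
    obtain s where s: "lo \<le> s" "s \<le> hi" "?\<phi> s = \<tau>"
      using IVT'[of ?\<phi> lo \<tau> hi] low[of lo] high[of hi] \<tau> \<open>lo < hi\<close> continuous_volume_below[OF K(1) n] by auto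
    have "s \<noteq> lo" "s \<noteq> hi" using s \<tau> low[of lo] high[of hi] by auto
    then have "\<exists>s. lo < s \<and> s < hi \<and> ?\<phi> s = \<tau>" using s by (intro exI[of _ s]) auto
    from someI_ex[OF this] show "lo < Q \<tau>" "Q \<tau> < hi" "?\<phi> (Q \<tau>) = \<tau>" by (auto simp: Q_def)
  qed
  have range: "0 < ?\<phi> s" "?\<phi> s < ?C" if "lo < s" "s < hi" for s
    using mono[of lo s] mono[of s hi] that low[of lo] high[of hi] by auto
  have QI: "Q (?\<phi> s) = s" if s: "lo < s" "s < hi" for s
  proof (rule ccontr)
    assume "Q (?\<phi> s) \<noteq> s"
    then show False
      using mono[of s "Q (?\<phi> s)"] mono[of "Q (?\<phi> s)" s] Q[OF range[OF s]] s by (cases "s < Q (?\<phi> s)") auto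
  qed
  have DQ: "(Q has_real_derivative inverse (?a (Q \<tau>))) (at \<tau>)" if \<tau>: "0 < \<tau>" "\<tau> < ?C" for \<tau>
  proof (rule DERIV_inverse_function[where f="?\<phi>" and a=0 and b="?C"])
    show "(?\<phi> has_real_derivative ?a (Q \<tau>)) (at (Q \<tau>))" using D Q[OF \<tau>] by blast
    show "?a (Q \<tau>) \<noteq> 0" using D(1)[of "Q \<tau>"] Q[OF \<tau>] by simp
    show "?\<phi> (Q y) = y" if "0 < y" "y < ?C" for y using Q that by blast
    obtain u v where uv: "lo < u" "u < Q \<tau>" "Q \<tau> < v" "v < hi" using dense Q[OF \<tau>] by meson
    have "isCont Q (?\<phi> (Q \<tau>))"
    proof (rule isCont_inverse_function2[OF uv(2,3)])
      fix z assume z: "u \<le> z" "z \<le> v"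
      show "Q (?\<phi> z) = z" using z uv by (intro QI) auto
      show "isCont ?\<phi> z" using D(2)[of z] z uv by (intro DERIV_isCont) auto
    qed
    then show "isCont Q \<tau>" using Q[OF \<tau>] by simp
  qed (use \<tau> in auto)
  have "\<exists>p\<in>K. p \<bullet> n = hi" using q by (auto simp: hi_def)
  then show ?thesis
    by (intro that[of lo hi Q], unfold is_quantile_def)
       (use \<open>lo < hi\<close> p q low high D range QI Q DQ in \<open>auto simp: lo_def[symmetric] hi_def[symmetric]\<close>)
qed

lemma measure_midpoint:
  fixes K L M :: "'a::euclidean_space set"
  assumes "K \<in> sets borel" "L \<in> sets borel" "M \<in> sets borel"
    and fin: "bounded K" "bounded L" "bounded M"
    and mid: "\<And>x y. x \<in> K \<Longrightarrow> y \<in> L \<Longrightarrow> (1/2) *\<^sub>R (x + y) \<in> M"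
  shows "measure lborel K * measure lborel L \<le> (measure lborel M)\<^sup>2"
proof -
  have e: "emeasure lborel S = ennreal (measure lborel S)" if "bounded S" for S :: "'a set"
    using emeasure_bounded_finite[OF that] by (intro emeasure_eq_ennreal_measure) auto
  have "ennreal (measure lborel K * measure lborel L) \<le> ennreal ((measure lborel M)\<^sup>2)"
    using brunn_minkowski_midpoint[OF assms(1-3) mid] e[OF fin(1)] e[OF fin(2)] e[OF fin(3)]
    by (simp add: ennreal_mult ennreal_power)
  then show ?thesis by simp
qed

text \<open>
  The parts of \<open>K\<close> and \<open>K'\<close> below their \<open>\<tau>\<close>-quantiles have volume \<open>\<tau>\<close>, the parts above have volume \<open>C - \<tau>\<close>,
  and the midpoints of the two pairs are separated in \<open>M\<close> by the level \<open>m \<tau>\<close>. As the total volume is \<open>C\<close>,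
  the level \<open>m \<tau>\<close> is the \<open>\<tau>\<close>-quantile of \<open>M\<close>. Its derivative is the inverse of an area that is
  both the harmonic mean of the areas in \<open>K\<close> and \<open>K'\<close> and at least their geometric mean, so these areas are equal.
\<close>

lemma quantile_shift:
  fixes K K' M :: "'a::euclidean_space set"
  assumes K: "compact K" "convex K" and K': "compact K'" "convex K'" and M: "compact M" "convex M"
    and n: "norm n = 1" and C: "0 < C" and vol: "measure lborel K = C" "measure lborel K' = C" "measure lborel M = C"
    and mid: "\<And>x y. x \<in> K \<Longrightarrow> y \<in> K' \<Longrightarrow> (1/2) *\<^sub>R (x + y) \<in> M"
    and Q: "is_quantile n K lo hi Q" and Q': "is_quantile n K' lo' hi' Q'"
  shows "\<exists>k. \<forall>\<tau>. 0 < \<tau> \<longrightarrow> \<tau> < C \<longrightarrow> Q' \<tau> = Q \<tau> + k"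
proof -
  obtain lo'' hi'' Q'' where Q'': "is_quantile n M lo'' hi'' Q''"
    using is_quantile_exists[OF M n] vol(3) C by metis
  have [measurable]: "K \<in> sets borel" "K' \<in> sets borel" "M \<in> sets borel"
    using K K' M by (auto simp: borel_compact)
  have bd: "bounded (K \<inter> S)" "bounded (K' \<inter> S)" "bounded (M \<inter> S)" for S
    using K K' M by (auto intro: bounded_subset[OF compact_imp_bounded])
  define m where "m \<tau> = (Q \<tau> + Q' \<tau>) / 2" for \<tau>
  have m: "volume_below n M (m \<tau>) = \<tau>" if \<tau>: "0 < \<tau>" "\<tau> < C" for \<tau>
  proof -
    have q: "volume_below n K (Q \<tau>) = \<tau>" "volume_below n K' (Q' \<tau>) = \<tau>"
      using Q Q' \<tau> vol by (auto simp: is_quantile_def)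
    have "volume_below n K (Q \<tau>) * volume_below n K' (Q' \<tau>) \<le> (volume_below n M (m \<tau>))\<^sup>2"
      unfolding volume_below_def
    proof (rule measure_midpoint[OF _ _ _ bd])
      fix x y assume "x \<in> K \<inter> {x. x \<bullet> n \<le> Q \<tau>}" "y \<in> K' \<inter> {x. x \<bullet> n \<le> Q' \<tau>}"
      then show "(1/2) *\<^sub>R (x + y) \<in> M \<inter> {x. x \<bullet> n \<le> m \<tau>}"
        using mid by (auto simp: m_def inner_left_distrib intro!: divide_right_mono add_mono)
    qed auto
    then have "\<tau>\<^sup>2 \<le> (volume_below n M (m \<tau>))\<^sup>2" unfolding q by (simp add: power2_eq_square)
    then have 1: "\<tau> \<le> volume_below n M (m \<tau>)"
      by (rule power2_le_imp_le) (simp add: volume_below_def)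
    have "measure lborel (K \<inter> {x. Q \<tau> < x \<bullet> n}) * measure lborel (K' \<inter> {x. Q' \<tau> < x \<bullet> n})
        \<le> (measure lborel (M \<inter> {x. m \<tau> < x \<bullet> n}))\<^sup>2"
    proof (rule measure_midpoint[OF _ _ _ bd])
      fix x y assume "x \<in> K \<inter> {x. Q \<tau> < x \<bullet> n}" "y \<in> K' \<inter> {x. Q' \<tau> < x \<bullet> n}"
      then show "(1/2) *\<^sub>R (x + y) \<in> M \<inter> {x. m \<tau> < x \<bullet> n}"
        using mid by (auto simp: m_def inner_left_distrib intro!: divide_strict_right_mono add_strict_mono)
    qed auto
    then have "(C - \<tau>)\<^sup>2 \<le> (C - volume_below n M (m \<tau>))\<^sup>2"
      using K M K' by (simp add: volume_above q vol power2_eq_square)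
    moreover have "0 \<le> C - volume_below n M (m \<tau>)"
      using measure_nonneg[of lborel "M \<inter> {x. m \<tau> < x \<bullet> n}"] unfolding volume_above[OF M(1)] vol .
    ultimately have "C - \<tau> \<le> C - volume_below n M (m \<tau>)" by (rule power2_le_imp_le)
    with 1 show ?thesis by simp
  qed
  have "((\<lambda>\<tau>. Q' \<tau> - Q \<tau>) has_real_derivative 0) (at \<tau>)" if \<tau>: "0 < \<tau>" "\<tau> < C" for \<tau>
  proof -
    define a a' b where "a = enn2real (slice_area n K (Q \<tau>))" and "a' = enn2real (slice_area n K' (Q' \<tau>))"
      and "b = enn2real (slice_area n M (m \<tau>))"
    have a: "0 < a" "(Q has_real_derivative inverse a) (at \<tau>)"
      using Q \<tau> vol by (auto simp: is_quantile_def a_def)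
    have a': "0 < a'" "(Q' has_real_derivative inverse a') (at \<tau>)"
      using Q' \<tau> vol by (auto simp: is_quantile_def a'_def)
    have "lo'' < m \<tau>" "m \<tau> < hi''"
      using Q'' m[OF \<tau>] \<tau> vol unfolding is_quantile_def by (metis less_irrefl not_le)+
    then have b: "(volume_below n M has_real_derivative b) (at (m \<tau>))"
      using Q'' by (auto simp: is_quantile_def b_def)
    have "(m has_real_derivative (inverse a + inverse a') / 2) (at \<tau>)"
      unfolding m_def using a(2) a'(2) by (auto intro!: derivative_eq_intros)
    then have "((\<lambda>\<tau>. volume_below n M (m \<tau>)) has_real_derivative b * ((inverse a + inverse a') / 2)) (at \<tau>)"
      by (rule DERIV_chain2[where f="volume_below n M" and g=m, OF b])
    then have "((\<lambda>\<tau>. \<tau>) has_real_derivative b * ((inverse a + inverse a') / 2)) (at \<tau>)"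
      by (rule has_field_derivative_transform_within_open[where S="{0<..<C}"]) (use \<tau> m in auto)
    then have b1: "b * ((inverse a + inverse a') / 2) = 1" using DERIV_unique DERIV_ident by blast
    have "ennreal (a * a') \<le> ennreal (b\<^sup>2)"
    proof -
      have "slice_area n K (Q \<tau>) * slice_area n K' (Q' \<tau>) \<le> (slice_area n M ((Q \<tau> + Q' \<tau>) / 2))\<^sup>2"
        by (rule slice_area_midpoint) (auto intro: mid)
      then show ?thesis
        using slice_area_finite[OF K(1) n, of "Q \<tau>"] slice_area_finite[OF K'(1) n, of "Q' \<tau>"] slice_area_finite[OF M(1) n, of "m \<tau>"]
        by (simp add: a_def a'_def b_def m_def ennreal_mult flip: ennreal_power)
    qed
    then have ab: "a * a' \<le> b\<^sup>2" by simp
    have "b * (a + a') = 2 * (a * a')" using b1 a(1) a'(1) by (simp add: field_simps)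
    then have "(b * (a + a'))\<^sup>2 = (2 * (a * a'))\<^sup>2" by simp
    then have "b\<^sup>2 * (a + a')\<^sup>2 = 4 * (a * a') * (a * a')"
      unfolding power_mult_distrib by (simp add: power2_eq_square)
    also have "\<dots> \<le> 4 * (a * a') * b\<^sup>2" using ab a(1) a'(1) by (intro mult_left_mono) auto
    finally have "b\<^sup>2 * ((a + a')\<^sup>2 - 4 * (a * a')) \<le> 0" by (simp add: algebra_simps)
    moreover have "0 < b\<^sup>2" using less_le_trans[OF mult_pos_pos[OF a(1) a'(1)] ab] .
    ultimately have "(a + a')\<^sup>2 - 4 * (a * a') \<le> 0" by (simp add: mult_le_0_iff)
    moreover have "(a + a')\<^sup>2 - 4 * (a * a') = (a - a')\<^sup>2" by (simp add: power2_eq_square algebra_simps)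
    ultimately have "a = a'" by simp
    then show ?thesis using DERIV_diff[OF a'(2) a(2)] by simp
  qed
  then have "Q' \<tau> - Q \<tau> = Q' (C / 2) - Q (C / 2)" if "0 < \<tau>" "\<tau> < C" for \<tau>
    using that C by (intro DERIV_isconst3[of 0 C _ _ "\<lambda>\<tau>. Q' \<tau> - Q \<tau>"]) auto
  then show ?thesis by (intro exI[of _ "Q' (C / 2) - Q (C / 2)"]) (simp add: algebra_simps)
qed

lemma marginal_shift:
  fixes K K' M :: "'a::euclidean_space set"
  assumes K: "compact K" "convex K" and K': "compact K'" "convex K'" and M: "compact M" "convex M"
    and n: "norm n = 1" and C: "0 < C" and vol: "measure lborel K = C" "measure lborel K' = C" "measure lborel M = C"
    and mid: "\<And>x y. x \<in> K \<Longrightarrow> y \<in> K' \<Longrightarrow> (1/2) *\<^sub>R (x + y) \<in> M"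
    and Q: "is_quantile n K lo hi Q" and Q': "is_quantile n K' lo' hi' Q'"
  obtains k where "lo' = lo + k" "hi' = hi + k" "\<forall>s. volume_below n K' (s + k) = volume_below n K s"
proof -
  obtain k where k: "\<And>\<tau>. 0 < \<tau> \<Longrightarrow> \<tau> < C \<Longrightarrow> Q' \<tau> = Q \<tau> + k"
    using quantile_shift[OF assms] by blast
  have fwd: "lo' < s + k \<and> s + k < hi' \<and> volume_below n K' (s + k) = volume_below n K s" if "lo < s" "s < hi" for s
  proof -
    have \<tau>: "0 < volume_below n K s" "volume_below n K s < C" "Q (volume_below n K s) = s"
      using Q that vol by (auto simp: is_quantile_def)
    then have "Q' (volume_below n K s) = s + k" using k by simp
    then show ?thesis using Q' \<tau> vol unfolding is_quantile_def by metis
  qed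
  have bwd: "lo < s - k \<and> s - k < hi" if "lo' < s" "s < hi'" for s
  proof -
    have \<tau>: "0 < volume_below n K' s" "volume_below n K' s < C" "Q' (volume_below n K' s) = s"
      using Q' that vol by (auto simp: is_quantile_def)
    then have "Q (volume_below n K' s) = s - k" using k by simp
    then show ?thesis using Q \<tau> vol unfolding is_quantile_def by metis
  qed
  have lt: "lo < hi" "lo' < hi'" using Q Q' by (auto simp: is_quantile_def)
  have eq: "{lo + k<..<hi + k} = {lo'<..<hi'}"
  proof (intro set_eqI iffI)
    fix x assume "x \<in> {lo + k<..<hi + k}"
    then show "x \<in> {lo'<..<hi'}" using fwd[of "x - k"] by auto
  next
    fix x assume "x \<in> {lo'<..<hi'}"
    then show "x \<in> {lo + k<..<hi + k}" using bwd[of x] by auto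
  qed
  have hi: "hi' = hi + k"
    using arg_cong[OF eq, of Sup] lt by simp
  have lo: "lo' = lo + k"
    using arg_cong[OF eq, of Inf] lt by simp
  have "volume_below n K' (s + k) = volume_below n K s" for s
  proof -
    consider "s \<le> lo" | "lo < s" "s < hi" | "hi \<le> s" by linarith
    then show ?thesis
    proof cases
      case 1 then show ?thesis using Q Q' lo by (simp add: is_quantile_def)
    next
      case 2 then show ?thesis using fwd by blast
    next
      case 3 then show ?thesis using Q Q' hi vol by (simp add: is_quantile_def)
    qed
  qed
  then show ?thesis using that lo hi by blast
qed

definition moment :: "'a::euclidean_space set \<Rightarrow> 'a" where
  "moment K = (\<integral>x. indicator K x *\<^sub>R x \<partial>lborel)"

text \<open>
  Layer cake formula for the nonnegative function \<open>x \<bullet> n - lo\<close> on \<open>K\<close>.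
\<close>

lemma moment_layers:
  fixes K :: "'a::euclidean_space set"
  assumes K: "compact K" and lo: "\<forall>p\<in>K. lo \<le> p \<bullet> n"
  shows "0 \<le> moment K \<bullet> n - lo * measure lborel K"
    and "ennreal (moment K \<bullet> n - lo * measure lborel K)
      = (\<integral>\<^sup>+r. indicator {0<..} r * ennreal (measure lborel K - volume_below n K (lo + r)) \<partial>lborel)"
proof -
  have [measurable]: "K \<in> sets borel" using K by (rule borel_compact)
  have fin: "emeasure lborel (K \<inter> S) \<noteq> \<infinity>" for S
    using emeasure_mono[of "K \<inter> S" K lborel] emeasure_compact_finite[OF K] by (auto simp: top_unique)
  define g where "g x = indicator K x * (x \<bullet> n - lo)" for x
  have g0: "0 \<le> g x" for x using lo by (simp add: g_def indicator_def)
  have int1: "integrable lborel (\<lambda>x. indicator K x *\<^sub>R x)"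
    by (rule borel_integrable_compact[OF K continuous_on_id])
  have int2: "integrable lborel (\<lambda>x. lo * indicator K x)"
    using fin[of UNIV] by (intro integrable_mult_right integrable_real_indicator) (auto simp: less_top)
  have geq: "g = (\<lambda>x. (indicator K x *\<^sub>R x) \<bullet> n - lo * indicator K x)"
    by (auto simp: g_def algebra_simps)
  have gint: "integrable lborel g" unfolding geq using int1 int2 by (intro Bochner_Integration.integrable_diff integrable_inner_left) auto
  have geval: "(\<integral>x. g x \<partial>lborel) = moment K \<bullet> n - lo * measure lborel K"
  proof -
    have i1: "integrable lborel (\<lambda>x. (indicator K x *\<^sub>R x) \<bullet> n)"
      by (rule integrable_inner_left) (rule int1)
    have "(\<integral>x. (indicator K x *\<^sub>R x) \<bullet> n \<partial>lborel) = moment K \<bullet> n"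
      unfolding moment_def by (rule integral_inner_left) (rule int1)
    moreover have "(\<integral>x. lo * indicator K x \<partial>lborel) = lo * measure lborel K" by simp
    ultimately show ?thesis unfolding geq Bochner_Integration.integral_diff[OF i1 int2] by simp
  qed
  show "0 \<le> moment K \<bullet> n - lo * measure lborel K"
    unfolding geval[symmetric] by (rule Bochner_Integration.integral_nonneg) (rule g0)
  have "ennreal (moment K \<bullet> n - lo * measure lborel K) = (\<integral>\<^sup>+x. ennreal (g x) \<partial>lborel)"
    unfolding geval[symmetric] using g0 by (intro nn_integral_eq_integral[symmetric] gint) auto
  also have "\<dots> = (\<integral>\<^sup>+r. indicator {0<..} r * emeasure lborel {x. ennreal r < ennreal (g x)} \<partial>lborel)"
    by (rule nn_integral_layers) (use gint in auto)
  also have "\<dots> = (\<integral>\<^sup>+r. indicator {0<..} r * ennreal (measure lborel K - volume_below n K (lo + r)) \<partial>lborel)"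
  proof (rule nn_integral_cong)
    fix r :: real
    show "indicator {0<..} r * emeasure lborel {x. ennreal r < ennreal (g x)}
      = indicator {0<..} r * ennreal (measure lborel K - volume_below n K (lo + r))"
    proof (cases "0 < r")
      case True
      have "{x. ennreal r < ennreal (g x)} = K \<inter> {x. lo + r < x \<bullet> n}"
        using True by (auto simp: ennreal_less_iff g_def indicator_def split: if_splits)
      moreover have "emeasure lborel (K \<inter> {x. lo + r < x \<bullet> n}) = ennreal (measure lborel (K \<inter> {x. lo + r < x \<bullet> n}))"
        using fin by (intro emeasure_eq_ennreal_measure) auto
      ultimately show ?thesis by (simp add: volume_above[OF K])
    qed simp
  qed
  finally show "ennreal (moment K \<bullet> n - lo * measure lborel K)
      = (\<integral>\<^sup>+r. indicator {0<..} r * ennreal (measure lborel K - volume_below n K (lo + r)) \<partial>lborel)" .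
qed

text \<open>
  The shift of the quantiles shifts the mean of \<open>x \<bullet> n\<close> by the same amount. Unlike the maxima, the
  means are linear in \<open>n\<close>.
\<close>

lemma support_shift:
  fixes K K' M :: "'a::euclidean_space set"
  assumes K: "compact K" "convex K" and K': "compact K'" "convex K'" and M: "compact M" "convex M"
    and n: "norm n = 1" and C: "0 < C" and vol: "measure lborel K = C" "measure lborel K' = C" "measure lborel M = C"
    and mid: "\<And>x y. x \<in> K \<Longrightarrow> y \<in> K' \<Longrightarrow> (1/2) *\<^sub>R (x + y) \<in> M"
    and p: "p \<in> K" "\<forall>x\<in>K. x \<bullet> n \<le> p \<bullet> n" and p': "p' \<in> K'" "\<forall>x\<in>K'. x \<bullet> n \<le> p' \<bullet> n"
  shows "C * (p' \<bullet> n - p \<bullet> n) = (moment K' - moment K) \<bullet> n"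
proof -
  obtain lo hi Q where Q: "is_quantile n K lo hi Q" using is_quantile_exists[OF K n] vol C by metis
  obtain lo' hi' Q' where Q': "is_quantile n K' lo' hi' Q'" using is_quantile_exists[OF K' n] vol C by metis
  obtain k where k: "lo' = lo + k" "hi' = hi + k" "\<forall>s. volume_below n K' (s + k) = volume_below n K s"
    by (rule marginal_shift[OF K K' M n C vol mid Q Q'])
  have "p \<bullet> n = hi" using Q p by (auto simp: is_quantile_def intro: antisym)
  moreover have "p' \<bullet> n = hi'" using Q' p' by (auto simp: is_quantile_def intro: antisym)
  ultimately have pk: "p' \<bullet> n - p \<bullet> n = k" using k by simp
  have lo: "\<forall>p\<in>K. lo \<le> p \<bullet> n" "\<forall>p\<in>K'. lo' \<le> p \<bullet> n" using Q Q' by (auto simp: is_quantile_def)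
  note L = moment_layers[OF K(1) lo(1)] and L' = moment_layers[OF K'(1) lo(2)]
  have "volume_below n K' (lo' + r) = volume_below n K (lo + r)" for r
    using k(3)[rule_format, of "lo + r"] by (simp add: k(1) ac_simps)
  then have "ennreal (moment K' \<bullet> n - lo' * C) = ennreal (moment K \<bullet> n - lo * C)"
    using L(2) L'(2) by (simp add: vol)
  then have "moment K' \<bullet> n - lo' * C = moment K \<bullet> n - lo * C"
    using L(1) L'(1) by (simp add: vol)
  then show ?thesis unfolding pk by (simp add: k(1) inner_diff_left algebra_simps)
qed

text \<open>
  The cell of the mean heights contains the midpoints of the two cells and has the same volume by
  maximality. The heights of a maximizer are the maxima of \<open>p \<bullet> v i\<close> by \<open>optimal_tight\<close>, so they
  differ by the linear function of \<open>v i\<close> found in \<open>support_shift\<close>.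
\<close>

theorem optimal_unique:
  fixes v :: "'i \<Rightarrow> 'a::euclidean_space"
  assumes I: "finite I" and rec: "no_recession I v" and C: "0 < C" and v: "\<And>i. i \<in> I \<Longrightarrow> v i \<noteq> 0"
    and le: "\<And>c. 0 < (\<Sum>i\<in>I. c i) \<Longrightarrow> measure lborel (cell I v c) \<le> C * (\<Sum>i\<in>I. c i) ^ DIM('a)"
    and c: "(\<Sum>i\<in>I. c i) = 1" "measure lborel (cell I v c) = C"
    and c': "(\<Sum>i\<in>I. c' i) = 1" "measure lborel (cell I v c') = C"
  obtains t where "\<forall>i\<in>I. c' i = c i + t \<bullet> v i"
proof -
  define b where "b i = (c i + c' i) / 2" for i
  have K: "compact (cell I v c)" for c by (rule compact_cell[OF I rec])
  have mid: "(1/2) *\<^sub>R (x + y) \<in> cell I v b" if "x \<in> cell I v c" "y \<in> cell I v c'" for x y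
    using cell_midpoint[OF that] by (simp add: b_def[abs_def])
  have "(\<Sum>i\<in>I. b i) = 1" using c c' by (simp add: b_def sum.distrib flip: sum_divide_distrib)
  then have "measure lborel (cell I v b) \<le> C" using le[of b] by simp
  moreover have "measure lborel (cell I v c) * measure lborel (cell I v c') \<le> (measure lborel (cell I v b))\<^sup>2"
    by (intro measure_midpoint cell_borel compact_imp_bounded[OF K] mid)
  then have "C\<^sup>2 \<le> (measure lborel (cell I v b))\<^sup>2" unfolding c c' power2_eq_square[of C] .
  then have "C \<le> measure lborel (cell I v b)" by (rule power2_le_imp_le) simp
  ultimately have b: "measure lborel (cell I v b) = C" by simp
  define t where "t = (1 / C) *\<^sub>R (moment (cell I v c') - moment (cell I v c))"
  have "c' i = c i + t \<bullet> v i" if i: "i \<in> I" for i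
  proof -
    obtain p where p: "p \<in> cell I v c" "p \<bullet> v i = c i"
      by (rule optimal_tight[OF I rec C le c(1) zero_less_one _ i]) (use c in auto)
    obtain p' where p': "p' \<in> cell I v c'" "p' \<bullet> v i = c' i"
      by (rule optimal_tight[OF I rec C le c'(1) zero_less_one _ i]) (use c' in auto)
    have n: "norm (sgn (v i)) = 1" using v[OF i] by (simp add: norm_sgn)
    have L: "0 < norm (v i)" using v[OF i] by simp
    note sg = inner_sgn[OF v[OF i]]
    have up: "\<forall>x\<in>cell I v c. x \<bullet> sgn (v i) \<le> p \<bullet> sgn (v i)"
    proof
      fix x assume "x \<in> cell I v c"
      then have "x \<bullet> v i \<le> p \<bullet> v i" using i p by (simp add: mem_cell)
      then show "x \<bullet> sgn (v i) \<le> p \<bullet> sgn (v i)" unfolding sg[of x] sg[of p] using L by simp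
    qed
    have up': "\<forall>x\<in>cell I v c'. x \<bullet> sgn (v i) \<le> p' \<bullet> sgn (v i)"
    proof
      fix x assume "x \<in> cell I v c'"
      then have "x \<bullet> v i \<le> p' \<bullet> v i" using i p' by (simp add: mem_cell)
      then show "x \<bullet> sgn (v i) \<le> p' \<bullet> sgn (v i)" unfolding sg[of x] sg[of p'] using L by simp
    qed
    have S: "C * (p' \<bullet> sgn (v i) - p \<bullet> sgn (v i)) = (moment (cell I v c') - moment (cell I v c)) \<bullet> sgn (v i)"
      by (rule support_shift[OF K convex_cell K convex_cell K convex_cell n C c(2) c'(2) b mid p(1) up p'(1) up'])
    have "c' i - c i = norm (v i) * (p' \<bullet> sgn (v i) - p \<bullet> sgn (v i))"
      unfolding p(2)[symmetric] p'(2)[symmetric] sg[of p] sg[of p'] by (simp add: right_diff_distrib)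
    also have "p' \<bullet> sgn (v i) - p \<bullet> sgn (v i) = t \<bullet> sgn (v i)"
      unfolding t_def inner_scaleR_left S[symmetric] using C by simp
    also have "norm (v i) * (t \<bullet> sgn (v i)) = t \<bullet> v i" by (rule sg[symmetric])
    finally show ?thesis by simp
  qed
  then show ?thesis using that by blast
qed

section \<open>Extremal polyhedra\<close>

text \<open>
  Equality in \<open>emeasure_cell_bound\<close> between positive real numbers.
\<close>

definition extremal :: "'i set \<Rightarrow> ('i \<Rightarrow> 'a::euclidean_space) \<Rightarrow> ('i \<Rightarrow> real) \<Rightarrow> bool" where
  "extremal I v c \<longleftrightarrow> polyhedron_const I v < \<infinity> \<and> 0 < (\<Sum>i\<in>I. c i) \<and>
     emeasure lborel (cell I v c) = polyhedron_const I v * ennreal ((\<Sum>i\<in>I. c i) ^ DIM('a))"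

text \<open>
  If the sum of the heights is not positive, the cell has volume 0, since a point with strict inequalities
  would give \<open>\<Sum>i\<in>I. c i > p \<bullet> (\<Sum>i\<in>I. v i) = 0\<close>.
\<close>

lemma emeasure_cell_bound:
  fixes v :: "'i \<Rightarrow> 'a::euclidean_space"
  assumes I: "finite I" "I \<noteq> {}" and v: "\<And>i. i \<in> I \<Longrightarrow> v i \<noteq> 0" and fin: "polyhedron_const I v < \<infinity>"
  shows "emeasure lborel (cell I v c) \<le> polyhedron_const I v * ennreal (max 0 (\<Sum>i\<in>I. c i) ^ DIM('a))"
proof (cases "0 < (\<Sum>i\<in>I. c i)")
  case True
  then show ?thesis using polyhedron_const_ge[OF refl True, of v] by simp
next
  case False
  have "\<not> 0 < emeasure lborel (cell I v c)"
  proof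
    assume pos: "0 < emeasure lborel (cell I v c)"
    obtain p where p: "\<forall>i\<in>I. p \<bullet> v i < c i" by (rule cell_strict_point[OF I(1) v pos])
    have "0 < (\<Sum>i\<in>I. c i - p \<bullet> v i)" using I p by (intro sum_pos) auto
    also have "\<dots> = (\<Sum>i\<in>I. c i)"
      using polyhedron_const_finite_imp(2)[OF I fin] by (simp add: sum_subtractf flip: inner_sum_right)
    finally show False using False by simp
  qed
  then show ?thesis by simp
qed

lemma polyhedron_const_real:
  fixes v :: "'i \<Rightarrow> 'a::euclidean_space"
  assumes I: "finite I" "I \<noteq> {}" and fin: "polyhedron_const I v < \<infinity>"
  obtains C where "0 < C" "polyhedron_const I v = ennreal C"
    "\<forall>c. 0 < (\<Sum>i\<in>I. c i) \<longrightarrow> measure lborel (cell I v c) \<le> C * (\<Sum>i\<in>I. c i) ^ DIM('a)"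
proof -
  obtain C where C: "polyhedron_const I v = ennreal C" "0 < C"
    using fin polyhedron_const_pos[OF I, of v] by (cases "polyhedron_const I v") auto
  have "measure lborel (cell I v c) \<le> C * (\<Sum>i\<in>I. c i) ^ DIM('a)" if s: "0 < (\<Sum>i\<in>I. c i)" for c
  proof -
    have "emeasure lborel (cell I v c) \<le> ennreal (C * (\<Sum>i\<in>I. c i) ^ DIM('a))"
      using polyhedron_const_ge[OF refl s, of v] C s by (simp add: ennreal_mult)
    then show ?thesis using C s by (simp add: measure_def enn2real_leI)
  qed
  then show ?thesis using that C by blast
qed

lemma extremal_measure:
  fixes v :: "'i \<Rightarrow> 'a::euclidean_space"
  assumes "extremal I v c" "polyhedron_const I v = ennreal C" "0 < C"
  shows "measure lborel (cell I v c) = C * (\<Sum>i\<in>I. c i) ^ DIM('a)"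
  using assms by (simp add: extremal_def measure_def flip: ennreal_mult)

lemma face_eq_slice:
  assumes "p \<in> P" "p \<bullet> n = m" "\<forall>q\<in>P. q \<bullet> n \<le> m"
  shows "face_with_normal P n = P \<inter> {x. x \<bullet> n = m}"
  using assms by (auto simp: face_with_normal_def intro: antisym)

lemma slice_area_face:
  assumes n: "norm n = 1"
  shows "slice_area n (P \<inter> {x. x \<bullet> n = m}) m = slice_area n P m"
  using slice_area_Int_eq[OF n, of P "{m}" m] by simp

lemma hausdorff_measure_empty: "hausdorff_measure s ({} :: 'a::metric_space set) = 0"
proof -
  have "hausdorff_premeasure s \<delta> ({} :: 'a set) \<le> 0" if "0 < \<delta>" for \<delta>
    using hausdorff_premeasure_le[of "{} :: 'a set" "\<lambda>_. {}" \<delta> s] that by (simp add: hausdorff_weight_def)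
  then show ?thesis by (simp add: hausdorff_measure_def)
qed

theorem extremal_facet_areas:
  fixes v :: "'i \<Rightarrow> 'a::euclidean_space"
  assumes I: "finite I" "I \<noteq> {}" and v: "\<And>i. i \<in> I \<Longrightarrow> v i \<noteq> 0" and inj: "inj_on (\<lambda>i. sgn (v i)) I"
    and ext: "extremal I v c" and C: "polyhedron_const I v = ennreal C" and i: "i \<in> I"
  shows "hausdorff_measure (DIM('a) - 1) (face_with_normal (cell I v c) (sgn (v i)))
    = ennreal (real DIM('a) * C * (\<Sum>i\<in>I. c i) ^ (DIM('a) - 1) * norm (v i))"
proof -
  let ?P = "cell I v c" and ?n = "sgn (v i)" and ?m = "c i / norm (v i)"
  have fin: "polyhedron_const I v < \<infinity>" and s: "0 < (\<Sum>i\<in>I. c i)" using ext by (auto simp: extremal_def)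
  have rec: "no_recession I v" using polyhedron_const_finite_imp[OF I fin] by blast
  obtain C' where C': "0 < C'" "polyhedron_const I v = ennreal C'"
    and le: "\<forall>c. 0 < (\<Sum>i\<in>I. c i) \<longrightarrow> measure lborel (cell I v c) \<le> C' * (\<Sum>i\<in>I. c i) ^ DIM('a)"
    by (rule polyhedron_const_real[OF I fin])
  have CC: "C = C'" using C C' by (metis ennreal_inj ennreal_neg less_imp_le not_le order_refl ennreal_eq_0_iff not_less)
  have eq: "measure lborel ?P = C' * (\<Sum>i\<in>I. c i) ^ DIM('a)" by (rule extremal_measure[OF ext C'(2,1)])
  have n: "norm ?n = 1" using v[OF i] by (simp add: norm_sgn)
  have L: "0 < norm (v i)" using v[OF i] by simp
  have vn: "x \<bullet> v i = norm (v i) * (x \<bullet> ?n)" for x by (rule inner_sgn[OF v[OF i]])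
  obtain p where p: "p \<in> ?P" "p \<bullet> v i = c i"
    by (rule optimal_tight[OF I(1) rec C'(1) _ refl s eq i]) (use le in blast)
  have face: "face_with_normal ?P ?n = ?P \<inter> {x. x \<bullet> ?n = ?m}"
  proof (rule face_eq_slice[OF p(1)])
    show "p \<bullet> ?n = ?m" using p(2) L unfolding vn by (simp add: field_simps)
    show "\<forall>q\<in>?P. q \<bullet> ?n \<le> ?m"
    proof
      fix q assume "q \<in> ?P"
      then have "q \<bullet> v i \<le> c i" using i by (simp add: mem_cell)
      then show "q \<bullet> ?n \<le> ?m" using L unfolding vn by (simp add: pos_le_divide_eq mult.commute)
    qed
  qed
  have "hausdorff_measure (DIM('a) - 1) (face_with_normal ?P ?n) = slice_area ?n ?P ?m"
  proof -
    have "closed {x. x \<bullet> ?n = ?m}" using closed_hyperplane[of ?n ?m] by (simp only: inner_commute)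
    then have "compact (?P \<inter> {x. x \<bullet> ?n = ?m})" by (intro compact_Int_closed compact_cell[OF I(1) rec])
    from hausdorff_measure_compact_slice[OF this _ n, of ?m] show ?thesis
      unfolding face by (simp add: slice_area_face[OF n])
  qed
  also have "\<dots> = ennreal (enn2real (slice_area ?n ?P ?m))"
    using slice_area_finite[OF compact_cell[OF I(1) rec] n] by simp
  also have "enn2real (slice_area ?n ?P ?m) = real DIM('a) * C * (\<Sum>i\<in>I. c i) ^ (DIM('a) - 1) * norm (v i)"
    using optimal_facet_area[OF I(1) rec C'(1) v inj _ refl s eq i] le L by (simp add: CC field_simps)
  finally show ?thesis .
qed

text \<open>
  Positive finite areas make the cell bounded with nonempty interior. Then every facet is active
  at its height, and the assumption says that all partial derivatives of the volume equal \<open>\<alpha>\<close>.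
\<close>

theorem extremal_of_proportional_facets:
  fixes v :: "'i \<Rightarrow> 'a::euclidean_space"
  assumes I: "finite I" "I \<noteq> {}" and v: "\<And>i. i \<in> I \<Longrightarrow> v i \<noteq> 0" and inj: "inj_on (\<lambda>i. sgn (v i)) I"
    and \<alpha>: "0 < \<alpha>"
    and H: "\<And>i. i \<in> I \<Longrightarrow> hausdorff_measure (DIM('a) - 1) (face_with_normal (cell I v c) (sgn (v i))) = ennreal (\<alpha> * norm (v i))"
    and nd: "2 \<le> DIM('a) \<or> 0 < emeasure lborel (cell I v c) \<and> emeasure lborel (cell I v c) < \<infinity>"
  shows "extremal I v c"
proof -
  let ?P = "cell I v c"
  have n: "norm (sgn (v i)) = 1" if "i \<in> I" for i using v[OF that] by (simp add: norm_sgn)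
  have "\<exists>m. face_with_normal ?P (sgn (v i)) = ?P \<inter> {x. x \<bullet> sgn (v i) = m} \<and> (\<forall>p\<in>?P. p \<bullet> sgn (v i) \<le> m)" if i: "i \<in> I" for i
  proof -
    have "face_with_normal ?P (sgn (v i)) \<noteq> {}"
      using H[OF i] \<alpha> v[OF i] hausdorff_measure_empty[where 'a='a] by (auto simp: ennreal_eq_0_iff mult_le_0_iff)
    then obtain p where p: "p \<in> face_with_normal ?P (sgn (v i))" by blast
    then show ?thesis
      by (intro exI[of _ "p \<bullet> sgn (v i)"] conjI face_eq_slice[of p]) (auto simp: face_with_normal_def)
  qed
  then obtain m where m: "\<And>i. i \<in> I \<Longrightarrow> face_with_normal ?P (sgn (v i)) = ?P \<inter> {x. x \<bullet> sgn (v i) = m i}"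
      "\<And>i p. i \<in> I \<Longrightarrow> p \<in> ?P \<Longrightarrow> p \<bullet> sgn (v i) \<le> m i"
    by metis
  have closed: "closed (?P \<inter> {x. x \<bullet> sgn (v i) = m i})" for i
    using closed_hyperplane[of "sgn (v i)" "m i"] by (intro closed_Int closed_cell) (simp add: inner_commute)
  have fin: "slice_area (sgn (v i)) ?P (m i) < \<infinity>" if i: "i \<in> I" for i
    using slice_area_le_hausdorff[OF n[OF i], of "?P \<inter> {x. x \<bullet> sgn (v i) = m i}" "m i"] H[OF i]
    by (simp add: m(1)[OF i] slice_area_face[OF n[OF i]] less_top[symmetric] top_unique) (metis ennreal_neq_top top_unique)
  have pos: "0 < slice_area (sgn (v i)) ?P (m i)" if i: "i \<in> I" for i
  proof (rule ccontr)
    assume "\<not> 0 < slice_area (sgn (v i)) ?P (m i)"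
    then have "hausdorff_measure (DIM('a) - 1) (?P \<inter> {x. x \<bullet> sgn (v i) = m i}) = 0"
      by (intro hausdorff_measure_null_slice[OF closed _ n[OF i]]) (auto simp: slice_area_face[OF n[OF i]])
    then show False using H[OF i] \<alpha> v[OF i] by (simp add: m(1)[OF i] zero_less_mult_iff)
  qed
  have rec: "no_recession I v" and vpos: "0 < emeasure lborel ?P"
    using nd finite_facets_nondegenerate[of I v c m, OF _ I v pos fin] no_recession_of_finite_volume[of I v c] by blast+
  obtain p0 where p0: "\<forall>i\<in>I. p0 \<bullet> v i < c i" by (rule cell_strict_point[OF I(1) v vpos])
  define V where "V c = measure lborel (cell I v c)" for c
  have eV: "emeasure lborel (cell I v c) = ennreal (V c)" for c
    using emeasure_compact_finite[OF compact_cell[OF I(1) rec, of c]] unfolding V_def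
    by (intro emeasure_eq_ennreal_measure) auto
  have Vpos: "0 < V c" using vpos by (simp add: eV)
  have D: "((\<lambda>t. V (c(i := c i + t))) has_real_derivative \<alpha>) (at 0)" if i: "i \<in> I" for i
  proof -
    note F = facet_of_positive_area[OF I(1) v inj i bspec[OF p0] m(2)[OF i] pos[OF i]]
    obtain q where q: "q \<in> cell I v (c(i := c i + 1))" "c i < q \<bullet> v i" using F(2) by blast
    have "compact (?P \<inter> {x. x \<bullet> sgn (v i) = m i})"
      using closed_Int_compact[OF closed[of i] compact_cell[OF I(1) rec, of c]] by (simp add: Int_ac)
    from hausdorff_measure_compact_slice[OF this _ n[OF i], of "m i"]
    have "hausdorff_measure (DIM('a) - 1) (?P \<inter> {x. x \<bullet> sgn (v i) = m i}) = slice_area (sgn (v i)) ?P (m i)"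
      by (simp add: slice_area_face[OF n[OF i]])
    then have "slice_area (sgn (v i)) ?P (m i) = ennreal (\<alpha> * norm (v i))" using H[OF i] m(1)[OF i] by simp
    moreover have "p0 \<in> ?P" using p0 by (simp add: mem_cell less_imp_le)
    ultimately show ?thesis
      using facet_derivative[OF I(1) rec i v[OF i] _ bspec[OF p0 i] q] \<alpha> v[OF i] by (simp add: V_def F(1))
  qed
  note E = equal_densities_optimal[OF I(1) rec Vpos[unfolded V_def] \<alpha> D[unfolded V_def], folded V_def]
  define S where "S = (\<Sum>i\<in>I. c i)"
  have S: "0 < S" using E(2) by (simp add: S_def)
  have le: "polyhedron_const I v \<le> ennreal (V c / S ^ DIM('a))"
  proof (rule polyhedron_const_least)
    fix b :: "'i \<Rightarrow> real" assume b: "(\<Sum>i\<in>I. b i) = 1"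
    have "V (\<lambda>i. S * b i) \<le> V c" using E(3)[of "\<lambda>i. S * b i"] b by (simp add: S_def V_def flip: sum_distrib_left)
    moreover have "ennreal (V (\<lambda>i. S * b i)) = ennreal (S ^ DIM('a) * V b)"
      using emeasure_cell_scale[OF S, of I v b] S by (simp add: eV ennreal_mult V_def)
    then have "V (\<lambda>i. S * b i) = S ^ DIM('a) * V b" using S by (simp add: V_def)
    ultimately have "V b \<le> V c / S ^ DIM('a)" using S by (simp add: pos_le_divide_eq mult.commute)
    then show "emeasure lborel (cell I v b) \<le> ennreal (V c / S ^ DIM('a))" unfolding eV by (rule ennreal_leI)
  qed
  have "polyhedron_const I v * ennreal (S ^ DIM('a)) \<le> ennreal (V c / S ^ DIM('a)) * ennreal (S ^ DIM('a))"
    using le by (rule mult_right_mono) simp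
  also have "\<dots> = emeasure lborel ?P" using S Vpos by (simp add: eV flip: ennreal_mult)
  finally have "polyhedron_const I v * ennreal (S ^ DIM('a)) \<le> emeasure lborel ?P" .
  moreover have "emeasure lborel ?P \<le> polyhedron_const I v * ennreal (S ^ DIM('a))"
    by (rule polyhedron_const_ge) (use S S_def in auto)
  moreover have "polyhedron_const I v < \<infinity>" using le by (simp add: less_top[symmetric]) (metis ennreal_neq_top top_unique)
  ultimately show ?thesis using S by (auto simp: extremal_def S_def)
qed

text \<open>
  Two different directions on a line are opposite. From \<open>p\<close>, at which some inequality \<open>i\<close> is strict, a
  step in direction \<open>v i\<close> therefore makes all the others strict.
\<close>

lemma line_cell_nondegenerate:
  fixes v :: "'i \<Rightarrow> 'a::euclidean_space"
  assumes d: "DIM('a) = 1" and I: "finite I" and v: "\<And>i. i \<in> I \<Longrightarrow> v i \<noteq> 0" and inj: "inj_on (\<lambda>i. sgn (v i)) I"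
    and sum0: "(\<Sum>i\<in>I. v i) = 0" and s: "(\<Sum>i\<in>I. c i) \<noteq> 0" and p: "p \<in> cell I v c"
  shows "0 < emeasure lborel (cell I v c)"
proof -
  obtain b :: 'a where b: "Basis = {b}" using d card_1_singletonE by metis
  have rep: "x = (x \<bullet> b) *\<^sub>R b" for x using euclidean_representation[of x] by (simp add: b)
  have inn: "x \<bullet> y = (x \<bullet> b) * (y \<bullet> b)" for x y by (subst rep[of x]) (simp add: inner_commute)
  have opp: "v j \<bullet> v i < 0" if ij: "i \<in> I" "j \<in> I" "i \<noteq> j" for i j
  proof (rule ccontr)
    assume "\<not> v j \<bullet> v i < 0"
    then have ge: "0 \<le> (v j \<bullet> b) * (v i \<bullet> b)" using inn[of "v j" "v i"] by simp
    have "v i \<bullet> b \<noteq> 0" "v j \<bullet> b \<noteq> 0" using v ij rep by (metis scaleR_zero_left)+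
    then have "sgn (v j \<bullet> b) = sgn (v i \<bullet> b)" using ge by (auto simp: zero_le_mult_iff sgn_if)
    then have "sgn (v j) = sgn (v i)" using rep[of "v j"] rep[of "v i"] by (metis sgn_scaleR)
    then show False using inj ij by (auto dest: inj_onD)
  qed
  have "(\<Sum>i\<in>I. c i - p \<bullet> v i) = (\<Sum>i\<in>I. c i)" using sum0 by (simp add: sum_subtractf flip: inner_sum_right)
  then have nz: "(\<Sum>i\<in>I. c i - p \<bullet> v i) \<noteq> 0" using s by simp
  have "\<exists>i\<in>I. c i - p \<bullet> v i \<noteq> 0"
  proof (rule ccontr)
    assume "\<not> ?thesis"
    then have "(\<Sum>i\<in>I. c i - p \<bullet> v i) = 0" by (intro sum.neutral) blast
    then show False using nz by contradiction
  qed
  then obtain i where i1: "i \<in> I" "c i - p \<bullet> v i \<noteq> 0" by blast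
  moreover have "p \<bullet> v i \<le> c i" using p i1(1) by (simp add: mem_cell)
  ultimately have i: "i \<in> I" "p \<bullet> v i < c i" by simp_all
  \<comment> \<open>The step uses up half of the slack at i.\<close>
  define e where "e = (c i - p \<bullet> v i) / (2 * (v i \<bullet> v i))"
  have vv: "0 < v i \<bullet> v i" using v[OF i(1)] by simp
  have e: "0 < e" "e * (v i \<bullet> v i) = (c i - p \<bullet> v i) / 2" using i vv by (simp_all add: e_def)
  have "(p + e *\<^sub>R v i) \<bullet> v j < c j" if j: "j \<in> I" for j
  proof (cases "j = i")
    case True
    then show ?thesis using e i by (simp add: inner_left_distrib field_simps)
  next
    case False
    then have "e * (v i \<bullet> v j) < 0" using opp[of j i] i j e by (simp add: mult_pos_neg)
    moreover have "p \<bullet> v j \<le> c j" using p j by (simp add: mem_cell)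
    ultimately show ?thesis by (simp add: inner_left_distrib)
  qed
  then show ?thesis by (rule emeasure_cell_strict_point[OF I])
qed

lemma extremal_exists_iff:
  fixes v :: "'i \<Rightarrow> 'a::euclidean_space"
  assumes I: "finite I" "I \<noteq> {}"
  shows "(\<exists>c. extremal I v c) \<longleftrightarrow> span (v ` I) = UNIV \<and> (\<Sum>i\<in>I. v i) = 0"
proof
  assume "\<exists>c. extremal I v c"
  then have "polyhedron_const I v < \<infinity>" by (auto simp: extremal_def)
  then show "span (v ` I) = UNIV \<and> (\<Sum>i\<in>I. v i) = 0"
    using polyhedron_const_finite_imp[OF I, of v] span_of_no_recession[of I v] by blast
next
  assume *: "span (v ` I) = UNIV \<and> (\<Sum>i\<in>I. v i) = 0"
  then have "no_recession I v" using no_recession_of_span[OF I(1)] by blast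
  then obtain c where "(\<Sum>i\<in>I. c i) = 1" "emeasure lborel (cell I v c) = polyhedron_const I v" "polyhedron_const I v < \<infinity>"
    by (rule polyhedron_const_attained[OF I]) (use * in auto)
  then show "\<exists>c. extremal I v c" unfolding extremal_def by (intro exI[of _ c]) simp
qed

text \<open>
  Both maximizers are scaled to heights with sum one.
\<close>

lemma extremal_unique:
  fixes v :: "'i \<Rightarrow> 'a::euclidean_space"
  assumes I: "finite I" "I \<noteq> {}" and v: "\<And>i. i \<in> I \<Longrightarrow> v i \<noteq> 0"
    and c: "extremal I v c" and c': "extremal I v c'"
  obtains t where "\<forall>i\<in>I. c i = (\<Sum>i\<in>I. c i) / (\<Sum>i\<in>I. c' i) * c' i + t \<bullet> v i"
proof -
  have fin: "polyhedron_const I v < \<infinity>" and s: "0 < (\<Sum>i\<in>I. c i)" "0 < (\<Sum>i\<in>I. c' i)"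
    using c c' by (auto simp: extremal_def)
  obtain C where C: "0 < C" "polyhedron_const I v = ennreal C"
    and le: "\<forall>c. 0 < (\<Sum>i\<in>I. c i) \<longrightarrow> measure lborel (cell I v c) \<le> C * (\<Sum>i\<in>I. c i) ^ DIM('a)"
    by (rule polyhedron_const_real[OF I fin])
  have normalize: "(\<Sum>i\<in>I. b i / (\<Sum>i\<in>I. b i)) = 1 \<and> measure lborel (cell I v (\<lambda>i. b i / (\<Sum>i\<in>I. b i))) = C"
    if b: "extremal I v b" for b
  proof -
    have S: "0 < (\<Sum>i\<in>I. b i)" using b by (simp add: extremal_def)
    have "emeasure lborel (cell I v (\<lambda>i. 1 / (\<Sum>i\<in>I. b i) * b i)) = ennreal ((1 / (\<Sum>i\<in>I. b i)) ^ DIM('a)) * emeasure lborel (cell I v b)"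
      by (rule emeasure_cell_scale) (use S in simp)
    then have "measure lborel (cell I v (\<lambda>i. b i / (\<Sum>i\<in>I. b i))) = (1 / (\<Sum>i\<in>I. b i)) ^ DIM('a) * measure lborel (cell I v b)"
      using S by (simp add: measure_def enn2real_mult)
    also have "\<dots> = C" using extremal_measure[OF b C(2,1)] S by (simp add: power_divide)
    finally show ?thesis using S by (simp flip: sum_divide_distrib)
  qed
  obtain t where t: "\<forall>i\<in>I. c i / (\<Sum>i\<in>I. c i) = c' i / (\<Sum>i\<in>I. c' i) + t \<bullet> v i"
    by (rule optimal_unique[OF I(1) polyhedron_const_finite_imp(1)[OF I fin] C(1) v _
        conjunct1[OF normalize[OF c']] conjunct2[OF normalize[OF c']] conjunct1[OF normalize[OF c]] conjunct2[OF normalize[OF c]]])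
       (use le in auto)
  have "c i = (\<Sum>i\<in>I. c i) / (\<Sum>i\<in>I. c' i) * c' i + ((\<Sum>i\<in>I. c i) *\<^sub>R t) \<bullet> v i" if "i \<in> I" for i
  proof -
    have "c i = (\<Sum>i\<in>I. c i) * (c i / (\<Sum>i\<in>I. c i))" using s by simp
    also have "\<dots> = (\<Sum>i\<in>I. c i) * (c' i / (\<Sum>i\<in>I. c' i) + t \<bullet> v i)" using t that by simp
    finally show ?thesis by (simp add: distrib_left)
  qed
  then show ?thesis by (intro that[of "(\<Sum>i\<in>I. c i) *\<^sub>R t"]) blast
qed

section \<open>Subdifferentials of functions on a star\<close>

definition edge_vector :: "('a::euclidean_space \<Rightarrow> 'a \<Rightarrow> real) \<Rightarrow> 'a \<Rightarrow> 'a \<Rightarrow> 'a" where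
  "edge_vector A x y = (A x y)\<^sup>2 *\<^sub>R (y - x)"

definition edge_increment :: "('a::euclidean_space \<Rightarrow> 'a \<Rightarrow> real) \<Rightarrow> ('a \<Rightarrow> real) \<Rightarrow> 'a \<Rightarrow> 'a \<Rightarrow> real" where
  "edge_increment A u x y = (A x y)\<^sup>2 * (u y - u x)"

text \<open>
  The inequality at \<open>z\<close> is multiplied by \<open>A(x,z)\<^sup>2\<close>. With this factor the heights add up to the
  Laplacian, see \<open>graph_laplacian_eq_sum\<close>.
\<close>

lemma prox_subdiff_eq_cell:
  "prox_subdiff V A u x = cell (nbrs V A x) (edge_vector A x) (edge_increment A u x)"
proof -
  have "u x \<le> u z + p \<bullet> (x - z) \<longleftrightarrow> p \<bullet> edge_vector A x z \<le> edge_increment A u x z"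
    if "z \<in> nbrs V A x" for z p
  proof -
    have "0 < (A x z)\<^sup>2" using that by (simp add: nbrs_def)
    then have "p \<bullet> edge_vector A x z \<le> edge_increment A u x z \<longleftrightarrow> p \<bullet> (z - x) \<le> u z - u x"
      by (simp add: edge_vector_def edge_increment_def)
    also have "\<dots> \<longleftrightarrow> u x \<le> u z + p \<bullet> (x - z)" by (auto simp: inner_diff_right)
    finally show ?thesis ..
  qed
  then show ?thesis by (auto simp: prox_subdiff_def mem_cell)
qed

lemma graph_laplacian_eq_sum: "graph_laplacian V A u x = (\<Sum>y\<in>nbrs V A x. edge_increment A u x y)"
  by (simp add: graph_laplacian_def edge_increment_def)

lemma star_const_eq: "star_const V A x = polyhedron_const (nbrs V A x) (edge_vector A x)"
  by (simp add: star_const_def edge_vector_def[abs_def])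

lemma sgn_edge_vector:
  assumes "y \<in> nbrs V A x"
  shows "sgn (edge_vector A x y) = (1 / norm (y - x)) *\<^sub>R (y - x)"
  using assms by (simp add: edge_vector_def sgn_scaleR nbrs_def sgn_div_norm inverse_eq_divide)

lemma norm_edge_vector: "norm (edge_vector A x y) = norm (y - x) * (A x y)\<^sup>2"
  by (simp add: edge_vector_def mult.commute)

lemma prox_face_eq:
  assumes "y \<in> nbrs V A x"
  shows "prox_face V A u x y = face_with_normal (cell (nbrs V A x) (edge_vector A x) (edge_increment A u x)) (sgn (edge_vector A x y))"
  by (simp add: prox_face_def prox_subdiff_eq_cell sgn_edge_vector[OF assms])

lemma edge_increment_surj:
  assumes "A x x = 0"
  obtains u where "\<forall>y\<in>nbrs V A x. edge_increment A u x y = c y"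
  by (rule that[of "\<lambda>y. if y = x then 0 else c y / (A x y)\<^sup>2"])
     (use assms in \<open>auto simp: edge_increment_def nbrs_def\<close>)

lemma extremal_cong:
  assumes "\<forall>i\<in>I. c i = c' i"
  shows "extremal I v c \<longleftrightarrow> extremal I v c'"
proof -
  have "cell I v c = cell I v c'" using assms by (intro cell_cong) blast
  moreover have "sum c I = sum c' I" using assms by (intro sum.cong) auto
  ultimately show ?thesis by (simp only: extremal_def)
qed

lemma achieves_equality_iff_extremal:
  assumes I: "finite (nbrs V A x)" "nbrs V A x \<noteq> {}"
  shows "achieves_equality V A u x \<longleftrightarrow> extremal (nbrs V A x) (edge_vector A x) (edge_increment A u x)"
    (is "?L \<longleftrightarrow> ?R")
proof
  assume L: ?L
  then have fin: "star_const V A x < \<infinity>"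
    by (auto simp: achieves_equality_def prox_nondegenerate_def prox_bound_def less_top split: if_splits)
  then have eq: "emeasure lborel (prox_subdiff V A u x) = star_const V A x * ennreal (max 0 (graph_laplacian V A u x) ^ DIM('a))"
    using L by (auto simp: achieves_equality_def prox_bound_def)
  have "0 < graph_laplacian V A u x"
  proof (rule ccontr)
    assume "\<not> 0 < graph_laplacian V A u x"
    then have zero: "max 0 (graph_laplacian V A u x) ^ DIM('a) = 0" by simp
    have "0 < emeasure lborel (prox_subdiff V A u x)"
      using L unfolding achieves_equality_def prox_nondegenerate_def by blast
    then show False unfolding eq zero by simp
  qed
  then show ?R using fin eq
    by (simp add: extremal_def prox_subdiff_eq_cell star_const_eq graph_laplacian_eq_sum)
next
  assume R: ?R
  then have fin: "star_const V A x < \<infinity>" and s: "0 < graph_laplacian V A u x"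
    and eq: "emeasure lborel (prox_subdiff V A u x) = star_const V A x * ennreal (graph_laplacian V A u x ^ DIM('a))"
    by (auto simp: extremal_def prox_subdiff_eq_cell star_const_eq graph_laplacian_eq_sum)
  have "0 < star_const V A x" unfolding star_const_eq by (rule polyhedron_const_pos[OF I])
  then have "0 < emeasure lborel (prox_subdiff V A u x)" "emeasure lborel (prox_subdiff V A u x) < \<infinity>"
    unfolding eq using fin s by (auto simp: ennreal_zero_less_mult_iff ennreal_mult_less_top)
  then show ?L
    using eq fin s by (auto simp: achieves_equality_def prox_nondegenerate_def prox_bound_def)
qed

lemma ennreal_divide_eq_iff:
  fixes a b :: ennreal
  assumes "0 < k"
  shows "a / ennreal k = b \<longleftrightarrow> a = b * ennreal k"
proof -
  have k: "ennreal k \<noteq> 0" "ennreal k < top" using assms by auto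
  have 1: "a / ennreal k * ennreal k = a" for a
    using ennreal_divide_times[of a "ennreal k" "ennreal k"] ennreal_divide_self[OF k] by simp
  have 2: "b * ennreal k / ennreal k = b" for b
    using ennreal_times_divide[of b "ennreal k" "ennreal k"] ennreal_divide_self[OF k] by simp
  show ?thesis using 1 2 by metis
qed

lemma facet_areas_proportional_iff:
  assumes x: "x \<notin> nbrs V A x"
  shows "facet_areas_proportional V A u x \<longleftrightarrow> (\<exists>\<alpha>>0. \<forall>y\<in>nbrs V A x.
    hausdorff_measure (DIM('a) - 1) (face_with_normal (cell (nbrs V A x) (edge_vector A x) (edge_increment A u x)) (sgn (edge_vector A x y)))
      = ennreal (\<alpha> * norm (edge_vector (A :: 'a::euclidean_space \<Rightarrow> _) x y)))"
proof -
  have "hausdorff_measure (DIM('a) - 1) (prox_face V A u x y) / ennreal (norm (y - x) * (A x y)\<^sup>2) = ennreal \<alpha>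
    \<longleftrightarrow> hausdorff_measure (DIM('a) - 1) (face_with_normal (cell (nbrs V A x) (edge_vector A x) (edge_increment A u x)) (sgn (edge_vector A x y)))
      = ennreal (\<alpha> * norm (edge_vector A x y))" if y: "y \<in> nbrs V A x" and \<alpha>: "0 < \<alpha>" for y \<alpha>
  proof -
    have "y \<noteq> x" using x y by blast
    then have pos: "0 < norm (y - x) * (A x y)\<^sup>2" using y by (simp add: nbrs_def)
    show ?thesis
      unfolding ennreal_divide_eq_iff[OF pos] prox_face_eq[OF y] norm_edge_vector
      using \<alpha> by (simp add: ennreal_mult)
  qed
  then show ?thesis unfolding facet_areas_proportional_def by (metis (no_types, lifting))
qed

text \<open>
  Real right-hand sides, so that the condition can be compared with \<open>facet_areas_proportional_iff\<close>.
\<close>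

lemma facet_areas_sharp_iff:
  assumes x: "x \<notin> nbrs V A x" and C: "star_const V A x = ennreal C" "0 < C"
  shows "facet_areas_sharp V A u x \<longleftrightarrow> graph_laplacian V A u x \<noteq> 0 \<and> (\<forall>y\<in>nbrs V A x.
    hausdorff_measure (DIM('a) - 1) (face_with_normal (cell (nbrs V A x) (edge_vector A x) (edge_increment A u x)) (sgn (edge_vector A x y)))
      = ennreal (real DIM('a) * C * \<bar>graph_laplacian V A u x\<bar> ^ (DIM('a) - 1) * norm (edge_vector (A :: 'a::euclidean_space \<Rightarrow> _) x y)))"
proof (cases "graph_laplacian V A u x = 0")
  case False
  let ?s = "\<bar>graph_laplacian V A u x\<bar> ^ (DIM('a) - 1)"
  have s: "0 < ?s" using False by simp
  have rhs: "of_nat DIM('a) * ennreal C * ennreal (norm (y - x) * (A x y)\<^sup>2) * ennreal ?s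
      = ennreal (real DIM('a) * C * ?s * norm (edge_vector A x y))" for y
    using C s by (simp add: norm_edge_vector ennreal_of_nat_eq_real_of_nat mult.commute mult.left_commute flip: ennreal_mult)
  have "hausdorff_measure (DIM('a) - 1) (prox_face V A u x y) / ennreal ?s
        = of_nat DIM('a) * star_const V A x * ennreal (norm (y - x) * (A x y)\<^sup>2)
    \<longleftrightarrow> hausdorff_measure (DIM('a) - 1) (face_with_normal (cell (nbrs V A x) (edge_vector A x) (edge_increment A u x)) (sgn (edge_vector A x y)))
      = ennreal (real DIM('a) * C * ?s * norm (edge_vector A x y))" if y: "y \<in> nbrs V A x" for y
    unfolding ennreal_divide_eq_iff[OF s] prox_face_eq[OF y] C(1) rhs ..
  then show ?thesis unfolding facet_areas_sharp_def using False C by auto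
qed (simp add: facet_areas_sharp_def)

lemma graph_laplacian_affine:
  assumes I: "finite (nbrs V A x)" and l: "affine_on (star V A x) l"
  obtains a where "graph_laplacian V A l x = a \<bullet> (\<Sum>y\<in>nbrs V A x. edge_vector A x y)"
proof -
  obtain a b where ab: "\<forall>z\<in>star V A x. l z = a \<bullet> z + b" using l by (auto simp: affine_on_def)
  then have "edge_increment A l x y = a \<bullet> edge_vector A x y" if "y \<in> nbrs V A x" for y
    using that by (simp add: edge_increment_def edge_vector_def star_def inner_diff_right)
  then show ?thesis by (intro that[of a]) (simp add: graph_laplacian_eq_sum inner_sum_right)
qed

text \<open>
  The Laplacian of \<open>z \<mapsto> a \<bullet> z + b\<close> is the inner product of \<open>a\<close> with the sum of the edge vectors; to
  show that this sum is 0, it is itself taken for \<open>a\<close>.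
\<close>

lemma linear_precision_iff:
  assumes I: "finite (nbrs V A x)"
  shows "(\<forall>l. affine_on (star V A x) l \<longrightarrow> graph_laplacian V A l x = 0)
    \<longleftrightarrow> (\<Sum>y\<in>nbrs V A x. edge_vector A x y) = 0"
proof
  assume "(\<Sum>y\<in>nbrs V A x. edge_vector A x y) = 0"
  then show "\<forall>l. affine_on (star V A x) l \<longrightarrow> graph_laplacian V A l x = 0"
    using graph_laplacian_affine[OF I] by (metis inner_zero_right)
next
  define w where "w = (\<Sum>y\<in>nbrs V A x. edge_vector A x y)"
  assume lin: "\<forall>l. affine_on (star V A x) l \<longrightarrow> graph_laplacian V A l x = 0"
  have "affine_on (star V A x) (\<lambda>z. w \<bullet> z)" unfolding affine_on_def by (intro exI[of _ w] exI[of _ 0]) simp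
  then have "0 = graph_laplacian V A (\<lambda>z. w \<bullet> z) x" using lin by simp
  also have "\<dots> = w \<bullet> w"
    unfolding graph_laplacian_eq_sum edge_increment_def
    by (simp add: w_def edge_vector_def inner_sum_right inner_diff_right)
  finally show "(\<Sum>y\<in>nbrs V A x. edge_vector A x y) = 0" by (simp add: w_def)
qed

lemma span_edge_vectors:
  "span (edge_vector A x ` nbrs V A x) = span ((\<lambda>y. y - x) ` nbrs V A x)"
proof (rule antisym; rule span_minimal)
  show "edge_vector A x ` nbrs V A x \<subseteq> span ((\<lambda>y. y - x) ` nbrs V A x)"
    unfolding edge_vector_def by (intro image_subsetI span_scale span_base imageI)
  show "(\<lambda>y. y - x) ` nbrs V A x \<subseteq> span (edge_vector A x ` nbrs V A x)"
  proof
    fix z assume "z \<in> (\<lambda>y. y - x) ` nbrs V A x"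
    then obtain y where y: "y \<in> nbrs V A x" "z = y - x" by auto
    then have z: "z = (1 / (A x y)\<^sup>2) *\<^sub>R edge_vector A x y" by (simp add: edge_vector_def nbrs_def)
    show "z \<in> span (edge_vector A x ` nbrs V A x)" unfolding z by (intro span_scale span_base imageI y(1))
  qed
qed (rule subspace_span)+

theorem proposition3p1:
  fixes V :: "'a::euclidean_space set" and A :: "'a \<Rightarrow> 'a \<Rightarrow> real" and x :: 'a
  assumes "discrete V"
    and "\<forall>y\<in>V. \<forall>z\<in>V. A y z = A z y"
    and "\<forall>y\<in>V. finite (nbrs V A y)"
    and "x \<in> V"
    and no_loop: "A x x = 0"
    and not_isolated: "nbrs V A x \<noteq> {}"
  shows
    "(\<forall>u. emeasure lborel (prox_subdiff V A u x) \<le> prox_bound V A u x)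
     \<and>
     (inj_on (\<lambda>y. (1 / norm (y - x)) *\<^sub>R (y - x)) (nbrs V A x) \<longrightarrow>
       (\<forall>u. (achieves_equality V A u x \<longleftrightarrow> facet_areas_sharp V A u x)
          \<and> (DIM('a) \<ge> 2 \<or> prox_nondegenerate V A u x \<longrightarrow>
               (achieves_equality V A u x \<longleftrightarrow> facet_areas_proportional V A u x))))
     \<and>
     ((\<exists>u. achieves_equality V A u x) \<longleftrightarrow>
        span ((\<lambda>y. y - x) ` nbrs V A x) = UNIV \<and>
        (\<Sum>y\<in>nbrs V A x. (A x y)\<^sup>2 *\<^sub>R (y - x)) = 0)
     \<and>
     ((\<exists>u. achieves_equality V A u x) \<longleftrightarrow>
        span ((\<lambda>y. y - x) ` nbrs V A x) = UNIV \<and>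
        (\<forall>l. affine_on (star V A x) l \<longrightarrow> graph_laplacian V A l x = 0))
     \<and>
     (\<forall>u w. achieves_equality V A u x \<and> achieves_equality V A w x \<longrightarrow>
        affine_on (star V A x)
          (\<lambda>z. u z - graph_laplacian V A u x / graph_laplacian V A w x * w z))"
proof -
  let ?I = "nbrs V A x" and ?v = "edge_vector A x"
  have I: "finite ?I" "?I \<noteq> {}" using assms by auto
  have x: "x \<notin> ?I" using no_loop by (simp add: nbrs_def)
  have v: "?v y \<noteq> 0" if "y \<in> ?I" for y using that x by (auto simp: edge_vector_def nbrs_def)
  note ext = achieves_equality_iff_extremal[OF I]
  have bound: "emeasure lborel (prox_subdiff V A u x) \<le> prox_bound V A u x" for u
    using emeasure_cell_bound[OF I v, where c="edge_increment A u x"]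
    by (auto simp: prox_bound_def star_const_eq prox_subdiff_eq_cell graph_laplacian_eq_sum less_top)
  have existence: "(\<exists>u. achieves_equality V A u x) \<longleftrightarrow> span (?v ` ?I) = UNIV \<and> (\<Sum>y\<in>?I. ?v y) = 0"
    unfolding extremal_exists_iff[OF I, symmetric] ext
  proof
    assume "\<exists>c. extremal ?I ?v c"
    then obtain c where c: "extremal ?I ?v c" by blast
    obtain u where "\<forall>y\<in>?I. edge_increment A u x y = c y" by (rule edge_increment_surj[of A x, OF no_loop])
    then have "extremal ?I ?v (edge_increment A u x)" using c extremal_cong by blast
    then show "\<exists>u. extremal ?I ?v (edge_increment A u x)" by blast
  qed blast
  have facets: "(achieves_equality V A u x \<longleftrightarrow> facet_areas_sharp V A u x) \<and>
      (DIM('a) \<ge> 2 \<or> prox_nondegenerate V A u x \<longrightarrow> (achieves_equality V A u x \<longleftrightarrow> facet_areas_proportional V A u x))"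
    if inj0: "inj_on (\<lambda>y. (1 / norm (y - x)) *\<^sub>R (y - x)) ?I" for u
  proof -
    let ?c = "edge_increment A u x" and ?s = "graph_laplacian V A u x"
    have inj: "inj_on (\<lambda>y. sgn (?v y)) ?I" using inj0 by (simp add: sgn_edge_vector cong: inj_on_cong)
    have a_b: "facet_areas_sharp V A u x" if a: "achieves_equality V A u x"
    proof -
      have e: "extremal ?I ?v ?c" using a ext by blast
      then have fin: "polyhedron_const ?I ?v < \<infinity>" and s: "0 < ?s" by (auto simp: extremal_def graph_laplacian_eq_sum)
      obtain C where C: "0 < C" "polyhedron_const ?I ?v = ennreal C" by (rule polyhedron_const_real[OF I fin])
      have "star_const V A x = ennreal C" using C(2) by (simp only: star_const_eq)
      note sharp = facet_areas_sharp_iff[OF x this C(1), of u]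
      have H: "hausdorff_measure (DIM('a) - 1) (face_with_normal (cell ?I ?v ?c) (sgn (?v y)))
          = ennreal (real DIM('a) * C * \<bar>?s\<bar> ^ (DIM('a) - 1) * norm (?v y))" if "y \<in> ?I" for y
        using extremal_facet_areas[OF I v inj e C(2) that] s by (simp add: graph_laplacian_eq_sum)
      show ?thesis unfolding sharp by (intro conjI ballI H) (use s in simp)
    qed
    have b_c: "facet_areas_proportional V A u x" and b_pos: "DIM('a) = 1 \<longrightarrow> prox_nondegenerate V A u x"
      if b: "facet_areas_sharp V A u x"
    proof -
      have fin: "polyhedron_const ?I ?v < \<infinity>" and s: "?s \<noteq> 0" using b by (auto simp: facet_areas_sharp_def star_const_eq)
      obtain C where C: "0 < C" "polyhedron_const ?I ?v = ennreal C" by (rule polyhedron_const_real[OF I fin])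
      have "star_const V A x = ennreal C" using C(2) by (simp only: star_const_eq)
      note B = b[unfolded facet_areas_sharp_iff[OF x this C(1), of u]]
      have \<alpha>: "0 < real DIM('a) * C * \<bar>?s\<bar> ^ (DIM('a) - 1)" using s C by simp
      show "facet_areas_proportional V A u x"
        unfolding facet_areas_proportional_iff[OF x] using B \<alpha> by blast
      obtain y where y: "y \<in> ?I" using I by blast
      have "face_with_normal (cell ?I ?v ?c) (sgn (?v y)) \<noteq> {}"
      proof
        assume "face_with_normal (cell ?I ?v ?c) (sgn (?v y)) = {}"
        then have "ennreal (real DIM('a) * C * \<bar>?s\<bar> ^ (DIM('a) - 1) * norm (?v y)) = 0"
          using B y hausdorff_measure_empty[where 'a='a] by metis
        moreover have "0 < real DIM('a) * C * \<bar>?s\<bar> ^ (DIM('a) - 1) * norm (?v y)"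
          by (rule mult_pos_pos[OF \<alpha>]) (use v[OF y] in simp)
        ultimately show False by (simp only: ennreal_eq_0_iff not_le)
      qed
      then obtain p where p: "p \<in> cell ?I ?v ?c" by (auto simp: face_with_normal_def)
      have P: "no_recession ?I ?v" "(\<Sum>y\<in>?I. ?v y) = 0" using polyhedron_const_finite_imp[OF I fin] by auto
      show "DIM('a) = 1 \<longrightarrow> prox_nondegenerate V A u x"
      proof
        assume "DIM('a) = 1"
        then have "0 < emeasure lborel (cell ?I ?v ?c)"
          using s by (intro line_cell_nondegenerate[OF _ I(1) v inj P(2) _ p]) (auto simp: graph_laplacian_eq_sum)
        then show "prox_nondegenerate V A u x"
          using emeasure_compact_finite[OF compact_cell[OF I(1) P(1)], of ?c]
          by (simp add: prox_nondegenerate_def prox_subdiff_eq_cell)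
      qed
    qed
    have c_a: "achieves_equality V A u x" if c: "facet_areas_proportional V A u x" and nd: "2 \<le> DIM('a) \<or> prox_nondegenerate V A u x"
    proof -
      obtain \<alpha> where "0 < \<alpha>" "\<forall>y\<in>?I. hausdorff_measure (DIM('a) - 1) (face_with_normal (cell ?I ?v ?c) (sgn (?v y)))
          = ennreal (\<alpha> * norm (?v y))"
        using c[unfolded facet_areas_proportional_iff[OF x]] by blast
      then show ?thesis
        unfolding ext using nd
        by (intro extremal_of_proportional_facets[OF I v inj]) (auto simp: prox_nondegenerate_def prox_subdiff_eq_cell)
    qed
    have "2 \<le> DIM('a) \<or> DIM('a) = 1" using DIM_positive[where 'a='a] by linarith
    then show ?thesis using a_b b_c b_pos c_a by blast
  qed
  have uniqueness: "affine_on (star V A x) (\<lambda>z. u z - graph_laplacian V A u x / graph_laplacian V A w x * w z)"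
    if uw: "achieves_equality V A u x" "achieves_equality V A w x" for u w
  proof -
    let ?\<rho> = "graph_laplacian V A u x / graph_laplacian V A w x"
    obtain t where t: "\<forall>y\<in>?I. edge_increment A u x y = ?\<rho> * edge_increment A w x y + t \<bullet> ?v y"
      unfolding graph_laplacian_eq_sum
      by (rule extremal_unique[OF I v uw(1)[unfolded ext] uw(2)[unfolded ext]])
    have "u z - ?\<rho> * w z = t \<bullet> z + (u x - ?\<rho> * w x - t \<bullet> x)" if z: "z \<in> star V A x" for z
    proof (cases "z = x")
      case False
      then have z: "z \<in> ?I" using z by (simp add: star_def)
      then have "(A x z)\<^sup>2 * (u z - u x) = (A x z)\<^sup>2 * (?\<rho> * (w z - w x) + t \<bullet> (z - x))"
        using t by (simp add: edge_increment_def edge_vector_def distrib_left mult.left_commute)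
      then have "u z - u x = ?\<rho> * (w z - w x) + t \<bullet> (z - x)" using z by (simp add: nbrs_def)
      then show ?thesis by (simp add: right_diff_distrib inner_diff_right)
    qed simp
    then show ?thesis unfolding affine_on_def by blast
  qed
  have sum_eq: "(\<Sum>y\<in>?I. (A x y)\<^sup>2 *\<^sub>R (y - x)) = (\<Sum>y\<in>?I. ?v y)" by (simp add: edge_vector_def)
  show ?thesis
    unfolding linear_precision_iff[OF I(1)] sum_eq span_edge_vectors[symmetric]
    using bound existence facets uniqueness by blast
qed

end
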